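(* Let $\varphi:\mathcal O_q\to O_q\otimes\mathbb F[z_1,z_2,\ldots]$ be the algebra homomorphism that sends, for $n\in\mathbb N$, \begin{align*} \mathcal W_{-n}&\mapsto\sum_{k=0}^nW_{k-n}\otimes z_k, & \mathcal W_{n+1}&\mapsto\sum_{k=0}^nW_{n+1-k}\otimes z_k,\\ \mathcal G_n&\mapsto\sum_{k=0}^nG_{n-k}\otimes z_k, & \mathcal{\tilde G}_n&\mapsto\sum_{k=0}^n\tilde G_{n-k}\otimes z_k. \end{align*} Then $\varphi$ is an algebra isomorphism.
   Context: $\mathbb F$ is a field; $q\in\mathbb F$ is nonzero and not a root of unity; $\mathbb N=\{0,1,2,\ldots\}$; $[n]_q=(q^n-q^{-n})/(q-q^{-1})$. Algebras are associative, unital, over $\mathbb F$. $[X,Y]=XY-YX$ and $[X,Y]_r=rXY-r^{-1}YX$ for nonzero $r \in \mathbb F$. $\mathbb F[z_1,z_2,\ldots]$ is the polynomial algebra in countably many commuting variables, with $z_0=1$. The $q$-Onsager algebra $O_q$ has generators $W_0,W_1$ and relations $[W_0,[W_0,[W_0,W_1]_q]_{q^{-1}}]=(q^2-q^{-2})^2[W_1,W_0]$ and $[W_1,[W_1,[W_1,W_0]_q]_{q^{-1}}]=(q^2-q^{-2})^2[W_0,W_1]$. The algebra $\mathcal O_q$ has generators $\mathcal W_{-k},\mathcal W_{k+1},\mathcal G_{k+1},\mathcal{\tilde G}_{k+1}$ ($k\in\mathbb N$) and the following relations for $k,\ell\in\mathbb N$, where $\rho=-(q^2-q^{-2})^2$: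 $[\mathcal W_0,\mathcal W_{k+1}]=[\mathcal W_{-k},\mathcal W_1]=(\mathcal{\tilde G}_{k+1}-\mathcal G_{k+1})/(q+q^{-1})$; $[\mathcal W_0,\mathcal G_{k+1}]_q=[\mathcal{\tilde G}_{k+1},\mathcal W_0]_q=\rho\mathcal W_{-k-1}-\rho\mathcal W_{k+1}$; $[\mathcal G_{k+1},\mathcal W_1]_q=[\mathcal W_1,\mathcal{\tilde G}_{k+1}]_q=\rho\mathcal W_{k+2}-\rho\mathcal W_{-k}$; $[\mathcal W_{-k},\mathcal W_{-\ell}]=0$; $[\mathcal W_{k+1},\mathcal W_{\ell+1}]=0$; $[\mathcal W_{-k},\mathcal W_{\ell+1}]+[\mathcal W_{k+1},\mathcal W_{-\ell}]=0$; $[\mathcal W_{-k},\mathcal G_{\ell+1}]+[\mathcal G_{k+1},\mathcal W_{-\ell}]=0$; $[\mathcal W_{-k},\mathcal{\tilde G}_{\ell+1}]+[\mathcal{\tilde G}_{k+1},\mathcal W_{-\ell}]=0$; $[\mathcal W_{k+1},\mathcal G_{\ell+1}]+[\mathcal G_{k+1},\mathcal W_{\ell+1}]=0$; $[\mathcal W_{k+1},\mathcal{\tilde G}_{\ell+1}]+[\mathcal{\tilde G}_{k+1},\mathcal W_{\ell+1}]=0$; $[\mathcal G_{k+1},\mathcal G_{\ell+1}]=0$; $[\mathcal{\tilde G}_{k+1},\mathcal{\tilde G}_{\ell+1}]=0$; $[\mathcal{\tilde G}_{k+1},\mathcal G_{\ell+1}]+[\mathcal G_{k+1},\mathcal{\tilde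 G}_{\ell+1}]=0$. Also $\mathcal G_0=\mathcal{\tilde G}_0=-(q-q^{-1})[2]_q^2$. Set $\mathcal W^-(t)=\sum_{n\in\mathbb N}\mathcal W_{-n}t^n$, $\mathcal W^+(t)=\sum_{n\in\mathbb N}\mathcal W_{n+1}t^n$, $\mathcal G(t)=\sum_{n\in\mathbb N}\mathcal G_nt^n$, $\mathcal{\tilde G}(t)=\sum_{n\in\mathbb N}\mathcal{\tilde G}_nt^n$. Let $S=(q+q^{-1})\sum_{\ell\in\mathbb N}(-1)^\ell q^{-2\ell-1}t^{2\ell+1}$ (that is, $\frac{q+q^{-1}}{q^{-1}t+qt^{-1}}$) and $T=(q+q^{-1})\sum_{\ell\in\mathbb N}(-1)^\ell q^{2\ell+1}t^{2\ell+1}$ (that is, $\frac{q+q^{-1}}{qt+q^{-1}t^{-1}}$). Define $\Psi(t)=t^{-1}ST\,\mathcal W^-(S)\mathcal W^+(T)+tST\,\mathcal W^+(S)\mathcal W^-(T)-q^2ST\,\mathcal W^-(S)\mathcal W^-(T)-q^{-2}ST\,\mathcal W^+(S)\mathcal W^+(T)+(q^2-q^{-2})^{-2}\mathcal G(S)\mathcal{\tilde G}(T)$ and $\sum_{n\in\mathbb N}\mathcal Z^\vee_nt^n=\mathcal Z^\vee(t)=[2]_q^{-2}\Psi(t)$; one has $\mathcal Z^\vee_0=1$ and each $\mathcal Z^\vee_n$ is central in $\mathcal O_q$. Known from earlier work: there is an algebra isomorphism $\phi:O_q\otimes\mathbb F[z_1,z_2,\ldots]\to\mathcal O_q$ that sends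 $W_0\otimes1\mapsto\mathcal W_0$, $W_1\otimes1\mapsto\mathcal W_1$, $1\otimes z_n\mapsto\mathcal Z^\vee_n$ ($n\ge1$). Consequently there is an algebra homomorphism $\gamma:\mathcal O_q\to O_q$ that sends $\mathcal W_0\mapsto W_0$, $\mathcal W_1\mapsto W_1$, $\mathcal Z^\vee_n\mapsto0$ ($n\ge1$). The alternating generators of $O_q$ are $W_{-k}=\gamma(\mathcal W_{-k})$, $W_{k+1}=\gamma(\mathcal W_{k+1})$, $G_{k+1}=\gamma(\mathcal G_{k+1})$, $\tilde G_{k+1}=\gamma(\mathcal{\tilde G}_{k+1})$ for $k\in\mathbb N$, and $G_0=\tilde G_0=-(q-q^{-1})[2]_q^2$. The algebra homomorphism $\varphi$ in the claim exists because the alternating generators of $O_q$ satisfy the analogs of the defining relations of $\mathcal O_q$. *)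

theory Defs
  imports
    "HOL-Library.Poly_Mapping"
    "HOL-Computational_Algebra.Formal_Power_Series"
    "HOL-Algebra.Module"
    "HOL-Algebra.QuotRing"
begin

unbundle fps_syntax

section \<open>Algebras over a field\<close>

text \<open>
  The ground field is a type \<open>'a::field\<close>; an \<open>'a\<close>-algebra (associative, unital, not necessarily
  commutative) is a record of type \<open>('a, 'b) module\<close>, all of whose operations are used.
\<close>

definition alg_hom :: "('a::field, 'b) module \<Rightarrow> ('a, 'c) module \<Rightarrow> ('b \<Rightarrow> 'c) set" where
  "alg_hom A B = {h \<in> ring_hom A B. \<forall>c. \<forall>x\<in>carrier A. h (c \<odot>\<^bsub>A\<^esub> x) = c \<odot>\<^bsub>B\<^esub> h x}"

definition alg_iso :: "('a::field, 'b) module \<Rightarrow> ('a, 'c) module \<Rightarrow> ('b \<Rightarrow> 'c) set" where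
  "alg_iso A B = {h \<in> alg_hom A B. bij_betw h (carrier A) (carrier B)}"

text \<open>The quotient by a two-sided ideal; its ring part is that of \<open>A Quot I\<close>.\<close>

definition quot_alg :: "('a::field, 'b) module \<Rightarrow> 'b set \<Rightarrow> ('a, 'b set) module" where
  "quot_alg A I =
    \<lparr>carrier = carrier (A Quot I), mult = mult (A Quot I), one = one (A Quot I),
     zero = zero (A Quot I), add = add (A Quot I),
     smult = (\<lambda>c X. \<Union>x\<in>X. I +>\<^bsub>A\<^esub> (c \<odot>\<^bsub>A\<^esub> x))\<rparr>"

text \<open>The monoid algebra of \<open>'m\<close>, whose (not necessarily commutative) operation is written \<open>+\<close>.\<close>

definition monoid_alg :: "('a::field, 'm::monoid_add \<Rightarrow>\<^sub>0 'a) module" where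
  "monoid_alg =
    \<lparr>carrier = UNIV, mult = (*), one = 1, zero = 0, add = (+),
     smult = (\<lambda>c. Poly_Mapping.map ((*) c))\<rparr>"

subsection \<open>Presentations by generators and relations\<close>

datatype 'x word = Word (letters: "'x list")

instantiation word :: (type) monoid_add
begin
definition zero_word :: "'a word" where "0 = Word []"
definition plus_word :: "'a word \<Rightarrow> 'a word \<Rightarrow> 'a word" where
  "u + v = Word (letters u @ letters v)"
instance by standard (simp_all add: zero_word_def plus_word_def)
end

type_synonym ('x, 'a) free_alg = "'x word \<Rightarrow>\<^sub>0 'a"

definition gen :: "'x \<Rightarrow> ('x, 'a::field) free_alg" where
  "gen x = Poly_Mapping.single (Word [x]) 1"

definition const :: "'a::field \<Rightarrow> ('x, 'a) free_alg" where
  "const c = Poly_Mapping.single 0 c"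

text \<open>A relation \<open>l = r\<close> is given as the pair \<open>(l, r)\<close>.\<close>

definition rel_ideal ::
    "(('x, 'a::field) free_alg \<times> ('x, 'a) free_alg) set \<Rightarrow> ('x, 'a) free_alg set" where
  "rel_ideal R = Idl\<^bsub>monoid_alg :: ('a, ('x, 'a) free_alg) module\<^esub> {l - r | l r. (l, r) \<in> R}"

definition presented_alg ::
    "(('x, 'a::field) free_alg \<times> ('x, 'a) free_alg) set \<Rightarrow> ('a, ('x, 'a) free_alg set) module" where
  "presented_alg R = quot_alg monoid_alg (rel_ideal R)"

definition presented_cls ::
    "(('x, 'a::field) free_alg \<times> ('x, 'a) free_alg) set \<Rightarrow> ('x, 'a) free_alg \<Rightarrow>
      ('x, 'a) free_alg set" where
  "presented_cls R p = rel_ideal R +>\<^bsub>monoid_alg :: ('a, ('x, 'a) free_alg) module\<^esub> p"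

subsection \<open>Polynomials in countably many variables\<close>

abbreviation polys :: "('a::field, (nat \<Rightarrow>\<^sub>0 nat) \<Rightarrow>\<^sub>0 'a) module" where
  "polys \<equiv> monoid_alg"

text \<open>The variables are \<open>pvar 1, pvar 2, \<dots>\<close>, where \<open>pvar (i + 1)\<close> has exponent index \<open>i\<close>.\<close>

definition pvar :: "nat \<Rightarrow> (nat \<Rightarrow>\<^sub>0 nat) \<Rightarrow>\<^sub>0 'a::field" where
  "pvar n = (case n of 0 \<Rightarrow> 1 | Suc i \<Rightarrow> Poly_Mapping.single (Poly_Mapping.single i 1) 1)"

subsection \<open>Tensor products\<close>

text \<open>
  The free vector space on the set of pairs, with the product \<open>(a, b) (a', b') = (a a', b b')\<close>.
  The tensor product is its quotient by the bilinearity relators. A product of a pair with a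
  relator is again a relator, so that the two-sided ideal they generate is their linear span.
\<close>

definition pair_alg ::
    "('a::field, 'b) module \<Rightarrow> ('a, 'c) module \<Rightarrow> ('a, ('b \<times> 'c) \<Rightarrow>\<^sub>0 'a) module" where
  "pair_alg A B =
    \<lparr>carrier = {p. Poly_Mapping.keys p \<subseteq> carrier A \<times> carrier B},
     mult = (\<lambda>p r. \<Sum>u\<in>Poly_Mapping.keys p. \<Sum>v\<in>Poly_Mapping.keys r.
       Poly_Mapping.single (fst u \<otimes>\<^bsub>A\<^esub> fst v, snd u \<otimes>\<^bsub>B\<^esub> snd v)
         (Poly_Mapping.lookup p u * Poly_Mapping.lookup r v)),
     one = Poly_Mapping.single (\<one>\<^bsub>A\<^esub>, \<one>\<^bsub>B\<^esub>) 1,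
     zero = 0, add = (+), smult = (\<lambda>c. Poly_Mapping.map ((*) c))\<rparr>"

definition tensor_relators ::
    "('a::field, 'b) module \<Rightarrow> ('a, 'c) module \<Rightarrow> (('b \<times> 'c) \<Rightarrow>\<^sub>0 'a) set" where
  "tensor_relators A B = (let e = (\<lambda>a b. Poly_Mapping.single (a, b) 1) in
    {e (a \<oplus>\<^bsub>A\<^esub> a') b - e a b - e a' b | a a' b.
       a \<in> carrier A \<and> a' \<in> carrier A \<and> b \<in> carrier B} \<union>
    {e a (b \<oplus>\<^bsub>B\<^esub> b') - e a b - e a b' | a b b'.
       a \<in> carrier A \<and> b \<in> carrier B \<and> b' \<in> carrier B} \<union>
    {e (c \<odot>\<^bsub>A\<^esub> a) b - Poly_Mapping.single (a, b) c | a b c. a \<in> carrier A \<and> b \<in> carrier B} \<union>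
    {e a (c \<odot>\<^bsub>B\<^esub> b) - Poly_Mapping.single (a, b) c | a b c. a \<in> carrier A \<and> b \<in> carrier B})"

definition tensor_ideal ::
    "('a::field, 'b) module \<Rightarrow> ('a, 'c) module \<Rightarrow> (('b \<times> 'c) \<Rightarrow>\<^sub>0 'a) set" where
  "tensor_ideal A B = Idl\<^bsub>pair_alg A B\<^esub> (tensor_relators A B)"

definition tensor_alg ::
    "('a::field, 'b) module \<Rightarrow> ('a, 'c) module \<Rightarrow> ('a, (('b \<times> 'c) \<Rightarrow>\<^sub>0 'a) set) module" where
  "tensor_alg A B = quot_alg (pair_alg A B) (tensor_ideal A B)"

definition tensor ::
    "('a::field, 'b) module \<Rightarrow> ('a, 'c) module \<Rightarrow> 'b \<Rightarrow> 'c \<Rightarrow> (('b \<times> 'c) \<Rightarrow>\<^sub>0 'a) set" where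
  "tensor A B a b = tensor_ideal A B +>\<^bsub>pair_alg A B\<^esub> Poly_Mapping.single (a, b) 1"

section \<open>The \<open>q\<close>-Onsager algebra and its alternating central extension\<close>

definition qint :: "'a::field \<Rightarrow> nat \<Rightarrow> 'a" where
  "qint q n = (q ^ n - inverse q ^ n) / (q - inverse q)"

definition comm :: "('x, 'a::field) free_alg \<Rightarrow> ('x, 'a) free_alg \<Rightarrow> ('x, 'a) free_alg" where
  "comm X Y = X * Y - Y * X"

definition qcomm :: "'a::field \<Rightarrow> ('x, 'a) free_alg \<Rightarrow> ('x, 'a) free_alg \<Rightarrow> ('x, 'a) free_alg" where
  "qcomm r X Y = const r * X * Y - const (inverse r) * Y * X"

subsection \<open>The \<open>q\<close>-Onsager algebra\<close>

datatype onsager_gen = OGen0 | OGen1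

definition onsager_rels ::
    "'a::field \<Rightarrow> ((onsager_gen, 'a) free_alg \<times> (onsager_gen, 'a) free_alg) set" where
  "onsager_rels q = (let w0 = gen OGen0; w1 = gen OGen1; c = const ((q\<^sup>2 - inverse q ^ 2)\<^sup>2) in
    {(comm w0 (qcomm (inverse q) w0 (qcomm q w0 w1)), c * comm w1 w0),
     (comm w1 (qcomm (inverse q) w1 (qcomm q w1 w0)), c * comm w0 w1)})"

definition onsager :: "'a::field \<Rightarrow> ('a, (onsager_gen, 'a) free_alg set) module" where
  "onsager q = presented_alg (onsager_rels q)"

definition onsager_W0 :: "'a::field \<Rightarrow> (onsager_gen, 'a) free_alg set" where
  "onsager_W0 q = presented_cls (onsager_rels q) (gen OGen0)"

definition onsager_W1 :: "'a::field \<Rightarrow> (onsager_gen, 'a) free_alg set" where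
  "onsager_W1 q = presented_cls (onsager_rels q) (gen OGen1)"

subsection \<open>The alternating central extension\<close>

text \<open>
  \<open>Wminus k\<close>, \<open>Wplus k\<close>, \<open>Gplus k\<close>, \<open>Gtilde k\<close> are the generators with subscripts
  \<open>-k\<close>, \<open>k + 1\<close>, \<open>k + 1\<close>, \<open>k + 1\<close>, respectively.
\<close>

datatype ace_gen = Wminus nat | Wplus nat | Gplus nat | Gtilde nat

definition G_zero :: "'a::field \<Rightarrow> 'a" where
  "G_zero q = - (q - inverse q) * (qint q 2)\<^sup>2"

text \<open>Lifts to the free algebra, indexed as in the generating functions \<open>W\<^sup>-\<close>, \<open>W\<^sup>+\<close>, \<open>G\<close>, \<open>G~\<close>.\<close>

definition free_Wm :: "nat \<Rightarrow> (ace_gen, 'a::field) free_alg" where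
  "free_Wm n = gen (Wminus n)"

definition free_Wp :: "nat \<Rightarrow> (ace_gen, 'a::field) free_alg" where
  "free_Wp n = gen (Wplus n)"

definition free_G :: "'a::field \<Rightarrow> nat \<Rightarrow> (ace_gen, 'a) free_alg" where
  "free_G q n = (case n of 0 \<Rightarrow> const (G_zero q) | Suc k \<Rightarrow> gen (Gplus k))"

definition free_Gt :: "'a::field \<Rightarrow> nat \<Rightarrow> (ace_gen, 'a) free_alg" where
  "free_Gt q n = (case n of 0 \<Rightarrow> const (G_zero q) | Suc k \<Rightarrow> gen (Gtilde k))"

definition ace_rels ::
    "'a::field \<Rightarrow> ((ace_gen, 'a) free_alg \<times> (ace_gen, 'a) free_alg) set" where
  "ace_rels q =
    (let Wm = free_Wm; Wp = free_Wp; G = free_G q; Gt = free_Gt q;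
         \<rho> = const (- ((q\<^sup>2 - inverse q ^ 2)\<^sup>2)); d = const (inverse (q + inverse q)) in
    \<Union>k l.
     {(comm (Wm 0) (Wp k), d * (Gt (k+1) - G (k+1))),
      (comm (Wm k) (Wp 0), d * (Gt (k+1) - G (k+1))),
      (qcomm q (Wm 0) (G (k+1)), \<rho> * Wm (k+1) - \<rho> * Wp k),
      (qcomm q (Gt (k+1)) (Wm 0), \<rho> * Wm (k+1) - \<rho> * Wp k),
      (qcomm q (G (k+1)) (Wp 0), \<rho> * Wp (k+1) - \<rho> * Wm k),
      (qcomm q (Wp 0) (Gt (k+1)), \<rho> * Wp (k+1) - \<rho> * Wm k),
      (comm (Wm k) (Wm l), 0),
      (comm (Wp k) (Wp l), 0),
      (comm (Wm k) (Wp l) + comm (Wp k) (Wm l), 0),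
      (comm (Wm k) (G (l+1)) + comm (G (k+1)) (Wm l), 0),
      (comm (Wm k) (Gt (l+1)) + comm (Gt (k+1)) (Wm l), 0),
      (comm (Wp k) (G (l+1)) + comm (G (k+1)) (Wp l), 0),
      (comm (Wp k) (Gt (l+1)) + comm (Gt (k+1)) (Wp l), 0),
      (comm (G (k+1)) (G (l+1)), 0),
      (comm (Gt (k+1)) (Gt (l+1)), 0),
      (comm (Gt (k+1)) (G (l+1)) + comm (G (k+1)) (Gt (l+1)), 0)})"

definition ace :: "'a::field \<Rightarrow> ('a, (ace_gen, 'a) free_alg set) module" where
  "ace q = presented_alg (ace_rels q)"

definition ace_Wm :: "'a::field \<Rightarrow> nat \<Rightarrow> (ace_gen, 'a) free_alg set" where
  "ace_Wm q n = presented_cls (ace_rels q) (free_Wm n)"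

definition ace_Wp :: "'a::field \<Rightarrow> nat \<Rightarrow> (ace_gen, 'a) free_alg set" where
  "ace_Wp q n = presented_cls (ace_rels q) (free_Wp n)"

definition ace_G :: "'a::field \<Rightarrow> nat \<Rightarrow> (ace_gen, 'a) free_alg set" where
  "ace_G q n = presented_cls (ace_rels q) (free_G q n)"

definition ace_Gt :: "'a::field \<Rightarrow> nat \<Rightarrow> (ace_gen, 'a) free_alg set" where
  "ace_Gt q n = presented_cls (ace_rels q) (free_Gt q n)"

subsection \<open>The central elements \<open>Z\<^sup>\<or>\<^sub>n\<close>\<close>

text \<open>
  The series \<open>S\<close> and \<open>T\<close>; the term with index \<open>\<ell>\<close> is that of degree \<open>n = 2 \<ell> + 1\<close>.
\<close>

definition ser_S :: "'a::field \<Rightarrow> 'a fps" where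
  "ser_S q = Abs_fps (\<lambda>n. if odd n then (q + inverse q) * (-1) ^ (n div 2) * inverse q ^ n else 0)"

definition ser_T :: "'a::field \<Rightarrow> 'a fps" where
  "ser_T q = Abs_fps (\<lambda>n. if odd n then (q + inverse q) * (-1) ^ (n div 2) * q ^ n else 0)"

definition const_fps :: "'a::field fps \<Rightarrow> ('x, 'a) free_alg fps" where
  "const_fps f = Abs_fps (\<lambda>n. const (f $ n))"

text \<open>
  \<open>\<Psi>(t)\<close>, computed in the free algebra (projection to the quotient acts coefficientwise).
  \<open>S T\<close> is divisible by \<open>t\<close>, so that \<open>fps_shift 1\<close> is multiplication by \<open>t\<^sup>-\<^sup>1\<close>; moreover
  \<open>f oo s\<close> is \<open>f(s)\<close>.
\<close>

definition free_Psi :: "'a::field \<Rightarrow> (ace_gen, 'a) free_alg fps" where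
  "free_Psi q =
    (let S = const_fps (ser_S q); T = const_fps (ser_T q);
         Wm = Abs_fps free_Wm; Wp = Abs_fps free_Wp;
         G = Abs_fps (free_G q); Gt = Abs_fps (free_Gt q);
         c = (\<lambda>a. fps_const (const a)) in
      fps_shift 1 (S * T) * (Wm oo S) * (Wp oo T)
      + fps_X * S * T * (Wp oo S) * (Wm oo T)
      - c (q\<^sup>2) * S * T * (Wm oo S) * (Wm oo T)
      - c (inverse q ^ 2) * S * T * (Wp oo S) * (Wp oo T)
      + c (inverse ((q\<^sup>2 - inverse q ^ 2)\<^sup>2)) * (G oo S) * (Gt oo T))"

definition free_Z :: "'a::field \<Rightarrow> nat \<Rightarrow> (ace_gen, 'a) free_alg" where
  "free_Z q n = const (inverse ((qint q 2)\<^sup>2)) * (free_Psi q $ n)"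

definition ace_Z :: "'a::field \<Rightarrow> nat \<Rightarrow> (ace_gen, 'a) free_alg set" where
  "ace_Z q n = presented_cls (ace_rels q) (free_Z q n)"

subsection \<open>Alternating generators of the \<open>q\<close>-Onsager algebra\<close>

text \<open>
  These conditions determine \<open>\<gamma>\<close> on the carrier; its existence is a known theorem, which is not
  built into the definition.
\<close>

definition is_gamma ::
    "'a::field \<Rightarrow> ((ace_gen, 'a) free_alg set \<Rightarrow> (onsager_gen, 'a) free_alg set) \<Rightarrow> bool" where
  "is_gamma q \<gamma> \<longleftrightarrow>
    \<gamma> \<in> alg_hom (ace q) (onsager q) \<and>
    \<gamma> (ace_Wm q 0) = onsager_W0 q \<and> \<gamma> (ace_Wp q 0) = onsager_W1 q \<and>
    (\<forall>n\<ge>1. \<gamma> (ace_Z q n) = \<zero>\<^bsub>onsager q\<^esub>)"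

text \<open>\<open>alt_Wm k\<close> and \<open>alt_Wp k\<close> carry the subscripts \<open>-k\<close> and \<open>k + 1\<close>, as for \<open>ace q\<close>.\<close>

context
  fixes q :: "'a::field"
    and \<gamma> :: "(ace_gen, 'a) free_alg set \<Rightarrow> (onsager_gen, 'a) free_alg set"
begin

definition alt_Wm :: "nat \<Rightarrow> (onsager_gen, 'a) free_alg set" where
  "alt_Wm k = \<gamma> (ace_Wm q k)"

definition alt_Wp :: "nat \<Rightarrow> (onsager_gen, 'a) free_alg set" where
  "alt_Wp k = \<gamma> (ace_Wp q k)"

definition alt_G :: "nat \<Rightarrow> (onsager_gen, 'a) free_alg set" where
  "alt_G n = (if n = 0 then G_zero q \<odot>\<^bsub>onsager q\<^esub> \<one>\<^bsub>onsager q\<^esub> else \<gamma> (ace_G q n))"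

definition alt_Gt :: "nat \<Rightarrow> (onsager_gen, 'a) free_alg set" where
  "alt_Gt n = (if n = 0 then G_zero q \<odot>\<^bsub>onsager q\<^esub> \<one>\<^bsub>onsager q\<^esub> else \<gamma> (ace_Gt q n))"

end

subsection \<open>The homomorphism to be shown bijective\<close>

abbreviation onsager_polys ::
  "'a::field \<Rightarrow>
    ('a, ((onsager_gen, 'a) free_alg set \<times> ((nat \<Rightarrow>\<^sub>0 nat) \<Rightarrow>\<^sub>0 'a) \<Rightarrow>\<^sub>0 'a) set) module" where
  "onsager_polys q \<equiv> tensor_alg (onsager q) polys"

text \<open>For \<open>k \<le> n\<close> the subscripts \<open>k - n\<close> and \<open>n + 1 - k\<close> are those of \<open>alt_Wm (n - k)\<close> and
  \<open>alt_Wp (n - k)\<close>.\<close>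

definition is_varphi ::
    "'a::field \<Rightarrow> ((ace_gen, 'a) free_alg set \<Rightarrow> (onsager_gen, 'a) free_alg set) \<Rightarrow>
     ((ace_gen, 'a) free_alg set \<Rightarrow>
       ((onsager_gen, 'a) free_alg set \<times> ((nat \<Rightarrow>\<^sub>0 nat) \<Rightarrow>\<^sub>0 'a) \<Rightarrow>\<^sub>0 'a) set) \<Rightarrow> bool" where
  "is_varphi q \<gamma> \<phi> \<longleftrightarrow>
    (let conv = (\<lambda>a n. \<Oplus>\<^bsub>onsager_polys q\<^esub>k\<in>{0..n}. tensor (onsager q) polys (a (n - k)) (pvar k)) in
      \<phi> \<in> alg_hom (ace q) (onsager_polys q) \<and>
      (\<forall>n. \<phi> (ace_Wm q n) = conv (alt_Wm q \<gamma>) n) \<and>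
      (\<forall>n. \<phi> (ace_Wp q n) = conv (alt_Wp q \<gamma>) n) \<and>
      (\<forall>n. \<phi> (ace_G q n) = conv (alt_G q \<gamma>) n) \<and>
      (\<forall>n. \<phi> (ace_Gt q n) = conv (alt_Gt q \<gamma>) n))"

end

theory Submission
  imports Defs "HOL-Algebra.Multiplicative_Group"
begin

text \<open>
  The known homomorphism \<open>\<gamma>\<close> has a section \<open>\<kappa>\<close> from the \<open>q\<close>-Onsager algebra to its central
  extension, because the Dolan-Grady relations follow from the first few defining relations. The
  images under \<open>\<kappa>\<close> of the alternating generators satisfy the defining relations as well and have
  the same initial terms as the generators. Solving \<open>G\<^sub>n = (\<Sum>k\<le>n. \<kappa>(\<gamma>(G\<^sub>n\<^sub>-\<^sub>k)) \<zeta>\<^sub>k)\<close> for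
  \<open>\<zeta>\<^sub>n\<close>, one finds by induction that the other three families are convolutions with the same sequence
  \<open>\<zeta>\<close> and that \<open>\<zeta>\<^sub>n\<close> commutes with the two Onsager generators; hence \<open>\<zeta>\<^sub>n\<close> is central. So \<open>\<kappa>\<close> and
  \<open>z\<^sub>n \<mapsto> \<zeta>\<^sub>n\<close> define a map on the tensor product, which is a left inverse of \<open>\<phi>\<close>; and \<open>\<phi>\<close> is onto
  since it sends \<open>\<kappa>(x)\<close> to \<open>x \<otimes> 1\<close> and \<open>\<zeta>\<^sub>n\<close> to \<open>1 \<otimes> z\<^sub>n\<close>.
\<close>

section \<open>Algebras over a field and their homomorphisms\<close>

text \<open>In terms of generating functions, \<phi> multiplies the four alternating series by the
  one series z(t). Inverting it means finding a common factor \<zeta>(t) of the four series of the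
  extension over the images of their alternating versions. The series for G starts with an
  invertible scalar, so it can be divided without inverting any other element of the algebra; the
  relations must then carry the quotient over to the other three. They do so because (q - q^{-1})
  G_0 = \<rho>: the bracket [W_0, G_0]_q is \<rho> W_0, and a convolution satisfies the q-commutator
  relations down to the lowest index. The same computation with a central sequence shows that \<phi>
  exists.

  The obstacle is centrality. Commutation with the two Onsager generators controls only the image of
  \<kappa>, and during the induction it is known only up to the current degree, so the identities
  for convolutions carry explicit bounds. To reach the whole extension the \<zeta>_n must also
  commute with one another, which is extracted from the commutativity of the G_n and of their small
  counterparts.\<close>

locale falg = ring A for A :: "('a::field, 'b) module" (structure) +
  assumes smult_closed [simp, intro]: "x \<in> carrier A \<Longrightarrow> c \<odot> x \<in> carrier A"
    and smult_l_distr: "x \<in> carrier A \<Longrightarrow> (c + d) \<odot> x = c \<odot> x \<oplus> d \<odot> x"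
    and smult_r_distr: "x \<in> carrier A \<Longrightarrow> y \<in> carrier A \<Longrightarrow> c \<odot> (x \<oplus> y) = c \<odot> x \<oplus> c \<odot> y"
    and smult_smult: "x \<in> carrier A \<Longrightarrow> c \<odot> (d \<odot> x) = (c * d) \<odot> x"
    and smult_one [simp]: "x \<in> carrier A \<Longrightarrow> 1 \<odot> x = x"
    and smult_mult_left: "x \<in> carrier A \<Longrightarrow> y \<in> carrier A \<Longrightarrow> (c \<odot> x) \<otimes> y = c \<odot> (x \<otimes> y)"
    and smult_mult_right: "x \<in> carrier A \<Longrightarrow> y \<in> carrier A \<Longrightarrow> x \<otimes> (c \<odot> y) = c \<odot> (x \<otimes> y)"
begin

lemma smult_zero_left [simp]:
  assumes x: "x \<in> carrier A"
  shows "0 \<odot> x = \<zero>"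
proof -
  have "0 \<odot> x \<oplus> 0 \<odot> x = 0 \<odot> x" using smult_l_distr[OF x, of 0 0] by simp
  then show ?thesis using x by (metis add.l_cancel_one smult_closed)
qed

lemma smult_zero_right [simp]: "c \<odot> \<zero> = \<zero>"
  using smult_r_distr[of \<zero> \<zero> c] by (metis add.l_cancel_one l_zero smult_closed zero_closed)

lemma smult_minus_left: "x \<in> carrier A \<Longrightarrow> (- c) \<odot> x = \<ominus> (c \<odot> x)"
  using smult_l_distr[of x "- c" c] by (metis add.inv_equality ab_left_minus smult_closed smult_zero_left)

lemma smult_minus_right: "x \<in> carrier A \<Longrightarrow> c \<odot> (\<ominus> x) = \<ominus> (c \<odot> x)"
  using smult_r_distr[of "\<ominus> x" x c]
  by (metis add.inv_closed add.inv_equality l_neg smult_closed smult_zero_right)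

lemma smult_diff_right: "x \<in> carrier A \<Longrightarrow> y \<in> carrier A \<Longrightarrow> c \<odot> (x \<ominus> y) = c \<odot> x \<ominus> c \<odot> y"
  by (simp add: a_minus_def smult_r_distr smult_minus_right)

lemma smult_cancel:
  assumes "c \<noteq> 0" "x \<in> carrier A" "y \<in> carrier A" "c \<odot> x = c \<odot> y"
  shows "x = y"
proof -
  have "inverse c \<odot> (c \<odot> x) = inverse c \<odot> (c \<odot> y)" using assms(4) by (rule arg_cong)
  then show ?thesis using assms(1-3) by (simp add: smult_smult)
qed

lemma finsum_smult:
  "finite I \<Longrightarrow> f \<in> I \<rightarrow> carrier A \<Longrightarrow> c \<odot> (\<Oplus>i\<in>I. f i) = (\<Oplus>i\<in>I. c \<odot> f i)"
  by (induction I rule: finite_induct) (auto simp: smult_r_distr Pi_def)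

end

locale falg_hom = falg A + B: falg B
  for A :: "('a::field, 'b) module" (structure) and B :: "('a, 'c) module" (structure) +
  fixes h
  assumes alg_hom: "h \<in> alg_hom A B"
begin

lemma ring_hom: "h \<in> ring_hom A B"
  using alg_hom by (simp add: alg_hom_def)

sublocale ring_hom_ring A B h
  by (rule ring_hom_ringI2) (use ring_hom ring_axioms B.ring_axioms in auto)

lemma hom_smult [simp]: "x \<in> carrier A \<Longrightarrow> h (c \<odot> x) = c \<odot>\<^bsub>B\<^esub> h x"
  using alg_hom by (simp add: alg_hom_def)

lemma hom_diff [simp]:
  "x \<in> carrier A \<Longrightarrow> y \<in> carrier A \<Longrightarrow> h (x \<ominus> y) = h x \<ominus>\<^bsub>B\<^esub> h y"
  by (simp add: a_minus_def)

lemma hom_sum: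
  "finite I \<Longrightarrow> f \<in> I \<rightarrow> carrier A \<Longrightarrow> h (\<Oplus>i\<in>I. f i) = (\<Oplus>\<^bsub>B\<^esub>i\<in>I. h (f i))"
  by (induction I rule: finite_induct) (auto simp: Pi_def)

end

lemma falg_homI: "falg A \<Longrightarrow> falg B \<Longrightarrow> h \<in> alg_hom A B \<Longrightarrow> falg_hom A B h"
  by (simp add: falg_hom_def falg_hom_axioms_def)

lemma alg_homI:
  assumes "\<And>x. x \<in> carrier A \<Longrightarrow> h x \<in> carrier B"
    and "\<And>x y. x \<in> carrier A \<Longrightarrow> y \<in> carrier A \<Longrightarrow> h (x \<otimes>\<^bsub>A\<^esub> y) = h x \<otimes>\<^bsub>B\<^esub> h y"
    and "\<And>x y. x \<in> carrier A \<Longrightarrow> y \<in> carrier A \<Longrightarrow> h (x \<oplus>\<^bsub>A\<^esub> y) = h x \<oplus>\<^bsub>B\<^esub> h y"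
    and "h \<one>\<^bsub>A\<^esub> = \<one>\<^bsub>B\<^esub>"
    and "\<And>c x. x \<in> carrier A \<Longrightarrow> h (c \<odot>\<^bsub>A\<^esub> x) = c \<odot>\<^bsub>B\<^esub> h x"
  shows "h \<in> alg_hom A B"
  unfolding alg_hom_def by (intro CollectI conjI ring_hom_memI allI ballI assms)

lemma alg_hom_comp:
  assumes "g \<in> alg_hom A B" and "h \<in> alg_hom B C"
  shows "(\<lambda>x. h (g x)) \<in> alg_hom A C"
  using assms by (intro alg_homI) (simp_all add: alg_hom_def ring_hom_def Pi_iff)

section \<open>Quotient algebras\<close>

locale falg_ideal = falg A + ideal I A
  for A :: "('a::field, 'b) module" (structure) and I
begin

text \<open>The scalar \<open>c\<close> acts as multiplication by \<open>c \<odot> \<one>\<close>,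
  so an ideal of the underlying ring is automatically a subspace.\<close>

lemma smult_mem_ideal:
  assumes x: "x \<in> I"
  shows "c \<odot> x \<in> I"
proof -
  have "(c \<odot> \<one>) \<otimes> x \<in> I" using x by (rule I_l_closed) simp
  then show ?thesis using Icarr[OF x] by (simp add: smult_mult_left)
qed

lemma coset_eq_iff:
  assumes "x \<in> carrier A" and "y \<in> carrier A"
  shows "I +> x = I +> y \<longleftrightarrow> x \<ominus> y \<in> I"
  unfolding a_rcos_module_minus[OF ring_axioms assms(2,1), symmetric]
  using a_repr_independence' a_repr_independenceD assms by blast

text \<open>Representatives of a coset differ by an element of the ideal, and so do their multiples;
  hence the union that defines \<open>smult\<close> in \<open>quot_alg\<close> is a union of equal
  cosets.\<close>

lemma smult_coset:
  assumes x: "x \<in> carrier A"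
  shows "(\<Union>y\<in>I +> x. I +> (c \<odot> y)) = I +> (c \<odot> x)"
proof -
  have "I +> (c \<odot> y) = I +> (c \<odot> x)" if y: "y \<in> I +> x" for y
  proof -
    have yc: "y \<in> carrier A" using y x a_r_coset_subset_G a_subset by blast
    have "y \<ominus> x \<in> I" using y yc x a_rcos_module_minus[OF ring_axioms] by blast
    then have "c \<odot> (y \<ominus> x) \<in> I" by (rule smult_mem_ideal)
    then show ?thesis using x yc by (simp add: coset_eq_iff smult_diff_right)
  qed
  moreover have "x \<in> I +> x" using x by (rule a_rcos_self)
  ultimately show ?thesis by blast
qed

lemma quot_alg_carrier: "carrier (quot_alg A I) = (\<lambda>x. I +> x) ` carrier A"
  by (auto simp: quot_alg_def FactRing_def A_RCOSETS_def')

lemma quot_alg_zero: "\<zero>\<^bsub>quot_alg A I\<^esub> = I +> \<zero>"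
proof -
  have "I +> \<zero> = I" by (rule a_rcos_const) simp
  moreover have "\<zero>\<^bsub>quot_alg A I\<^esub> = I" by (simp add: quot_alg_def FactRing_def)
  ultimately show ?thesis by (rule trans[OF _ sym, rotated])
qed

lemma quot_alg_one: "\<one>\<^bsub>quot_alg A I\<^esub> = I +> \<one>"
  by (simp add: quot_alg_def FactRing_def)

lemma quot_alg_mult:
  "x \<in> carrier A \<Longrightarrow> y \<in> carrier A \<Longrightarrow> (I +> x) \<otimes>\<^bsub>quot_alg A I\<^esub> (I +> y) = I +> (x \<otimes> y)"
  by (simp add: quot_alg_def FactRing_def rcoset_mult_add)

lemma quot_alg_add:
  "x \<in> carrier A \<Longrightarrow> y \<in> carrier A \<Longrightarrow> (I +> x) \<oplus>\<^bsub>quot_alg A I\<^esub> (I +> y) = I +> (x \<oplus> y)"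
  by (simp add: quot_alg_def FactRing_def a_rcos_sum)

lemma quot_alg_smult: "x \<in> carrier A \<Longrightarrow> c \<odot>\<^bsub>quot_alg A I\<^esub> (I +> x) = I +> (c \<odot> x)"
  by (simp add: quot_alg_def smult_coset)

lemmas quot_alg_simps =
  quot_alg_carrier quot_alg_zero quot_alg_one quot_alg_mult quot_alg_add quot_alg_smult

lemma falg_quot: "falg (quot_alg A I)"
proof -
  let ?Q = "quot_alg A I"
  have ag: "abelian_group ?Q"
  proof (rule abelian_groupI, unfold quot_alg_carrier ball_simps bex_simps)
    fix x y assume "x \<in> (+>) I ` carrier A" "y \<in> (+>) I ` carrier A"
    then show "x \<oplus>\<^bsub>?Q\<^esub> y = y \<oplus>\<^bsub>?Q\<^esub> x" by (auto simp: quot_alg_add) (simp_all add: a_comm)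
  next
    fix x assume "x \<in> (+>) I ` carrier A"
    then obtain y where y: "y \<in> carrier A" "x = I +> y" by auto
    have "(I +> (\<ominus> y)) \<oplus>\<^bsub>?Q\<^esub> (I +> y) = \<zero>\<^bsub>?Q\<^esub>"
      using y(1) by (simp add: quot_alg_add quot_alg_zero l_neg)
    then show "\<exists>y\<in>carrier A. (I +> y) \<oplus>\<^bsub>?Q\<^esub> x = \<zero>\<^bsub>?Q\<^esub>" using y by blast
  qed (auto simp: quot_alg_add quot_alg_zero a_assoc)
  have mo: "Group.monoid ?Q"
    by (rule monoidI) (auto simp: quot_alg_carrier quot_alg_mult quot_alg_one m_assoc)
  have r: "ring ?Q"
    by (rule ringI[OF ag mo])
      (auto simp: quot_alg_carrier quot_alg_mult quot_alg_add l_distr r_distr)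
  show ?thesis
    by (intro falg.intro[OF r] falg_axioms.intro)
      (auto simp: quot_alg_carrier quot_alg_mult quot_alg_add quot_alg_smult smult_l_distr
        smult_r_distr smult_smult smult_mult_left smult_mult_right)
qed

lemma coset_hom: "(\<lambda>x. I +> x) \<in> alg_hom A (quot_alg A I)"
  by (rule alg_homI) (auto simp: quot_alg_simps)

text \<open>The induced map is evaluated at an arbitrarily chosen representative; vanishing on
  \<open>I\<close> makes the value independent of the choice.\<close>

lemma quot_lift:
  assumes B: "falg B" and h: "h \<in> alg_hom A B" and ker: "\<And>x. x \<in> I \<Longrightarrow> h x = \<zero>\<^bsub>B\<^esub>"
  shows "\<exists>k\<in>alg_hom (quot_alg A I) B. \<forall>x\<in>carrier A. k (I +> x) = h x"
proof -
  interpret h: falg_hom A B h by (rule falg_homI[OF falg_axioms B h])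
  define k where "k X = h (SOME x. x \<in> carrier A \<and> X = I +> x)" for X
  have k: "k (I +> x) = h x" if x: "x \<in> carrier A" for x
  proof -
    define y where "y = (SOME y. y \<in> carrier A \<and> I +> x = I +> y)"
    have y: "y \<in> carrier A \<and> I +> x = I +> y"
      unfolding y_def by (rule someI[where x = x]) (use x in simp)
    then have "x \<ominus> y \<in> I" using x coset_eq_iff by blast
    then have "h (x \<ominus> y) = \<zero>\<^bsub>B\<^esub>" by (rule ker)
    then have "h x = h y" using x y by simp
    then show ?thesis unfolding k_def y_def by (rule sym)
  qed
  have "k \<in> alg_hom (quot_alg A I) B"
    by (rule alg_homI) (auto simp: quot_alg_simps k)
  with k show ?thesis by blast
qed

end

lemma (in falg) genideal_falg_ideal: "S \<subseteq> carrier A \<Longrightarrow> falg_ideal A (Idl S)"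
  by (simp add: falg_ideal_def falg_axioms genideal_ideal)

lemma (in falg_hom) kills_genideal:
  assumes "S \<subseteq> carrier A" "\<And>x. x \<in> S \<Longrightarrow> h x = \<zero>\<^bsub>B\<^esub>" "x \<in> Idl S"
  shows "h x = \<zero>\<^bsub>B\<^esub>"
proof -
  have "S \<subseteq> a_kernel A B h"
    unfolding a_kernel_def' using assms(1,2) by blast
  then have "Idl S \<subseteq> a_kernel A B h"
    by (rule genideal_minimal[OF kernel_is_ideal])
  then show ?thesis unfolding a_kernel_def' using assms(3) by blast
qed

section \<open>Linear extension\<close>

text \<open>Reduces linear and bilinear identities to single terms. The set \<open>S\<close> is kept
  so that the \<open>single\<close> case knows its index to lie in \<open>S\<close>; this matters
  for \<open>pair_alg\<close>, where the laws of the factors hold only on their carriers.\<close>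

lemma poly_mapping_induct_single [consumes 1, case_names zero single add]:
  fixes p :: "'i \<Rightarrow>\<^sub>0 'a::ab_group_add"
  assumes "Poly_Mapping.keys p \<subseteq> S"
    and "P 0"
    and "\<And>u c. u \<in> S \<Longrightarrow> P (Poly_Mapping.single u c)"
    and "\<And>p r. Poly_Mapping.keys p \<subseteq> S \<Longrightarrow> Poly_Mapping.keys r \<subseteq> S \<Longrightarrow> P p \<Longrightarrow> P r \<Longrightarrow> P (p + r)"
  shows "P p"
proof -
  have "\<forall>p. Poly_Mapping.keys p \<subseteq> K \<longrightarrow> P p" if "finite K" "K \<subseteq> S" for K
    using that
  proof (induction K rule: finite_induct)
    case empty
    have "p = 0" if "Poly_Mapping.keys p \<subseteq> {}" for p :: "'i \<Rightarrow>\<^sub>0 'a"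
      using that by simp
    then show ?case using assms(2) by blast
  next
    case (insert u K)
    show ?case
    proof (intro allI impI)
      fix p :: "'i \<Rightarrow>\<^sub>0 'a" assume p: "Poly_Mapping.keys p \<subseteq> insert u K"
      \<comment> \<open>Removing the coefficient at \<open>u\<close> leaves a support inside
        \<open>K\<close>, to which the induction hypothesis applies.\<close>
      define r where "r = p - Poly_Mapping.single u (Poly_Mapping.lookup p u)"
      have "Poly_Mapping.lookup r i = 0" if "i \<notin> K" for i
        using that p by (auto simp: r_def lookup_minus lookup_single when_def in_keys_iff)
      then have r: "Poly_Mapping.keys r \<subseteq> K" by (auto simp: in_keys_iff)
      have "P (Poly_Mapping.single u (Poly_Mapping.lookup p u))" "P r"
        using insert r assms(3) by auto
      then have "P (Poly_Mapping.single u (Poly_Mapping.lookup p u) + r)"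
        using r insert.prems by (intro assms(4)) (auto split: if_splits)
      then show "P p" by (simp add: r_def)
    qed
  qed
  then show ?thesis using assms(1) by (metis finite_keys order_refl)
qed

context falg
begin

text \<open>The same map underlies the universal properties of monoid algebras (with
  \<open>S = UNIV\<close> below) and of pair algebras (with \<open>S\<close> the product of the
  carriers).\<close>

definition lin :: "('i \<Rightarrow> 'b) \<Rightarrow> ('i \<Rightarrow>\<^sub>0 'a) \<Rightarrow> 'b" where
  "lin f p = (\<Oplus>u\<in>Poly_Mapping.keys p. Poly_Mapping.lookup p u \<odot> f u)"

context
  fixes f :: "'i \<Rightarrow> 'b" and S
  assumes f: "f \<in> S \<rightarrow> carrier A"
begin

text \<open>Supports can shrink when coefficients cancel, so sums are compared over a common finite
  superset; the extra terms have coefficient zero.\<close>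

lemma lin_superset:
  assumes "finite K" "Poly_Mapping.keys p \<subseteq> K" "K \<subseteq> S"
  shows "lin f p = (\<Oplus>u\<in>K. Poly_Mapping.lookup p u \<odot> f u)"
  unfolding lin_def
  by (rule add.finprod_mono_neutral_cong_left)
    (use assms f in \<open>auto simp: Pi_iff in_keys_iff subset_iff\<close>)

lemma lin_closed [simp]: "Poly_Mapping.keys p \<subseteq> S \<Longrightarrow> lin f p \<in> carrier A"
  unfolding lin_def by (rule finsum_closed) (use f in \<open>auto simp: Pi_iff subset_iff\<close>)

lemma lin_add:
  assumes "Poly_Mapping.keys p \<subseteq> S" "Poly_Mapping.keys r \<subseteq> S"
  shows "lin f (p + r) = lin f p \<oplus> lin f r"
proof -
  define K where "K = Poly_Mapping.keys p \<union> Poly_Mapping.keys r"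
  have K: "finite K" "Poly_Mapping.keys p \<subseteq> K" "Poly_Mapping.keys r \<subseteq> K" "K \<subseteq> S"
    "Poly_Mapping.keys (p + r) \<subseteq> K"
    using assms Poly_Mapping.keys_add[of p r] by (auto simp: K_def)
  have c: "f u \<in> carrier A" if "u \<in> K" for u using that K f by blast
  have "(\<Oplus>u\<in>K. Poly_Mapping.lookup (p + r) u \<odot> f u) =
      (\<Oplus>u\<in>K. Poly_Mapping.lookup p u \<odot> f u \<oplus> Poly_Mapping.lookup r u \<odot> f u)"
    by (rule finsum_cong') (auto simp: c lookup_add smult_l_distr)
  also have "\<dots> = (\<Oplus>u\<in>K. Poly_Mapping.lookup p u \<odot> f u) \<oplus> (\<Oplus>u\<in>K. Poly_Mapping.lookup r u \<odot> f u)"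
    by (rule finsum_addf) (auto simp: c)
  finally show ?thesis
    unfolding lin_superset[OF K(1,2,4)] lin_superset[OF K(1,3,4)] lin_superset[OF K(1,5,4)] .
qed

lemma lin_single:
  assumes "u \<in> S"
  shows "lin f (Poly_Mapping.single u c) = c \<odot> f u"
proof -
  have "f u \<in> carrier A" using f assms by blast
  then show ?thesis using assms by (subst lin_superset[of "{u}"]) auto
qed

lemma lin_smult:
  assumes "Poly_Mapping.keys p \<subseteq> S"
  shows "lin f (Poly_Mapping.map ((*) c) p) = c \<odot> lin f p"
proof -
  have c: "f u \<in> carrier A" if "u \<in> Poly_Mapping.keys p" for u using that assms f by blast
  have "Poly_Mapping.keys (Poly_Mapping.map ((*) c) p) \<subseteq> Poly_Mapping.keys p"
    by (auto simp: in_keys_iff Poly_Mapping.map.rep_eq when_def)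
  then have "lin f (Poly_Mapping.map ((*) c) p) =
      (\<Oplus>u\<in>Poly_Mapping.keys p. Poly_Mapping.lookup (Poly_Mapping.map ((*) c) p) u \<odot> f u)"
    by (intro lin_superset) (use assms in auto)
  also have "\<dots> = (\<Oplus>u\<in>Poly_Mapping.keys p. c \<odot> (Poly_Mapping.lookup p u \<odot> f u))"
    by (rule finsum_cong') (auto simp: c smult_smult Poly_Mapping.map.rep_eq when_def)
  also have "\<dots> = c \<odot> lin f p"
    unfolding lin_def by (rule finsum_smult[symmetric]) (auto simp: c)
  finally show ?thesis .
qed

end

end

section \<open>Monoid algebras\<close>

text \<open>The index \<open>0\<close> is the unit of the monoid, so scalars are central even when
  the monoid, such as that of words, is not commutative.\<close>

lemma single_zero_commute:
  fixes p :: "'m::monoid_add \<Rightarrow>\<^sub>0 'a::field"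
  shows "Poly_Mapping.single 0 c * p = p * Poly_Mapping.single 0 c"
proof -
  have "Poly_Mapping.keys p \<subseteq> UNIV" by simp
  then show ?thesis
    by (induction p rule: poly_mapping_induct_single)
      (simp_all add: mult_single mult.commute algebra_simps)
qed

lemma monoid_alg_simps [simp]:
  "carrier monoid_alg = UNIV" "mult monoid_alg = (*)" "one monoid_alg = 1"
  "zero monoid_alg = 0" "add monoid_alg = (+)"
  by (simp_all add: monoid_alg_def)

lemma monoid_alg_smult:
  fixes p :: "'m::monoid_add \<Rightarrow>\<^sub>0 'a::field"
  shows "c \<odot>\<^bsub>monoid_alg\<^esub> p = Poly_Mapping.single 0 c * p"
  by (simp add: monoid_alg_def mult_map_scale_conv_mult)

lemma falg_monoid_alg: "falg (monoid_alg :: ('a::field, 'm::monoid_add \<Rightarrow>\<^sub>0 'a) module)"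
proof -
  have "ring (monoid_alg :: ('a, 'm \<Rightarrow>\<^sub>0 'a) module)"
  proof (rule ringI)
    show "abelian_group (monoid_alg :: ('a, 'm \<Rightarrow>\<^sub>0 'a) module)"
    proof (rule abelian_groupI)
      fix x :: "'m \<Rightarrow>\<^sub>0 'a"
      have "- x + x = 0" by simp
      then show "\<exists>y\<in>carrier monoid_alg. y \<oplus>\<^bsub>monoid_alg\<^esub> x = \<zero>\<^bsub>monoid_alg\<^esub>"
        unfolding monoid_alg_simps by blast
    qed (simp_all add: add.assoc add.commute)
    show "Group.monoid (monoid_alg :: ('a, 'm \<Rightarrow>\<^sub>0 'a) module)"
      by (rule monoidI) (simp_all add: mult.assoc)
  qed (simp_all add: distrib_left distrib_right)
  moreover have "falg_axioms (monoid_alg :: ('a, 'm \<Rightarrow>\<^sub>0 'a) module)"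
  proof
    fix x y :: "'m \<Rightarrow>\<^sub>0 'a" and c :: 'a
    have "x * (Poly_Mapping.single 0 c * y) = (x * Poly_Mapping.single 0 c) * y"
      by (simp add: mult.assoc)
    also have "\<dots> = Poly_Mapping.single 0 c * (x * y)"
      by (simp add: single_zero_commute[symmetric] mult.assoc)
    finally show "x \<otimes>\<^bsub>monoid_alg\<^esub> (c \<odot>\<^bsub>monoid_alg\<^esub> y) = c \<odot>\<^bsub>monoid_alg\<^esub> (x \<otimes>\<^bsub>monoid_alg\<^esub> y)"
      by (simp add: monoid_alg_smult)
  qed (simp_all add: monoid_alg_smult single_add distrib_left distrib_right mult_single flip: mult.assoc)
  ultimately show ?thesis by (rule falg.intro)
qed

lemma monoid_alg_diff: "p \<ominus>\<^bsub>monoid_alg\<^esub> r = p - r"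
proof -
  interpret falg monoid_alg by (rule falg_monoid_alg)
  have "\<ominus>\<^bsub>monoid_alg\<^esub> r = - r" by (rule minus_equality) simp_all
  then show ?thesis by (simp add: a_minus_def)
qed

text \<open>Universal property of the monoid algebra. Both sides of the multiplicativity law are
  bilinear, so it is enough to compare them on single terms.\<close>

lemma (in falg) lin_monoid_hom:
  assumes f: "\<And>u. f u \<in> carrier A" and zero: "f 0 = \<one>"
    and plus: "\<And>u v. f (u + v) = f u \<otimes> f v"
  shows "lin f \<in> alg_hom monoid_alg A"
proof (rule alg_homI)
  have F: "f \<in> UNIV \<rightarrow> carrier A" using f by blast
  fix p r
  show "lin f (p \<otimes>\<^bsub>monoid_alg\<^esub> r) = lin f p \<otimes> lin f r"
  proof -
    have single: "lin f (Poly_Mapping.single u c * r) = (c \<odot> f u) \<otimes> lin f r" for u c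
    proof -
      have "Poly_Mapping.keys r \<subseteq> UNIV" by simp
      then show ?thesis
        by (induction r rule: poly_mapping_induct_single)
          (simp_all add: lin_def[of _ 0] mult_single lin_single[OF F] lin_closed[OF F] lin_add[OF F]
            f plus smult_mult_left smult_mult_right smult_smult distrib_left r_distr mult.commute)
    qed
    have "Poly_Mapping.keys p \<subseteq> UNIV" by simp
    then show ?thesis
      by (induction p rule: poly_mapping_induct_single)
        (simp_all add: lin_def[of _ 0] single lin_single[OF F] lin_closed[OF F] lin_add[OF F]
            distrib_right l_distr)
  qed
  show "lin f p \<in> carrier A" by (simp add: lin_closed[OF F])
  show "lin f (p \<oplus>\<^bsub>monoid_alg\<^esub> r) = lin f p \<oplus> lin f r" by (simp add: lin_add[OF F])
  show "lin f \<one>\<^bsub>monoid_alg\<^esub> = \<one>" by (simp add: lin_single[OF F] zero flip: single_one)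
  show "lin f (c \<odot>\<^bsub>monoid_alg\<^esub> p) = c \<odot> lin f p" for c
    using lin_smult[OF F, of p c] by (simp add: monoid_alg_def)
qed

section \<open>Presented algebras\<close>

lemma monoid_alg_smult_const: "c \<odot>\<^bsub>monoid_alg\<^esub> p = const c * p"
  by (simp add: monoid_alg_smult const_def)

lemma free_alg_induct [case_names one gen add mult smult]:
  fixes p :: "('x, 'a::field) free_alg"
  assumes "P 1" and "\<And>x. P (gen x)" and "\<And>p r. P p \<Longrightarrow> P r \<Longrightarrow> P (p + r)"
    and "\<And>p r. P p \<Longrightarrow> P r \<Longrightarrow> P (p * r)" and "\<And>c p. P p \<Longrightarrow> P (const c * p)"
  shows "P p"
proof -
  have w: "P (Poly_Mapping.single (Word xs) 1)" for xs
  proof (induction xs)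
    case Nil
    then show ?case using assms(1) by (simp add: zero_word_def flip: single_one)
  next
    case (Cons x xs)
    have "Poly_Mapping.single (Word (x # xs)) 1 = gen x * Poly_Mapping.single (Word xs) (1::'a)"
      by (simp add: gen_def mult_single plus_word_def)
    then show ?case using assms(2,4) Cons by metis
  qed
  have s: "P (Poly_Mapping.single u c)" for u c
  proof -
    have "Poly_Mapping.single u c = const c * Poly_Mapping.single (Word (letters u)) 1"
      by (simp add: const_def mult_single)
    then show ?thesis using assms(5) w by metis
  qed
  have "Poly_Mapping.keys p \<subseteq> UNIV" by simp
  then show ?thesis
  proof (induction p rule: poly_mapping_induct_single)
    case zero
    then show ?case using s[of 0 0] by simp
  qed (use s assms(3) in auto)
qed

context falg
begin

definition word_prod :: "('x \<Rightarrow> 'b) \<Rightarrow> 'x word \<Rightarrow> 'b" where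
  "word_prod g w = foldr (\<lambda>x y. g x \<otimes> y) (letters w) \<one>"

text \<open>Universal property of the free algebra: \<open>word_prod g\<close> is the monoid
  homomorphism on words that extends \<open>g\<close>.\<close>

lemma free_alg_lift:
  assumes g: "\<And>x. g x \<in> carrier A"
  shows "lin (word_prod g) \<in> alg_hom monoid_alg A" and "lin (word_prod g) (gen x) = g x"
proof -
  have c: "foldr (\<lambda>x y. g x \<otimes> y) xs \<one> \<in> carrier A" for xs
    by (induction xs) (auto simp: g)
  have "foldr (\<lambda>x y. g x \<otimes> y) (xs @ ys) \<one> =
      foldr (\<lambda>x y. g x \<otimes> y) xs \<one> \<otimes> foldr (\<lambda>x y. g x \<otimes> y) ys \<one>" for xs ys
    by (induction xs) (simp_all add: g c m_assoc)
  then show "lin (word_prod g) \<in> alg_hom monoid_alg A"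
    by (intro lin_monoid_hom) (simp_all add: word_prod_def c zero_word_def plus_word_def)
  have "word_prod g \<in> UNIV \<rightarrow> carrier A" by (simp add: word_prod_def c)
  from lin_single[OF this] show "lin (word_prod g) (gen x) = g x"
    by (simp add: gen_def g word_prod_def)
qed

end

lemma falg_ideal_rel:
  "falg_ideal (monoid_alg :: ('a::field, ('x, 'a) free_alg) module) (rel_ideal R)"
  unfolding rel_ideal_def by (rule falg.genideal_falg_ideal[OF falg_monoid_alg]) simp

lemma falg_presented: "falg (presented_alg R)"
  unfolding presented_alg_def by (rule falg_ideal.falg_quot[OF falg_ideal_rel])

lemma presented_cls_hom: "presented_cls R \<in> alg_hom monoid_alg (presented_alg R)"
  unfolding presented_alg_def presented_cls_def[abs_def]
  by (rule falg_ideal.coset_hom[OF falg_ideal_rel])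

lemma presented_cls_surj: "carrier (presented_alg R) = range (presented_cls R)"
  unfolding presented_alg_def presented_cls_def[abs_def]
  by (simp add: falg_ideal.quot_alg_carrier[OF falg_ideal_rel])

lemma presented_cls_rel:
  assumes "(l, r) \<in> R"
  shows "presented_cls R l = presented_cls R r"
proof -
  have "l - r \<in> rel_ideal R"
    unfolding rel_ideal_def using assms by (intro subsetD[OF ring.genideal_self[OF falg.axioms(1)[OF falg_monoid_alg]]]) auto
  then show ?thesis
    unfolding presented_cls_def
    by (subst falg_ideal.coset_eq_iff[OF falg_ideal_rel]) (simp_all add: monoid_alg_diff)
qed

text \<open>The kernel of \<open>h\<close> is an ideal that contains every \<open>l - r\<close>,
  hence the ideal that these differences generate.\<close>

lemma presented_lift:
  assumes "falg B" and h: "h \<in> alg_hom monoid_alg B" and rel: "\<And>l r. (l, r) \<in> R \<Longrightarrow> h l = h r"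
  shows "\<exists>k\<in>alg_hom (presented_alg R) B. \<forall>p. k (presented_cls R p) = h p"
proof -
  interpret h: falg_hom monoid_alg B h by (rule falg_homI[OF falg_monoid_alg assms(1,2)])
  have "h x = \<zero>\<^bsub>B\<^esub>" if "x \<in> rel_ideal R" for x
  proof (rule h.kills_genideal)
    show "x \<in> Idl\<^bsub>monoid_alg\<^esub> {l - r | l r. (l, r) \<in> R}" using that by (simp add: rel_ideal_def)
    fix y assume "y \<in> {l - r | l r. (l, r) \<in> R}"
    then obtain l r where "y = l - r" "(l, r) \<in> R" by blast
    then show "h y = \<zero>\<^bsub>B\<^esub>"
      using rel h.hom_diff[of l r] h.hom_closed[of r] by (simp add: monoid_alg_diff)
  qed simp
  from falg_ideal.quot_lift[OF falg_ideal_rel assms(1) h this]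
  show ?thesis by (simp add: presented_alg_def presented_cls_def)
qed

section \<open>Tensor products\<close>

lemma lookup_map_mult:
  "Poly_Mapping.lookup (Poly_Mapping.map ((*) c) p) i = c * Poly_Mapping.lookup p i"
  for c :: "'a::field"
  by (simp add: Poly_Mapping.map.rep_eq when_def)

lemma map_mult_zero: "Poly_Mapping.map ((*) c) 0 = 0" for c :: "'a::field"
  by (rule poly_mapping_eqI) (simp add: lookup_map_mult)

lemma map_mult_single:
  "Poly_Mapping.map ((*) c) (Poly_Mapping.single u d) = Poly_Mapping.single u (c * d)"
  for c :: "'a::field"
  by (simp add: map_single)

lemma map_mult_add:
  fixes p r :: "'i \<Rightarrow>\<^sub>0 'a::field"
  shows "Poly_Mapping.map ((*) c) (p + r) = Poly_Mapping.map ((*) c) p + Poly_Mapping.map ((*) c) r"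
  by (rule poly_mapping_eqI) (simp add: lookup_map_mult lookup_add distrib_left)

locale falg_pair = A: falg A + B: falg B
  for A :: "('a::field, 'b) module" and B :: "('a, 'c) module"
begin

lemma pair_alg_simps:
  "carrier (pair_alg A B) = {p. Poly_Mapping.keys p \<subseteq> carrier A \<times> carrier B}"
  "\<one>\<^bsub>pair_alg A B\<^esub> = Poly_Mapping.single (\<one>\<^bsub>A\<^esub>, \<one>\<^bsub>B\<^esub>) 1"
  "\<zero>\<^bsub>pair_alg A B\<^esub> = 0"
  "add (pair_alg A B) = (+)"
  "c \<odot>\<^bsub>pair_alg A B\<^esub> p = Poly_Mapping.map ((*) c) p"
  by (simp_all add: pair_alg_def)

lemma pair_single_mult:
  "Poly_Mapping.single (a, b) c \<otimes>\<^bsub>pair_alg A B\<^esub> Poly_Mapping.single (a', b') d =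
    Poly_Mapping.single (a \<otimes>\<^bsub>A\<^esub> a', b \<otimes>\<^bsub>B\<^esub> b') (c * d)"
  by (simp add: pair_alg_def)

lemma pair_zero_mult: "0 \<otimes>\<^bsub>pair_alg A B\<^esub> p = 0" "p \<otimes>\<^bsub>pair_alg A B\<^esub> 0 = 0"
  by (simp_all add: pair_alg_def)

text \<open>Keys can disappear from \<open>p + r\<close> by cancellation. The summand is additive in
  the coefficient and vanishes at zero, so the sums over the different key sets still match.\<close>

lemma pair_add_mult:
  "(p + r) \<otimes>\<^bsub>pair_alg A B\<^esub> s = p \<otimes>\<^bsub>pair_alg A B\<^esub> s + r \<otimes>\<^bsub>pair_alg A B\<^esub> s"
  unfolding pair_alg_def
  by (simp, rule setsum_keys_plus_distrib) (simp_all add: distrib_right single_add sum.distrib)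

lemma pair_mult_add:
  "s \<otimes>\<^bsub>pair_alg A B\<^esub> (p + r) = s \<otimes>\<^bsub>pair_alg A B\<^esub> p + s \<otimes>\<^bsub>pair_alg A B\<^esub> r"
proof -
  have "(\<Sum>v\<in>Poly_Mapping.keys (p + r). Poly_Mapping.single (fst u \<otimes>\<^bsub>A\<^esub> fst v, snd u \<otimes>\<^bsub>B\<^esub> snd v)
         (Poly_Mapping.lookup s u * Poly_Mapping.lookup (p + r) v)) =
     (\<Sum>v\<in>Poly_Mapping.keys p. Poly_Mapping.single (fst u \<otimes>\<^bsub>A\<^esub> fst v, snd u \<otimes>\<^bsub>B\<^esub> snd v)
         (Poly_Mapping.lookup s u * Poly_Mapping.lookup p v)) +
     (\<Sum>v\<in>Poly_Mapping.keys r. Poly_Mapping.single (fst u \<otimes>\<^bsub>A\<^esub> fst v, snd u \<otimes>\<^bsub>B\<^esub> snd v)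
         (Poly_Mapping.lookup s u * Poly_Mapping.lookup r v))" for u
    by (rule setsum_keys_plus_distrib) (simp_all add: distrib_left single_add)
  then show ?thesis by (simp add: pair_alg_def sum.distrib)
qed

lemma pair_keys_mult:
  assumes "Poly_Mapping.keys p \<subseteq> carrier A \<times> carrier B" "Poly_Mapping.keys r \<subseteq> carrier A \<times> carrier B"
  shows "Poly_Mapping.keys (p \<otimes>\<^bsub>pair_alg A B\<^esub> r) \<subseteq> carrier A \<times> carrier B"
proof -
  have *: "Poly_Mapping.keys (Poly_Mapping.single (a, b) c \<otimes>\<^bsub>pair_alg A B\<^esub> r) \<subseteq> carrier A \<times> carrier B"
    if ab: "a \<in> carrier A" "b \<in> carrier B" for a b c
    using assms(2)
  proof (induction r rule: poly_mapping_induct_single)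
    case zero
    then show ?case by (simp add: pair_zero_mult)
  next
    case (single u d)
    then show ?case using ab by (cases u) (auto simp: pair_single_mult split: if_splits)
  next
    case (add p r)
    then show ?case unfolding pair_mult_add
      using Poly_Mapping.keys_add by (meson Un_least order_trans)
  qed
  show ?thesis
    using assms(1)
  proof (induction p rule: poly_mapping_induct_single)
    case zero
    then show ?case by (simp add: pair_zero_mult)
  next
    case (single u d)
    then show ?case by (cases u) (simp add: *)
  next
    case (add p r)
    then show ?case unfolding pair_add_mult
      using Poly_Mapping.keys_add by (meson Un_least order_trans)
  qed
qed

text \<open>Both sides are trilinear, so three nested inductions reduce the claim to single terms.
  Membership in the carriers is used there, because \<open>A\<close> and \<open>B\<close> are
  associative only on them.\<close>

lemma pair_mult_assoc:
  assumes p: "Poly_Mapping.keys p \<subseteq> carrier A \<times> carrier B"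
    and r: "Poly_Mapping.keys r \<subseteq> carrier A \<times> carrier B"
    and s: "Poly_Mapping.keys s \<subseteq> carrier A \<times> carrier B"
  shows "(p \<otimes>\<^bsub>pair_alg A B\<^esub> r) \<otimes>\<^bsub>pair_alg A B\<^esub> s = p \<otimes>\<^bsub>pair_alg A B\<^esub> (r \<otimes>\<^bsub>pair_alg A B\<^esub> s)"
  using p
proof (induction p rule: poly_mapping_induct_single)
  case (single u c)
  show ?case
    using r
  proof (induction r rule: poly_mapping_induct_single)
    case (single v d)
    show ?case
      using s
    proof (induction s rule: poly_mapping_induct_single)
      case (single w e)
      then show ?case
        using \<open>u \<in> _\<close> \<open>v \<in> _\<close>
        by (cases u; cases v; cases w)
          (auto simp: pair_single_mult A.m_assoc B.m_assoc mult.assoc)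
    qed (simp_all add: pair_zero_mult pair_mult_add)
  qed (simp_all add: pair_zero_mult pair_add_mult pair_mult_add)
qed (simp_all add: pair_zero_mult pair_add_mult)

lemma pair_smult_mult:
  assumes "Poly_Mapping.keys p \<subseteq> carrier A \<times> carrier B" "Poly_Mapping.keys r \<subseteq> carrier A \<times> carrier B"
  shows "Poly_Mapping.map ((*) c) p \<otimes>\<^bsub>pair_alg A B\<^esub> r = Poly_Mapping.map ((*) c) (p \<otimes>\<^bsub>pair_alg A B\<^esub> r)"
    and "p \<otimes>\<^bsub>pair_alg A B\<^esub> Poly_Mapping.map ((*) c) r = Poly_Mapping.map ((*) c) (p \<otimes>\<^bsub>pair_alg A B\<^esub> r)"
proof -
  have *: "Poly_Mapping.map ((*) c) (Poly_Mapping.single (a, b) d) \<otimes>\<^bsub>pair_alg A B\<^esub> r =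
      Poly_Mapping.map ((*) c) (Poly_Mapping.single (a, b) d \<otimes>\<^bsub>pair_alg A B\<^esub> r)"
    "Poly_Mapping.single (a, b) d \<otimes>\<^bsub>pair_alg A B\<^esub> Poly_Mapping.map ((*) c) r =
      Poly_Mapping.map ((*) c) (Poly_Mapping.single (a, b) d \<otimes>\<^bsub>pair_alg A B\<^esub> r)" for a b d
    using assms(2)
    by (induction r rule: poly_mapping_induct_single)
      (auto simp: pair_zero_mult pair_mult_add map_mult_zero map_mult_single map_mult_add pair_single_mult ac_simps)
  show "Poly_Mapping.map ((*) c) p \<otimes>\<^bsub>pair_alg A B\<^esub> r = Poly_Mapping.map ((*) c) (p \<otimes>\<^bsub>pair_alg A B\<^esub> r)"
    "p \<otimes>\<^bsub>pair_alg A B\<^esub> Poly_Mapping.map ((*) c) r = Poly_Mapping.map ((*) c) (p \<otimes>\<^bsub>pair_alg A B\<^esub> r)"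
    using assms(1)
    by (induction p rule: poly_mapping_induct_single)
      (auto simp: pair_zero_mult pair_add_mult map_mult_zero map_mult_add *[unfolded map_mult_single]
        map_mult_single)
qed

lemma falg_pair_alg: "falg (pair_alg A B)"
proof -
  let ?P = "pair_alg A B"
  have add: "Poly_Mapping.keys (p + r) \<subseteq> carrier A \<times> carrier B"
    if "Poly_Mapping.keys p \<subseteq> carrier A \<times> carrier B" "Poly_Mapping.keys r \<subseteq> carrier A \<times> carrier B"
    for p r :: "'b \<times> 'c \<Rightarrow>\<^sub>0 'a"
    using that Poly_Mapping.keys_add by (meson Un_least order_trans)
  have ag: "abelian_group ?P"
  proof (rule abelian_groupI)
    fix x assume "x \<in> carrier ?P"
    then have "- x \<in> carrier ?P" by (simp add: pair_alg_simps in_keys_iff subset_iff)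
    moreover have "- x \<oplus>\<^bsub>?P\<^esub> x = \<zero>\<^bsub>?P\<^esub>" by (simp add: pair_alg_simps)
    ultimately show "\<exists>y\<in>carrier ?P. y \<oplus>\<^bsub>?P\<^esub> x = \<zero>\<^bsub>?P\<^esub>" by blast
  qed (simp_all add: pair_alg_simps add add.assoc add.commute)
  have one: "\<one>\<^bsub>?P\<^esub> \<otimes>\<^bsub>?P\<^esub> p = p" "p \<otimes>\<^bsub>?P\<^esub> \<one>\<^bsub>?P\<^esub> = p"
    if "Poly_Mapping.keys p \<subseteq> carrier A \<times> carrier B" for p
    using that unfolding pair_alg_simps
    by (induction p rule: poly_mapping_induct_single)
      (auto simp: pair_zero_mult pair_add_mult pair_mult_add pair_single_mult)
  have mo: "Group.monoid ?P"
    by (rule monoidI)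
      (simp_all add: pair_alg_simps(1) pair_keys_mult pair_mult_assoc one, simp add: pair_alg_simps)
  have r: "ring ?P"
    by (rule ringI[OF ag mo]) (simp_all add: pair_alg_simps(4) pair_add_mult pair_mult_add)
  have sm: "Poly_Mapping.keys (Poly_Mapping.map ((*) c) p) \<subseteq> carrier A \<times> carrier B"
    if "Poly_Mapping.keys p \<subseteq> carrier A \<times> carrier B" for c and p :: "'b \<times> 'c \<Rightarrow>\<^sub>0 'a"
    using that by (force simp: in_keys_iff lookup_map_mult subset_iff)
  show ?thesis
    by (intro falg.intro[OF r] falg_axioms.intro)
      (simp_all add: pair_alg_simps sm pair_smult_mult map_mult_add,
       auto intro!: poly_mapping_eqI simp: lookup_map_mult lookup_add algebra_simps)
qed

lemma pair_alg_diff: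
  assumes "r \<in> carrier (pair_alg A B)"
  shows "p \<ominus>\<^bsub>pair_alg A B\<^esub> r = p - r"
proof -
  interpret P: falg "pair_alg A B" by (rule falg_pair_alg)
  have "- r \<in> carrier (pair_alg A B)"
    using assms by (simp add: pair_alg_simps in_keys_iff subset_iff)
  then have "\<ominus>\<^bsub>pair_alg A B\<^esub> r = - r"
    using assms by (intro P.minus_equality) (simp_all add: pair_alg_simps(3,4))
  then show ?thesis by (simp add: a_minus_def pair_alg_simps(4))
qed

lemma single_in_pair:
  "a \<in> carrier A \<Longrightarrow> b \<in> carrier B \<Longrightarrow> Poly_Mapping.single (a, b) c \<in> carrier (pair_alg A B)"
  by (simp add: pair_alg_simps)

lemma relators_closed: "tensor_relators A B \<subseteq> carrier (pair_alg A B)"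
proof -
  interpret P: falg "pair_alg A B" by (rule falg_pair_alg)
  have d: "p - r \<in> carrier (pair_alg A B)"
    if "p \<in> carrier (pair_alg A B)" "r \<in> carrier (pair_alg A B)" for p r
    using that P.minus_closed[of p r] by (simp add: pair_alg_diff)
  show ?thesis
    unfolding tensor_relators_def Let_def by (auto intro!: d single_in_pair)
qed

section \<open>The tensor product as a quotient of the pair algebra\<close>

sublocale T: falg_ideal "pair_alg A B" "tensor_ideal A B"
  unfolding tensor_ideal_def
  by (rule falg.genideal_falg_ideal[OF falg_pair_alg relators_closed])

lemma falg_tensor: "falg (tensor_alg A B)"
  unfolding tensor_alg_def by (rule T.falg_quot)

lemma tensor_closed:
  "a \<in> carrier A \<Longrightarrow> b \<in> carrier B \<Longrightarrow> tensor A B a b \<in> carrier (tensor_alg A B)"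
  by (simp add: tensor_def tensor_alg_def T.quot_alg_carrier single_in_pair)

lemma tensor_mult:
  assumes "a \<in> carrier A" "b \<in> carrier B" "a' \<in> carrier A" "b' \<in> carrier B"
  shows "tensor A B a b \<otimes>\<^bsub>tensor_alg A B\<^esub> tensor A B a' b' =
    tensor A B (a \<otimes>\<^bsub>A\<^esub> a') (b \<otimes>\<^bsub>B\<^esub> b')"
  using assms by (simp add: tensor_def tensor_alg_def T.quot_alg_mult single_in_pair pair_single_mult)

lemma tensor_one: "\<one>\<^bsub>tensor_alg A B\<^esub> = tensor A B \<one>\<^bsub>A\<^esub> \<one>\<^bsub>B\<^esub>"
  by (simp add: tensor_def tensor_alg_def T.quot_alg_one pair_alg_simps)

lemma coset_relator_eq:
  assumes "p - r \<in> tensor_relators A B" "p \<in> carrier (pair_alg A B)" "r \<in> carrier (pair_alg A B)"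
  shows "tensor_ideal A B +>\<^bsub>pair_alg A B\<^esub> p = tensor_ideal A B +>\<^bsub>pair_alg A B\<^esub> r"
proof -
  have "p - r \<in> tensor_ideal A B"
    unfolding tensor_ideal_def using T.genideal_self[OF relators_closed] assms(1) by blast
  then show ?thesis using assms(2,3) by (simp add: T.coset_eq_iff pair_alg_diff)
qed

lemma tensor_add_left:
  assumes "a \<in> carrier A" "a' \<in> carrier A" "b \<in> carrier B"
  shows "tensor A B (a \<oplus>\<^bsub>A\<^esub> a') b = tensor A B a b \<oplus>\<^bsub>tensor_alg A B\<^esub> tensor A B a' b"
proof -
  have "tensor_ideal A B +>\<^bsub>pair_alg A B\<^esub> Poly_Mapping.single (a \<oplus>\<^bsub>A\<^esub> a', b) 1 =
      tensor_ideal A B +>\<^bsub>pair_alg A B\<^esub>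
        (Poly_Mapping.single (a, b) 1 \<oplus>\<^bsub>pair_alg A B\<^esub> Poly_Mapping.single (a', b) 1)"
    by (rule coset_relator_eq)
      (use assms in \<open>auto simp: single_in_pair, force simp: tensor_relators_def pair_alg_simps diff_diff_eq[symmetric]\<close>)
  then show ?thesis
    using assms by (simp add: tensor_def tensor_alg_def T.quot_alg_add single_in_pair)
qed

lemma tensor_add_right:
  assumes "a \<in> carrier A" "b \<in> carrier B" "b' \<in> carrier B"
  shows "tensor A B a (b \<oplus>\<^bsub>B\<^esub> b') = tensor A B a b \<oplus>\<^bsub>tensor_alg A B\<^esub> tensor A B a b'"
proof -
  have "tensor_ideal A B +>\<^bsub>pair_alg A B\<^esub> Poly_Mapping.single (a, b \<oplus>\<^bsub>B\<^esub> b') 1 =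
      tensor_ideal A B +>\<^bsub>pair_alg A B\<^esub>
        (Poly_Mapping.single (a, b) 1 \<oplus>\<^bsub>pair_alg A B\<^esub> Poly_Mapping.single (a, b') 1)"
    by (rule coset_relator_eq)
      (use assms in \<open>auto simp: single_in_pair, force simp: tensor_relators_def pair_alg_simps diff_diff_eq[symmetric]\<close>)
  then show ?thesis
    using assms by (simp add: tensor_def tensor_alg_def T.quot_alg_add single_in_pair)
qed

lemma smult_tensor:
  assumes "a \<in> carrier A" "b \<in> carrier B"
  shows "c \<odot>\<^bsub>tensor_alg A B\<^esub> tensor A B a b =
    tensor_ideal A B +>\<^bsub>pair_alg A B\<^esub> Poly_Mapping.single (a, b) c"
  using assms
  by (simp add: tensor_def tensor_alg_def T.quot_alg_smult single_in_pair pair_alg_simps(5) map_mult_single)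

lemma tensor_smult_left:
  assumes "a \<in> carrier A" "b \<in> carrier B"
  shows "tensor A B (c \<odot>\<^bsub>A\<^esub> a) b = c \<odot>\<^bsub>tensor_alg A B\<^esub> tensor A B a b"
  unfolding smult_tensor[OF assms] unfolding tensor_def
  by (rule coset_relator_eq; (simp add: single_in_pair assms)?)
    (unfold tensor_relators_def Let_def, use assms in blast)

lemma tensor_smult_right:
  assumes "a \<in> carrier A" "b \<in> carrier B"
  shows "tensor A B a (c \<odot>\<^bsub>B\<^esub> b) = c \<odot>\<^bsub>tensor_alg A B\<^esub> tensor A B a b"
  unfolding smult_tensor[OF assms] unfolding tensor_def
  by (rule coset_relator_eq; (simp add: single_in_pair assms)?)
    (unfold tensor_relators_def Let_def, use assms in blast)

text \<open>A scalar can be absorbed into the left factor, so every element is a sum of pure tensors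
  and no case for scalar multiples is needed.\<close>

lemma tensor_induct [consumes 1, case_names tensor add]:
  assumes "X \<in> carrier (tensor_alg A B)"
    and t: "\<And>a b. a \<in> carrier A \<Longrightarrow> b \<in> carrier B \<Longrightarrow> P (tensor A B a b)"
    and add: "\<And>X Y. X \<in> carrier (tensor_alg A B) \<Longrightarrow> Y \<in> carrier (tensor_alg A B) \<Longrightarrow>
      P X \<Longrightarrow> P Y \<Longrightarrow> P (X \<oplus>\<^bsub>tensor_alg A B\<^esub> Y)"
  shows "P X"
proof -
  let ?c = "\<lambda>p. tensor_ideal A B +>\<^bsub>pair_alg A B\<^esub> p"
  obtain p where p: "p \<in> carrier (pair_alg A B)" "X = ?c p"
    using assms(1) by (auto simp: tensor_alg_def T.quot_alg_carrier)
  have s: "P (?c (Poly_Mapping.single (a, b) c))" if "a \<in> carrier A" "b \<in> carrier B" for a b c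
    using t[of "c \<odot>\<^bsub>A\<^esub> a" b] that by (simp add: tensor_smult_left smult_tensor)
  have "Poly_Mapping.keys p \<subseteq> carrier A \<times> carrier B" using p(1) by (simp add: pair_alg_simps)
  then have "P (?c p)"
  proof (induction p rule: poly_mapping_induct_single)
    case zero
    then show ?case using s[OF A.zero_closed B.zero_closed, of 0] by simp
  next
    case (single u c)
    then show ?case using s by (cases u) auto
  next
    case (add p r)
    then have "?c (p + r) = ?c p \<oplus>\<^bsub>tensor_alg A B\<^esub> ?c r"
      and "?c p \<in> carrier (tensor_alg A B)" "?c r \<in> carrier (tensor_alg A B)"
      by (simp_all add: tensor_alg_def T.quot_alg_add T.quot_alg_carrier pair_alg_simps(1,4))
    then show ?case using assms(3) add.IH by metis
  qed
  with p show ?thesis by simp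
qed

text \<open>The hypothesis \<open>comm\<close> is what makes the bilinear map multiplicative: it
  moves \<open>g b\<close> past \<open>f a'\<close> in the product of the images of two pure
  tensors.\<close>

lemma tensor_lift:
  assumes C: "falg C" and f: "f \<in> alg_hom A C" and g: "g \<in> alg_hom B C"
    and comm: "\<And>a b. a \<in> carrier A \<Longrightarrow> b \<in> carrier B \<Longrightarrow> f a \<otimes>\<^bsub>C\<^esub> g b = g b \<otimes>\<^bsub>C\<^esub> f a"
  shows "\<exists>h\<in>alg_hom (tensor_alg A B) C. \<forall>a\<in>carrier A. \<forall>b\<in>carrier B.
    h (tensor A B a b) = f a \<otimes>\<^bsub>C\<^esub> g b"
proof -
  interpret C: falg C by (rule C)
  interpret f: falg_hom A C f by (rule falg_homI[OF A.falg_axioms C f])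
  interpret g: falg_hom B C g by (rule falg_homI[OF B.falg_axioms C g])
  define k where "k u = f (fst u) \<otimes>\<^bsub>C\<^esub> g (snd u)" for u
  have k: "k \<in> carrier A \<times> carrier B \<rightarrow> carrier C" by (auto simp: k_def)
  have k_mult: "k (a \<otimes>\<^bsub>A\<^esub> a', b \<otimes>\<^bsub>B\<^esub> b') = k (a, b) \<otimes>\<^bsub>C\<^esub> k (a', b')"
    if "a \<in> carrier A" "b \<in> carrier B" "a' \<in> carrier A" "b' \<in> carrier B" for a b a' b'
  proof -
    have "k (a, b) \<otimes>\<^bsub>C\<^esub> k (a', b') = f a \<otimes>\<^bsub>C\<^esub> (g b \<otimes>\<^bsub>C\<^esub> f a') \<otimes>\<^bsub>C\<^esub> g b'"
      using that by (simp add: k_def C.m_assoc)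
    also have "\<dots> = f a \<otimes>\<^bsub>C\<^esub> (f a' \<otimes>\<^bsub>C\<^esub> g b) \<otimes>\<^bsub>C\<^esub> g b'"
      using that by (simp only: comm)
    finally show ?thesis using that by (simp add: k_def C.m_assoc)
  qed
  note lin_simps = C.lin_single[OF k] C.lin_add[OF k] C.lin_closed[OF k]
  have hom: "C.lin k \<in> alg_hom (pair_alg A B) C"
  proof (rule alg_homI)
    fix p r assume "p \<in> carrier (pair_alg A B)" "r \<in> carrier (pair_alg A B)"
    then have p: "Poly_Mapping.keys p \<subseteq> carrier A \<times> carrier B"
      and r: "Poly_Mapping.keys r \<subseteq> carrier A \<times> carrier B"
      by (simp_all add: pair_alg_simps)
    show "C.lin k (p \<oplus>\<^bsub>pair_alg A B\<^esub> r) = C.lin k p \<oplus>\<^bsub>C\<^esub> C.lin k r"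
      using p r by (simp add: pair_alg_simps(4) lin_simps)
    have *: "C.lin k (Poly_Mapping.single u c \<otimes>\<^bsub>pair_alg A B\<^esub> r) =
        (c \<odot>\<^bsub>C\<^esub> k u) \<otimes>\<^bsub>C\<^esub> C.lin k r" if u: "u \<in> carrier A \<times> carrier B" for u c
      using r
    proof (induction r rule: poly_mapping_induct_single)
      case zero
      then show ?case using k u by (auto simp: pair_zero_mult C.lin_def[of _ 0] Pi_iff)
    next
      case (single v d)
      obtain a b a' b' where uv: "u = (a, b)" "v = (a', b')" by fastforce
      have ab: "a \<in> carrier A" "b \<in> carrier B" "a' \<in> carrier A" "b' \<in> carrier B"
        using u single uv by auto
      then have "k (a, b) \<in> carrier C" "k (a', b') \<in> carrier C" using k by auto
      then show ?case using ab
        by (simp add: uv pair_single_mult lin_simps k_mult C.smult_mult_left C.smult_mult_right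
            C.smult_smult mult.commute)
    next
      case (add p r)
      have "k u \<in> carrier C" using k u by blast
      then show ?case using add u
        by (cases u) (simp add: pair_mult_add lin_simps pair_keys_mult C.r_distr)
    qed
    show "C.lin k (p \<otimes>\<^bsub>pair_alg A B\<^esub> r) = C.lin k p \<otimes>\<^bsub>C\<^esub> C.lin k r"
      using p
    proof (induction p rule: poly_mapping_induct_single)
      case zero
      then show ?case using r by (simp add: pair_zero_mult C.lin_def[of _ 0] lin_simps)
    next
      case (single u c)
      then show ?case by (simp add: * lin_simps)
    next
      case (add p p')
      then show ?case using r by (simp add: pair_add_mult lin_simps pair_keys_mult C.l_distr)
    qed
  next
    show "C.lin k \<one>\<^bsub>pair_alg A B\<^esub> = \<one>\<^bsub>C\<^esub>"
      by (simp add: pair_alg_simps(2) lin_simps, simp add: k_def)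
  qed (simp_all add: pair_alg_simps(1,5) lin_simps C.lin_smult[OF k])
  interpret L: falg_hom "pair_alg A B" C "C.lin k"
    by (rule falg_homI[OF falg_pair_alg C hom])
  have L: "C.lin k (Poly_Mapping.single (a, b) c) = c \<odot>\<^bsub>C\<^esub> (f a \<otimes>\<^bsub>C\<^esub> g b)"
    if "a \<in> carrier A" "b \<in> carrier B" for a b c
    using that by (simp add: lin_simps, simp add: k_def)
  have L_diff: "C.lin k (p - r) = C.lin k p \<ominus>\<^bsub>C\<^esub> C.lin k r"
    if "p \<in> carrier (pair_alg A B)" "r \<in> carrier (pair_alg A B)" for p r
    using that L.hom_diff[of p r] by (simp add: pair_alg_diff)
  have diff_closed: "p - r \<in> carrier (pair_alg A B)"
    if "p \<in> carrier (pair_alg A B)" "r \<in> carrier (pair_alg A B)" for p r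
    using that T.minus_closed[of p r] by (simp add: pair_alg_diff)
  have add_diff: "(x \<oplus>\<^bsub>C\<^esub> y) \<ominus>\<^bsub>C\<^esub> x \<ominus>\<^bsub>C\<^esub> y = \<zero>\<^bsub>C\<^esub>"
    if "x \<in> carrier C" "y \<in> carrier C" for x y
  proof -
    have "(x \<oplus>\<^bsub>C\<^esub> y) \<ominus>\<^bsub>C\<^esub> x \<ominus>\<^bsub>C\<^esub> y = (x \<oplus>\<^bsub>C\<^esub> y) \<oplus>\<^bsub>C\<^esub> \<ominus>\<^bsub>C\<^esub> (x \<oplus>\<^bsub>C\<^esub> y)"
      using that by (simp add: C.minus_eq C.a_assoc C.minus_add)
    then show ?thesis using that by (simp add: C.r_neg)
  qed
  \<comment> \<open>The four kinds of relators vanish by the four identities that express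
    bilinearity of the product of \<open>f a\<close> and \<open>g b\<close>.\<close>
  have "C.lin k x = \<zero>\<^bsub>C\<^esub>" if "x \<in> tensor_relators A B" for x
    using that unfolding tensor_relators_def Let_def
    by (auto simp: L L_diff diff_closed single_in_pair C.l_distr C.r_distr C.smult_mult_left
        C.smult_mult_right add_diff)
  then have "C.lin k x = \<zero>\<^bsub>C\<^esub>" if "x \<in> tensor_ideal A B" for x
    using L.kills_genideal[OF relators_closed] that unfolding tensor_ideal_def by blast
  from T.quot_lift[OF C hom this] obtain h where h: "h \<in> alg_hom (tensor_alg A B) C"
    "\<And>x. x \<in> carrier (pair_alg A B) \<Longrightarrow> h (tensor_ideal A B +>\<^bsub>pair_alg A B\<^esub> x) = C.lin k x"
    unfolding tensor_alg_def by blast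
  then have "h (tensor A B a b) = f a \<otimes>\<^bsub>C\<^esub> g b" if "a \<in> carrier A" "b \<in> carrier B" for a b
    using that by (simp add: tensor_def single_in_pair L)
  with h(1) show ?thesis by blast
qed

end

section \<open>Commutators and convolutions\<close>

context falg
begin

text \<open>With \<open>qcm\<close> below, the counterparts in an arbitrary algebra of
  \<open>comm\<close> and \<open>qcomm\<close>, which live only in free algebras.\<close>

definition cm :: "'b \<Rightarrow> 'b \<Rightarrow> 'b" where
  "cm x y = x \<otimes> y \<ominus> y \<otimes> x"

definition qcm :: "'a \<Rightarrow> 'b \<Rightarrow> 'b \<Rightarrow> 'b" where
  "qcm r x y = r \<odot> (x \<otimes> y) \<ominus> inverse r \<odot> (y \<otimes> x)"

lemmas nf_simps = minus_eq m_assoc l_distr r_distr smult_r_distr smult_mult_left smult_mult_right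
  smult_smult l_minus r_minus smult_minus_right minus_add a_ac

lemma cm_closed [simp]: "x \<in> carrier A \<Longrightarrow> y \<in> carrier A \<Longrightarrow> cm x y \<in> carrier A"
  by (simp add: cm_def)

lemma qcm_closed [simp]: "x \<in> carrier A \<Longrightarrow> y \<in> carrier A \<Longrightarrow> qcm r x y \<in> carrier A"
  by (simp add: qcm_def)

lemma cm_eq_zero_iff: "x \<in> carrier A \<Longrightarrow> y \<in> carrier A \<Longrightarrow> cm x y = \<zero> \<longleftrightarrow> x \<otimes> y = y \<otimes> x"
  by (simp add: cm_def)

lemma cm_antisym: "x \<in> carrier A \<Longrightarrow> y \<in> carrier A \<Longrightarrow> cm y x = \<ominus> cm x y"
  by (simp add: cm_def nf_simps)

lemma qcm_flip: "x \<in> carrier A \<Longrightarrow> y \<in> carrier A \<Longrightarrow> qcm (inverse r) x y = \<ominus> qcm r y x"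
  by (simp add: qcm_def nf_simps)

lemma cm_linear:
  assumes "x \<in> carrier A" "y \<in> carrier A" "w \<in> carrier A"
  shows "cm x (y \<oplus> w) = cm x y \<oplus> cm x w" "cm (y \<oplus> w) x = cm y x \<oplus> cm w x"
    "cm x (y \<ominus> w) = cm x y \<ominus> cm x w"
  using assms by (simp_all add: cm_def nf_simps)

lemma qcm_linear:
  assumes "x \<in> carrier A" "y \<in> carrier A" "w \<in> carrier A"
  shows "qcm r x (y \<oplus> w) = qcm r x y \<oplus> qcm r x w" "qcm r (y \<oplus> w) x = qcm r y x \<oplus> qcm r w x"
    "qcm r x (y \<ominus> w) = qcm r x y \<ominus> qcm r x w"
  using assms by (simp_all add: qcm_def nf_simps)

lemma cm_smult:
  assumes "x \<in> carrier A" "y \<in> carrier A"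
  shows "cm x (c \<odot> y) = c \<odot> cm x y" "cm (c \<odot> y) x = c \<odot> cm y x"
    "cm x (\<ominus> y) = \<ominus> cm x y"
  using assms by (simp_all add: cm_def nf_simps)

lemma qcm_smult:
  assumes "x \<in> carrier A" "y \<in> carrier A"
  shows "qcm r x (c \<odot> y) = c \<odot> qcm r x y" "qcm r (c \<odot> y) x = c \<odot> qcm r y x"
    "qcm r x (\<ominus> y) = \<ominus> qcm r x y"
  using assms by (simp_all add: qcm_def nf_simps mult.commute)

lemma qcm_add_flip:
  assumes "x \<in> carrier A" "y \<in> carrier A"
  shows "qcm r x y \<oplus> qcm (inverse r) x y = (r + inverse r) \<odot> cm x y"
  using assms by (simp add: cm_def qcm_def nf_simps smult_l_distr)

text \<open>The difference of the two r-commutators is \<open>r + inverse r\<close> times the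
  commutator. For \<open>r = q\<close> this scalar is nonzero because
  \<open>q\<^sup>2 \<noteq> -1\<close>.\<close>

lemma qcm_sym_commute:
  assumes "x \<in> carrier A" "y \<in> carrier A" "r + inverse r \<noteq> 0" "qcm r x y = qcm r y x"
  shows "x \<otimes> y = y \<otimes> x"
proof -
  have "(r + inverse r) \<odot> cm x y = qcm r x y \<ominus> qcm r y x"
    using assms(1,2) by (simp add: qcm_flip minus_eq flip: qcm_add_flip)
  also have "\<dots> = (r + inverse r) \<odot> \<zero>" using assms by simp
  finally have "cm x y = \<zero>" using assms(1-3) by (auto intro: smult_cancel[where c = "r + inverse r"])
  then show ?thesis using assms(1,2) by (simp add: cm_eq_zero_iff)
qed

text \<open>Supplies the factor \<open>q - inverse q\<close> that combines with
  \<open>G_zero q\<close> to the constant \<rho> in \<open>qcm_a0_conv\<close>.\<close>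

lemma qcm_commuting:
  assumes "x \<in> carrier A" "y \<in> carrier A" "x \<otimes> y = y \<otimes> x"
  shows "qcm r x y = (r - inverse r) \<odot> (x \<otimes> y)"
  using assms smult_l_distr[of "x \<otimes> y" r "- inverse r"]
  by (simp add: qcm_def minus_eq smult_minus_left)

text \<open>Left and right multiplication by \<open>x\<close> commute with each other, hence so do
  all brackets with \<open>x\<close> in the first slot.\<close>

lemma cm_qcm_qcm:
  assumes "x \<in> carrier A" "y \<in> carrier A"
  shows "cm x (qcm s x (qcm r x y)) = qcm s x (qcm r x (cm x y))"
  using assms by (simp add: cm_def qcm_def nf_simps mult.commute)

section \<open>Convolutions: coefficients of products of generating functions\<close>

definition conv :: "(nat \<Rightarrow> 'b) \<Rightarrow> (nat \<Rightarrow> 'b) \<Rightarrow> nat \<Rightarrow> 'b" where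
  "conv x z n = (\<Oplus>k\<in>{0..n}. x (n - k) \<otimes> z k)"

lemma conv_cong: "(\<And>i. x i = y i) \<Longrightarrow> conv x z n = conv y z n"
  by (simp add: conv_def)

context
  fixes z :: "nat \<Rightarrow> 'b"
  assumes z: "\<And>k. z k \<in> carrier A"
begin

lemma conv_closed [simp]: "(\<And>i. x i \<in> carrier A) \<Longrightarrow> conv x z n \<in> carrier A"
  unfolding conv_def by (rule finsum_closed) (auto simp: z)

lemma conv_0: "(\<And>i. x i \<in> carrier A) \<Longrightarrow> conv x z 0 = x 0 \<otimes> z 0"
  by (simp add: conv_def z)

text \<open>Separates the scalar terms \<open>g 0\<close> and \<open>h 0\<close> from those of
  positive index, to which the relations refer, and produces the index shift between
  \<open>a (Suc k)\<close> and \<open>b k\<close>.\<close>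

lemma conv_Suc:
  assumes x: "\<And>i. x i \<in> carrier A"
  shows "conv x z (Suc n) = conv (\<lambda>i. x (Suc i)) z n \<oplus> x 0 \<otimes> z (Suc n)"
proof -
  have "conv x z (Suc n) = (\<Oplus>k\<in>insert (Suc n) {0..n}. x (Suc n - k) \<otimes> z k)"
    by (simp add: conv_def atLeast0_atMost_Suc)
  also have "\<dots> = x 0 \<otimes> z (Suc n) \<oplus> (\<Oplus>k\<in>{0..n}. x (Suc n - k) \<otimes> z k)"
    by (subst finsum_insert) (auto simp: x z)
  also have "(\<Oplus>k\<in>{0..n}. x (Suc n - k) \<otimes> z k) = conv (\<lambda>i. x (Suc i)) z n"
    unfolding conv_def by (rule finsum_cong') (auto simp: x z Suc_diff_le)
  finally show ?thesis using x z by (simp add: a_comm)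
qed

text \<open>The term \<open>z n\<close> occurs once, with coefficient \<open>x 0\<close>; when
  \<open>x 0\<close> is an invertible scalar, prescribing the convolutions is a triangular system
  for \<open>z\<close>.\<close>

lemma conv_last:
  assumes x: "\<And>i. x i \<in> carrier A"
  shows "conv x z n = x 0 \<otimes> z n \<oplus> (\<Oplus>k\<in>{..<n}. x (n - k) \<otimes> z k)"
proof -
  have "{0..n} = insert n {..<n}" by auto
  then show ?thesis unfolding conv_def by (simp add: Pi_iff x z)
qed

lemma additive_finsum:
  assumes "\<And>x. x \<in> carrier A \<Longrightarrow> L x \<in> carrier A" "L \<zero> = \<zero>"
    and "\<And>x y. x \<in> carrier A \<Longrightarrow> y \<in> carrier A \<Longrightarrow> L (x \<oplus> y) = L x \<oplus> L y"
    and "finite K" "f \<in> K \<rightarrow> carrier A"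
  shows "L (\<Oplus>k\<in>K. f k) = (\<Oplus>k\<in>K. L (f k))"
  using assms(4,5)
proof (induction K rule: finite_induct)
  case empty
  then show ?case by (simp add: assms(2))
next
  case (insert k K)
  then have "f k \<in> carrier A" "f \<in> K \<rightarrow> carrier A" "(\<lambda>k. L (f k)) \<in> K \<rightarrow> carrier A" "L (f k) \<in> carrier A"
    using assms(1) by auto
  then show ?case using insert by (simp add: assms(3))
qed

text \<open>Typically \<open>L\<close> is a bracket with a fixed element. It has to respect right
  multiplication by \<open>z k\<close> only for \<open>k \<le> n\<close>, since the induction that
  determines the sequence knows nothing yet about later terms.\<close>

lemma conv_map:
  assumes "\<And>x. x \<in> carrier A \<Longrightarrow> L x \<in> carrier A" "L \<zero> = \<zero>"
    and "\<And>x y. x \<in> carrier A \<Longrightarrow> y \<in> carrier A \<Longrightarrow> L (x \<oplus> y) = L x \<oplus> L y"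
    and "\<And>x k. x \<in> carrier A \<Longrightarrow> k \<le> n \<Longrightarrow> L (x \<otimes> z k) = L x \<otimes> z k"
    and x: "\<And>i. x i \<in> carrier A"
  shows "L (conv x z n) = conv (\<lambda>i. L (x i)) z n"
proof -
  have "L (conv x z n) = (\<Oplus>k\<in>{0..n}. L (x (n - k) \<otimes> z k))"
    unfolding conv_def by (rule additive_finsum) (use assms(1-3) x z in auto)
  also have "\<dots> = conv (\<lambda>i. L (x i)) z n"
    unfolding conv_def by (rule finsum_cong') (use assms x z in auto)
  finally show ?thesis .
qed

lemma conv_add:
  assumes "\<And>i. x i \<in> carrier A" "\<And>i. y i \<in> carrier A"
  shows "conv (\<lambda>i. x i \<oplus> y i) z n = conv x z n \<oplus> conv y z n"
  unfolding conv_def using assms z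
  by (subst finsum_addf[symmetric]) (auto intro!: finsum_cong' simp: l_distr)

lemma conv_zero: "conv (\<lambda>i. \<zero>) z n = \<zero>"
  unfolding conv_def using z by (intro add.finprod_one_eqI) simp

lemma conv_smult:
  assumes "\<And>i. x i \<in> carrier A"
  shows "conv (\<lambda>i. c \<odot> x i) z n = c \<odot> conv x z n"
  by (rule conv_map[symmetric]) (auto simp: assms smult_r_distr smult_mult_left z)

lemma conv_diff:
  assumes "\<And>i. x i \<in> carrier A" "\<And>i. y i \<in> carrier A"
  shows "conv (\<lambda>i. x i \<ominus> y i) z n = conv x z n \<ominus> conv y z n"
proof -
  have "conv (\<lambda>i. \<ominus> y i) z n = \<ominus> conv y z n"
    by (rule conv_map[symmetric]) (auto simp: assms minus_add l_minus z)
  then show ?thesis using assms by (simp add: minus_eq conv_add)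
qed

lemma cm_conv_right:
  assumes "y \<in> carrier A" "\<And>k. k \<le> n \<Longrightarrow> z k \<otimes> y = y \<otimes> z k" "\<And>i. x i \<in> carrier A"
  shows "cm y (conv x z n) = conv (\<lambda>i. cm y (x i)) z n"
proof (rule conv_map)
  fix x k assume "x \<in> carrier A" "k \<le> n"
  then show "cm y (x \<otimes> z k) = cm y x \<otimes> z k"
    using assms z by (simp add: cm_def nf_simps)
qed (use assms in \<open>auto simp: cm_linear cm_eq_zero_iff\<close>)

lemma cm_conv_left:
  assumes "y \<in> carrier A" "\<And>k. k \<le> n \<Longrightarrow> z k \<otimes> y = y \<otimes> z k" "\<And>i. x i \<in> carrier A"
  shows "cm (conv x z n) y = conv (\<lambda>i. cm (x i) y) z n"
proof (rule conv_map)
  fix x k assume "x \<in> carrier A" "k \<le> n"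
  then show "cm (x \<otimes> z k) y = cm x y \<otimes> z k"
    using assms z by (simp add: cm_def nf_simps)
qed (use assms in \<open>auto simp: cm_linear cm_eq_zero_iff\<close>)

lemma qcm_conv_right:
  assumes "y \<in> carrier A" "\<And>k. k \<le> n \<Longrightarrow> z k \<otimes> y = y \<otimes> z k" "\<And>i. x i \<in> carrier A"
  shows "qcm r y (conv x z n) = conv (\<lambda>i. qcm r y (x i)) z n"
proof (rule conv_map)
  fix x k assume "x \<in> carrier A" "k \<le> n"
  then show "qcm r y (x \<otimes> z k) = qcm r y x \<otimes> z k"
    using assms z by (simp add: qcm_def nf_simps)
qed (use assms in \<open>auto simp: qcm_linear\<close>, auto simp: qcm_def)

lemma qcm_conv_left:
  assumes "y \<in> carrier A" "\<And>k. k \<le> n \<Longrightarrow> z k \<otimes> y = y \<otimes> z k" "\<And>i. x i \<in> carrier A"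
  shows "qcm r (conv x z n) y = conv (\<lambda>i. qcm r (x i) y) z n"
proof (rule conv_map)
  fix x k assume "x \<in> carrier A" "k \<le> n"
  then show "qcm r (x \<otimes> z k) y = qcm r x y \<otimes> z k"
    using assms z by (simp add: qcm_def nf_simps)
qed (use assms in \<open>auto simp: qcm_linear\<close>, auto simp: qcm_def)

end

text \<open>The equations are triangular with an invertible scalar on the diagonal, so the sequence
  is recovered term by term.\<close>

lemma conv_cancel:
  assumes x: "\<And>i. x i \<in> carrier A" "x 0 = c \<odot> \<one>" "c \<noteq> 0"
    and u: "\<And>i. u i \<in> carrier A" and v: "\<And>i. v i \<in> carrier A"
    and eq: "\<And>n. conv x u n = conv x v n"
  shows "u n = v n"
proof (induction n rule: less_induct)
  case (less n)
  have "(\<Oplus>k\<in>{..<n}. x (n - k) \<otimes> u k) = (\<Oplus>k\<in>{..<n}. x (n - k) \<otimes> v k)"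
    by (rule finsum_cong') (simp_all add: Pi_iff x u v less)
  moreover have "(\<Oplus>k\<in>{..<n}. x (n - k) \<otimes> v k) \<in> carrier A"
    by (rule finsum_closed) (simp add: Pi_iff x v)
  ultimately have "x 0 \<otimes> u n = x 0 \<otimes> v n"
    using eq[of n] by (simp add: conv_last[OF u x(1)] conv_last[OF v x(1)] x u v)
  then show ?case
    by (intro smult_cancel[OF x(3) u v]) (simp add: x(2) smult_mult_left u v)
qed

end

section \<open>Families satisfying the relations of the alternating central extension\<close>

text \<open>Such a quadruple amounts to an algebra homomorphism from \<open>ace q\<close> to
  \<open>A\<close> (see \<open>ace_rep_lift\<close> and \<open>ace_rep_hom\<close>). The letters
  \<open>a\<close>, \<open>b\<close>, \<open>g\<close>, \<open>h\<close> stand for W^-, W^+, G, G~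
  with the indices of the generating functions; the zeroth terms of \<open>g\<close> and
  \<open>h\<close> are included as scalars so that convolutions need no special case.\<close>

locale ace_rep = falg A for A :: "('a::field, 'b) module" (structure) +
  fixes q :: 'a and a b g h :: "nat \<Rightarrow> 'b"
  assumes a_carr [simp]: "a n \<in> carrier A" and b_carr [simp]: "b n \<in> carrier A"
    and g_carr [simp]: "g n \<in> carrier A" and h_carr [simp]: "h n \<in> carrier A"
    and g_0: "g 0 = G_zero q \<odot> \<one>" and h_0: "h 0 = G_zero q \<odot> \<one>"
    and cm_a0_b: "cm (a 0) (b k) = inverse (q + inverse q) \<odot> (h (Suc k) \<ominus> g (Suc k))"
    and cm_a_b0: "cm (a k) (b 0) = inverse (q + inverse q) \<odot> (h (Suc k) \<ominus> g (Suc k))"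
    and qcm_a0_g: "qcm q (a 0) (g (Suc k)) =
      (- ((q\<^sup>2 - inverse q ^ 2)\<^sup>2)) \<odot> a (Suc k) \<ominus> (- ((q\<^sup>2 - inverse q ^ 2)\<^sup>2)) \<odot> b k"
    and qcm_h_a0: "qcm q (h (Suc k)) (a 0) =
      (- ((q\<^sup>2 - inverse q ^ 2)\<^sup>2)) \<odot> a (Suc k) \<ominus> (- ((q\<^sup>2 - inverse q ^ 2)\<^sup>2)) \<odot> b k"
    and qcm_g_b0: "qcm q (g (Suc k)) (b 0) =
      (- ((q\<^sup>2 - inverse q ^ 2)\<^sup>2)) \<odot> b (Suc k) \<ominus> (- ((q\<^sup>2 - inverse q ^ 2)\<^sup>2)) \<odot> a k"
    and qcm_b0_h: "qcm q (b 0) (h (Suc k)) =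
      (- ((q\<^sup>2 - inverse q ^ 2)\<^sup>2)) \<odot> b (Suc k) \<ominus> (- ((q\<^sup>2 - inverse q ^ 2)\<^sup>2)) \<odot> a k"
    and cm_a_a: "cm (a k) (a l) = \<zero>"
    and cm_b_b: "cm (b k) (b l) = \<zero>"
    and cm_a_b: "cm (a k) (b l) \<oplus> cm (b k) (a l) = \<zero>"
    and cm_a_g: "cm (a k) (g (Suc l)) \<oplus> cm (g (Suc k)) (a l) = \<zero>"
    and cm_a_h: "cm (a k) (h (Suc l)) \<oplus> cm (h (Suc k)) (a l) = \<zero>"
    and cm_b_g: "cm (b k) (g (Suc l)) \<oplus> cm (g (Suc k)) (b l) = \<zero>"
    and cm_b_h: "cm (b k) (h (Suc l)) \<oplus> cm (h (Suc k)) (b l) = \<zero>"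
    and cm_g_g: "cm (g (Suc k)) (g (Suc l)) = \<zero>"
    and cm_h_h: "cm (h (Suc k)) (h (Suc l)) = \<zero>"
    and cm_h_g: "cm (h (Suc k)) (g (Suc l)) \<oplus> cm (g (Suc k)) (h (Suc l)) = \<zero>"
begin

abbreviation "\<rho> \<equiv> - ((q\<^sup>2 - inverse q ^ 2)\<^sup>2)"

text \<open>The relations are symmetric under exchanging W_{-k} with W_{k+1} and G with G~, so every
  fact about \<open>a 0\<close> yields one about \<open>b 0\<close>.\<close>

lemma swap: "ace_rep A q b a h g"
proof (unfold_locales, goal_cases)
  \<comment> \<open>In the two relations that involve the difference of \<open>h\<close> and
    \<open>g\<close>, the commutator and the difference both change sign.\<close>
  case (7 k)
  show ?case using cm_a_b0[of k] cm_antisym[of "a k" "b 0"]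
    by (simp add: minus_add minus_eq a_comm flip: smult_minus_right)
next
  case (8 k)
  show ?case using cm_a0_b[of k] cm_antisym[of "a 0" "b k"]
    by (simp add: minus_add minus_eq a_comm flip: smult_minus_right)
qed (simp_all add: g_0 h_0 qcm_a0_g qcm_h_a0 qcm_g_b0 qcm_b0_h cm_a_a cm_b_b cm_a_b cm_a_g cm_a_h
    cm_b_g cm_b_h cm_g_g cm_h_h cm_h_g a_comm[of "cm (b _) _"] a_comm[of "cm (g _) _"])

end

text \<open>Explains the value of G_0: it gives [W_0, G_0]_q = \<rho> W_0, so that the scalar term
  of a convolution behaves like the missing lowest case of the q-commutator relations.\<close>

lemma G_zero_mult:
  assumes "q \<noteq> 0" "q - inverse q \<noteq> (0::'a::field)"
  shows "(q - inverse q) * G_zero q = - ((q\<^sup>2 - inverse q ^ 2)\<^sup>2)"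
proof -
  have "qint q 2 = q + inverse q"
    using assms by (simp add: qint_def power2_eq_square square_diff_square_factored)
  then show ?thesis by (simp add: G_zero_def power2_eq_square algebra_simps)
qed

text \<open>Commutation of \<open>z\<close> with anything is left to the individual lemmas: in the
  induction that determines the central sequence it is known only up to a bound, so each lemma
  states the bound that it needs.\<close>

locale conv_rep = ace_rep A q a b g h
  for A :: "('a::field, 'b) module" (structure) and q a b g h +
  fixes z :: "nat \<Rightarrow> 'b"
  assumes z [simp]: "z k \<in> carrier A"
    and q_nz: "q \<noteq> 0" "q - inverse q \<noteq> 0"
begin

text \<open>The bound \<open>n\<close> suffices although \<open>z (Suc n)\<close> occurs on the
  right: \<open>g 0\<close> and \<open>h 0\<close> are the same scalar, so their terms
  cancel.\<close>

lemma cm_a0_conv: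
  assumes "\<And>k. k \<le> n \<Longrightarrow> z k \<otimes> a 0 = a 0 \<otimes> z k"
  shows "cm (a 0) (conv b z n) = inverse (q + inverse q) \<odot> (conv h z (Suc n) \<ominus> conv g z (Suc n))"
proof -
  have "cm (a 0) (conv b z n) = conv (\<lambda>i. cm (a 0) (b i)) z n"
    by (rule cm_conv_right) (simp_all add: assms)
  also have "\<dots> = inverse (q + inverse q) \<odot>
      (conv (\<lambda>i. h (Suc i)) z n \<ominus> conv (\<lambda>i. g (Suc i)) z n)"
    by (simp add: cm_a0_b conv_smult conv_diff)
  also have "conv (\<lambda>i. h (Suc i)) z n \<ominus> conv (\<lambda>i. g (Suc i)) z n = conv h z (Suc n) \<ominus> conv g z (Suc n)"
    by (simp add: conv_Suc g_0 h_0 minus_eq minus_add a_ac r_neg1 r_neg2 l_neg r_neg)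
  finally show ?thesis .
qed

text \<open>The relations handle the terms of positive index. The scalar term contributes \<rho>
  times \<open>a 0 \<otimes> z (Suc n)\<close>, exactly what the shifted sum lacks in order to
  become \<open>conv a z (Suc n)\<close>.\<close>

lemma qcm_a0_conv:
  assumes "\<And>k. k \<le> Suc n \<Longrightarrow> z k \<otimes> a 0 = a 0 \<otimes> z k"
  shows "qcm q (a 0) (conv g z (Suc n)) = \<rho> \<odot> conv a z (Suc n) \<ominus> \<rho> \<odot> conv b z n"
    and "qcm q (conv h z (Suc n)) (a 0) = \<rho> \<odot> conv a z (Suc n) \<ominus> \<rho> \<odot> conv b z n"
proof -
  let ?t = "a 0 \<otimes> z (Suc n)"
  have t: "qcm q (a 0) (g 0 \<otimes> z (Suc n)) = \<rho> \<odot> ?t" "qcm q (h 0 \<otimes> z (Suc n)) (a 0) = \<rho> \<odot> ?t"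
    using assms[of "Suc n"] G_zero_mult[OF q_nz]
    by (simp_all add: g_0 h_0 smult_mult_left qcm_smult qcm_commuting smult_smult mult.commute)
  have r: "conv (\<lambda>i. \<rho> \<odot> a (Suc i) \<ominus> \<rho> \<odot> b i) z n \<oplus> \<rho> \<odot> ?t =
      \<rho> \<odot> conv a z (Suc n) \<ominus> \<rho> \<odot> conv b z n"
    by (simp add: conv_smult conv_diff conv_Suc smult_r_distr) (simp add: minus_eq a_ac)
  have "qcm q (a 0) (conv g z (Suc n)) =
      qcm q (a 0) (conv (\<lambda>i. g (Suc i)) z n) \<oplus> qcm q (a 0) (g 0 \<otimes> z (Suc n))"
    by (simp add: conv_Suc qcm_linear)
  also have "qcm q (a 0) (conv (\<lambda>i. g (Suc i)) z n) = conv (\<lambda>i. qcm q (a 0) (g (Suc i))) z n"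
    by (rule qcm_conv_right) (simp_all add: assms)
  finally show "qcm q (a 0) (conv g z (Suc n)) = \<rho> \<odot> conv a z (Suc n) \<ominus> \<rho> \<odot> conv b z n"
    by (simp only: t qcm_a0_g r)
  have "qcm q (conv h z (Suc n)) (a 0) =
      qcm q (conv (\<lambda>i. h (Suc i)) z n) (a 0) \<oplus> qcm q (h 0 \<otimes> z (Suc n)) (a 0)"
    by (simp add: conv_Suc qcm_linear)
  also have "qcm q (conv (\<lambda>i. h (Suc i)) z n) (a 0) = conv (\<lambda>i. qcm q (h (Suc i)) (a 0)) z n"
    by (rule qcm_conv_left) (simp_all add: assms)
  finally show "qcm q (conv h z (Suc n)) (a 0) = \<rho> \<odot> conv a z (Suc n) \<ominus> \<rho> \<odot> conv b z n"
    by (simp only: t qcm_h_a0 r)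
qed

text \<open>Without commutation at \<open>Suc n\<close> both sides still share the part of positive
  index. What is left of \<open>eq\<close> says that the q-commutator of \<open>a 0\<close> and
  \<open>z (Suc n)\<close> is symmetric, which forces them to commute.\<close>

lemma qcm_a0_conv_lower:
  assumes "\<And>k. k \<le> n \<Longrightarrow> z k \<otimes> a 0 = a 0 \<otimes> z k"
    and eq: "qcm q (a 0) (conv g z (Suc n)) = qcm q (conv h z (Suc n)) (a 0)"
    and q2: "q + inverse q \<noteq> 0" "G_zero q \<noteq> 0"
  shows "z (Suc n) \<otimes> a 0 = a 0 \<otimes> z (Suc n)"
proof -
  let ?L = "conv (\<lambda>i. \<rho> \<odot> a (Suc i) \<ominus> \<rho> \<odot> b i) z n"
  have "qcm q (a 0) (conv (\<lambda>i. g (Suc i)) z n) = conv (\<lambda>i. qcm q (a 0) (g (Suc i))) z n"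
    by (rule qcm_conv_right) (simp_all add: assms(1))
  then have 1: "qcm q (a 0) (conv g z (Suc n)) = ?L \<oplus> G_zero q \<odot> qcm q (a 0) (z (Suc n))"
    by (simp add: conv_Suc qcm_linear qcm_smult g_0 smult_mult_left qcm_a0_g)
  have "qcm q (conv (\<lambda>i. h (Suc i)) z n) (a 0) = conv (\<lambda>i. qcm q (h (Suc i)) (a 0)) z n"
    by (rule qcm_conv_left) (simp_all add: assms(1))
  then have 2: "qcm q (conv h z (Suc n)) (a 0) = ?L \<oplus> G_zero q \<odot> qcm q (z (Suc n)) (a 0)"
    by (simp add: conv_Suc qcm_linear qcm_smult h_0 smult_mult_left qcm_h_a0)
  have "G_zero q \<odot> qcm q (a 0) (z (Suc n)) = G_zero q \<odot> qcm q (z (Suc n)) (a 0)"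
    using eq unfolding 1 2 by (simp add: a_comm[of ?L] add.right_cancel)
  then have "qcm q (a 0) (z (Suc n)) = qcm q (z (Suc n)) (a 0)"
    by (rule smult_cancel[OF q2(2), rotated 2]) simp_all
  then have "a 0 \<otimes> z (Suc n) = z (Suc n) \<otimes> a 0"
    by (rule qcm_sym_commute[OF _ _ q2(1), rotated 2]) simp_all
  then show ?thesis by simp
qed

lemma swap_conv: "conv_rep A q b a h g z"
  using swap q_nz by (simp add: conv_rep_def conv_rep_axioms_def)

lemma cm_conv_b0:
  assumes "\<And>k. k \<le> n \<Longrightarrow> z k \<otimes> b 0 = b 0 \<otimes> z k"
  shows "cm (conv a z n) (b 0) = inverse (q + inverse q) \<odot> (conv h z (Suc n) \<ominus> conv g z (Suc n))"
  using conv_rep.cm_a0_conv[OF swap_conv, of n] assms cm_antisym[of "b 0" "conv a z n"]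
  by (simp add: minus_add minus_eq a_comm flip: smult_minus_right)

lemmas qcm_b0_conv = conv_rep.qcm_a0_conv[OF swap_conv]
lemmas qcm_b0_conv_lower = conv_rep.qcm_a0_conv_lower[OF swap_conv]

end

text \<open>The setting for the existence of \<phi>: convolving with a central sequence that starts
  at \<open>\<one>\<close> gives a quadruple with the same initial terms.\<close>

locale central_conv_rep = conv_rep +
  assumes z_central: "x \<in> carrier A \<Longrightarrow> z k \<otimes> x = x \<otimes> z k"
    and z_0: "z 0 = \<one>"
begin

lemma cm_conv_conv:
  assumes "\<And>i. x i \<in> carrier A" "\<And>i. y i \<in> carrier A"
  shows "cm (conv x z k) (conv y z l) = conv (\<lambda>i. conv (\<lambda>j. cm (x i) (y j)) z l) z k"
proof -
  have "cm (conv x z k) (conv y z l) = conv (\<lambda>i. cm (x i) (conv y z l)) z k"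
    by (rule cm_conv_left) (simp_all add: z_central assms)
  also have "\<dots> = conv (\<lambda>i. conv (\<lambda>j. cm (x i) (y j)) z l) z k"
    by (intro conv_cong cm_conv_right) (simp_all add: z_central assms)
  finally show ?thesis .
qed

lemma cm_conv_zero:
  assumes "\<And>i. x i \<in> carrier A" "\<And>i. y i \<in> carrier A" "\<And>i j. cm (x i) (y j) = \<zero>"
  shows "cm (conv x z k) (conv y z l) = \<zero>"
  using assms by (simp add: cm_conv_conv conv_zero)

lemma cm_conv_sum:
  assumes "\<And>i. x i \<in> carrier A" "\<And>i. y i \<in> carrier A" "\<And>i. x' i \<in> carrier A" "\<And>i. y' i \<in> carrier A"
    and "\<And>i j. cm (x i) (y j) \<oplus> cm (x' i) (y' j) = \<zero>"
  shows "cm (conv x z k) (conv y z l) \<oplus> cm (conv x' z k) (conv y' z l) = \<zero>"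
proof -
  have "cm (conv x z k) (conv y z l) \<oplus> cm (conv x' z k) (conv y' z l) =
      conv (\<lambda>i. conv (\<lambda>j. cm (x i) (y j) \<oplus> cm (x' i) (y' j)) z l) z k"
    using assms(1-4) by (simp add: cm_conv_conv conv_add)
  then show ?thesis by (simp add: assms(5) conv_zero)
qed

text \<open>These terms are scalar multiples of central elements and drop out of commutators, so
  that the relations for positive indices suffice.\<close>

lemma cm_scalar_central:
  assumes "x \<in> carrier A"
  shows "cm (g 0 \<otimes> z k) x = \<zero>" "cm x (g 0 \<otimes> z k) = \<zero>"
    and "cm (h 0 \<otimes> z k) x = \<zero>" "cm x (h 0 \<otimes> z k) = \<zero>"
proof -
  have "cm (z k) x = \<zero>" "cm x (z k) = \<zero>"
    using assms z_central[OF assms, of k] by (simp_all add: cm_eq_zero_iff)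
  then show "cm (g 0 \<otimes> z k) x = \<zero>" "cm x (g 0 \<otimes> z k) = \<zero>"
    "cm (h 0 \<otimes> z k) x = \<zero>" "cm x (h 0 \<otimes> z k) = \<zero>"
    using assms by (simp_all add: g_0 h_0 smult_mult_left cm_smult)
qed

lemma cm_conv_Suc:
  assumes "x \<in> carrier A"
  shows "cm x (conv g z (Suc k)) = cm x (conv (\<lambda>i. g (Suc i)) z k)"
    and "cm (conv g z (Suc k)) x = cm (conv (\<lambda>i. g (Suc i)) z k) x"
    and "cm x (conv h z (Suc k)) = cm x (conv (\<lambda>i. h (Suc i)) z k)"
    and "cm (conv h z (Suc k)) x = cm (conv (\<lambda>i. h (Suc i)) z k) x"
  using assms by (simp_all add: conv_Suc cm_linear cm_scalar_central)

text \<open>The first six relations are linear in the family once \<open>a 0\<close> or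
  \<open>b 0\<close> is fixed, and \<open>z 0 = \<one>\<close> leaves these two unchanged. The
  others are bilinear and pass through the double convolution in
  \<open>cm_conv_conv\<close>.\<close>

lemma ace_rep_conv: "ace_rep A q (conv a z) (conv b z) (conv g z) (conv h z)"
proof (unfold_locales, goal_cases)
  case 5 show ?case by (simp add: conv_0 z_0 g_0)
next
  case 6 show ?case by (simp add: conv_0 z_0 h_0)
next
  case 7 then show ?case using cm_a0_conv by (simp add: conv_0 z_0 z_central)
next
  case 8 then show ?case using cm_conv_b0 by (simp add: conv_0 z_0 z_central)
next
  case 9 then show ?case using qcm_a0_conv by (simp add: conv_0 z_0 z_central)
next
  case 10 then show ?case using qcm_a0_conv by (simp add: conv_0 z_0 z_central)
next
  case 11 then show ?case using qcm_b0_conv by (simp add: conv_0 z_0 z_central)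
next
  case 12 then show ?case using qcm_b0_conv by (simp add: conv_0 z_0 z_central)
qed (simp_all add: cm_conv_Suc cm_conv_zero cm_conv_sum cm_a_a cm_b_b cm_a_b cm_a_g cm_a_h cm_b_g
    cm_b_h cm_g_g cm_h_h cm_h_g)

end

text \<open>The commutator [a_0, b_0] is a multiple of h_1 - g_1, and a further bracket with a_0
  turns either term, up to sign, into u = \<rho> a_1 - \<rho> b_0. The two remaining brackets of u
  add up to a multiple of [a_0, u], from which a_1 drops out because it commutes with a_0.\<close>

lemma (in ace_rep) dolan_grady:
  assumes "q + inverse q \<noteq> 0"
  shows "cm (a 0) (qcm (inverse q) (a 0) (qcm q (a 0) (b 0))) =
    (q\<^sup>2 - inverse q ^ 2)\<^sup>2 \<odot> cm (b 0) (a 0)"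
proof -
  let ?d = "inverse (q + inverse q)" and ?u = "qcm q (a 0) (g (Suc 0))"
  have hu: "qcm q (h (Suc 0)) (a 0) = ?u" by (simp only: qcm_a0_g qcm_h_a0)
  have "cm (a 0) (qcm (inverse q) (a 0) (qcm q (a 0) (b 0))) =
      qcm (inverse q) (a 0) (qcm q (a 0) (cm (a 0) (b 0)))"
    by (simp add: cm_qcm_qcm)
  also have "\<dots> = ?d \<odot> (qcm q (a 0) (qcm (inverse q) (a 0) (h (Suc 0))) \<ominus> qcm (inverse q) (a 0) ?u)"
  proof -
    \<comment> \<open>The two brackets are interchanged on h_1 only, so that h_1 and g_1 each first
      meet the bracket that their relation evaluates.\<close>
    have "qcm (inverse q) (a 0) (qcm q (a 0) (h (Suc 0))) = qcm q (a 0) (qcm (inverse q) (a 0) (h (Suc 0)))"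
      by (simp add: qcm_def nf_simps mult.commute)
    then show ?thesis by (simp add: cm_a0_b qcm_smult qcm_linear)
  qed
  also have "qcm (inverse q) (a 0) (h (Suc 0)) = \<ominus> ?u" by (simp add: qcm_flip hu)
  also have "qcm q (a 0) (\<ominus> ?u) \<ominus> qcm (inverse q) (a 0) ?u = \<ominus> ((q + inverse q) \<odot> cm (a 0) ?u)"
    by (simp add: qcm_smult minus_eq minus_add flip: qcm_add_flip)
  also have "?d \<odot> \<ominus> ((q + inverse q) \<odot> cm (a 0) ?u) = \<ominus> cm (a 0) ?u"
    using assms by (simp add: smult_minus_right smult_smult)
  also have "cm (a 0) ?u = \<ominus> (\<rho> \<odot> cm (a 0) (b 0))"
    by (simp add: qcm_a0_g cm_linear cm_smult cm_a_a minus_eq)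
  also have "\<ominus> (\<ominus> (\<rho> \<odot> cm (a 0) (b 0))) = (q\<^sup>2 - inverse q ^ 2)\<^sup>2 \<odot> cm (b 0) (a 0)"
    using cm_antisym[of "a 0" "b 0"] by (simp add: smult_minus_left smult_minus_right)
  finally show ?thesis .
qed

section \<open>Recovering the central elements\<close>

text \<open>
  Two families with the same initial terms differ by the convolution with a sequence that commutes
  with these initial terms.
\<close>

locale two_reps = ace_rep A q a b g h + big: ace_rep A q a' b' g' h'
  for A :: "('a::field, 'b) module" (structure) and q a b g h a' b' g' h' +
  assumes a'_0: "a' 0 = a 0" and b'_0: "b' 0 = b 0"
    and q_ne: "q \<noteq> 0" "q - inverse q \<noteq> 0" "q + inverse q \<noteq> 0"
begin

lemma G_zero_nz: "G_zero q \<noteq> 0"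
proof
  assume "G_zero q = 0"
  then have "(q\<^sup>2 - inverse q ^ 2)\<^sup>2 = 0" using G_zero_mult[OF q_ne(1,2)] by simp
  then show False using q_ne by (simp add: square_diff_square_factored power2_eq_square)
qed

lemma rho_nz: "\<rho> \<noteq> 0"
  using G_zero_nz G_zero_mult[OF q_ne(1,2)] q_ne(2) by (metis mult_eq_0_iff)

text \<open>Left division of the series \<open>g'\<close> by \<open>g\<close>, possible because the
  zeroth term of \<open>g\<close> is an invertible scalar.\<close>

definition zeta :: "nat \<Rightarrow> 'b" where
  "zeta = wfrec less_than
    (\<lambda>z n. inverse (G_zero q) \<odot> (g' n \<ominus> (\<Oplus>k\<in>{..<n}. g (n - k) \<otimes> z k)))"

text \<open>Closure and recursion equation are proved together: removing \<open>cut\<close> under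
  the sum needs the earlier terms to lie in the carrier, and closure of the next term is read off
  from the equation.\<close>

lemma zeta_carr_eq:
  "zeta n \<in> carrier A \<and>
    zeta n = inverse (G_zero q) \<odot> (g' n \<ominus> (\<Oplus>k\<in>{..<n}. g (n - k) \<otimes> zeta k))"
proof (induction n rule: less_induct)
  case (less n)
  have c: "zeta k \<in> carrier A" if "k < n" for k using less that by blast
  have "zeta n = inverse (G_zero q) \<odot> (g' n \<ominus> (\<Oplus>k\<in>{..<n}. g (n - k) \<otimes> cut zeta less_than n k))"
    by (rule def_wfrec[OF zeta_def[THEN eq_reflection] wf_less_than])
  also have "(\<Oplus>k\<in>{..<n}. g (n - k) \<otimes> cut zeta less_than n k) = (\<Oplus>k\<in>{..<n}. g (n - k) \<otimes> zeta k)"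
    by (rule finsum_cong') (simp_all add: Pi_iff c cut_apply)
  finally have eq: "zeta n = inverse (G_zero q) \<odot> (g' n \<ominus> (\<Oplus>k\<in>{..<n}. g (n - k) \<otimes> zeta k))" .
  have "(\<Oplus>k\<in>{..<n}. g (n - k) \<otimes> zeta k) \<in> carrier A"
    by (rule finsum_closed) (simp add: Pi_iff c)
  then have "zeta n \<in> carrier A" unfolding eq by simp
  with eq show ?case by blast
qed

lemma zeta_carr [simp]: "zeta n \<in> carrier A"
  using zeta_carr_eq by blast

sublocale conv_rep A q a b g h zeta
  by unfold_locales (use q_ne in auto)

lemma g'_conv: "g' n = conv g zeta n"
proof -
  let ?s = "\<Oplus>k\<in>{..<n}. g (n - k) \<otimes> zeta k"
  have s: "?s \<in> carrier A" by (rule finsum_closed) auto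
  have "conv g zeta n = g 0 \<otimes> zeta n \<oplus> ?s" by (rule conv_last) simp_all
  also have "g 0 \<otimes> zeta n = G_zero q \<odot> zeta n" by (simp add: g_0 smult_mult_left)
  also have "\<dots> = g' n \<ominus> ?s"
  proof -
    have "zeta n = inverse (G_zero q) \<odot> (g' n \<ominus> ?s)" using zeta_carr_eq by blast
    then show ?thesis using s G_zero_nz by (simp add: smult_smult)
  qed
  finally show ?thesis using s by (simp add: minus_eq a_assoc l_neg)
qed

lemma zeta_0: "zeta 0 = \<one>"
proof (rule smult_cancel[OF G_zero_nz])
  show "G_zero q \<odot> zeta 0 = G_zero q \<odot> \<one>"
    using g'_conv[of 0] by (simp add: conv_0 g_0 big.g_0 smult_mult_left)
qed simp_all

text \<open>In degree n + 1 the relations are used in a fixed order. The commutator [a_0, b_n]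
  determines the term of \<open>h'\<close>; the q-commutators then show that the new term of
  \<open>zeta\<close> commutes with a_0 and b_0; with this known, they can be evaluated and give the
  terms of \<open>a'\<close> and \<open>b'\<close> after division by \<rho>.\<close>

lemma zeta_conv:
  "zeta n \<otimes> a 0 = a 0 \<otimes> zeta n \<and> zeta n \<otimes> b 0 = b 0 \<otimes> zeta n \<and>
   h' n = conv h zeta n \<and> a' n = conv a zeta n \<and> b' n = conv b zeta n"
proof (induction n rule: less_induct)
  case (less n)
  show ?case
  proof (cases n)
    case 0
    then show ?thesis by (simp add: zeta_0 conv_0 big.h_0 h_0 a'_0 b'_0)
  next
    case (Suc m)
    have ca: "zeta k \<otimes> a 0 = a 0 \<otimes> zeta k" and cb: "zeta k \<otimes> b 0 = b 0 \<otimes> zeta k" if "k \<le> m" for k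
      using less[of k] that Suc by auto
    have a': "a' m = conv a zeta m" and b': "b' m = conv b zeta m"
      using less[of m] Suc by auto
    have d: "inverse (q + inverse q) \<noteq> 0" using q_ne by simp
    have "inverse (q + inverse q) \<odot> (h' (Suc m) \<ominus> g' (Suc m)) =
        inverse (q + inverse q) \<odot> (conv h zeta (Suc m) \<ominus> conv g zeta (Suc m))"
      using big.cm_a0_b[of m] cm_a0_conv[OF ca] by (simp add: a'_0 b')
    then have "h' (Suc m) \<ominus> g' (Suc m) = conv h zeta (Suc m) \<ominus> conv g zeta (Suc m)"
      by (rule smult_cancel[OF d, rotated 2]) simp_all
    then have h': "h' (Suc m) = conv h zeta (Suc m)" by (simp add: g'_conv minus_eq)
    have ca': "zeta (Suc m) \<otimes> a 0 = a 0 \<otimes> zeta (Suc m)"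
    proof (rule qcm_a0_conv_lower[OF ca])
      \<comment> \<open>Both sides are evaluated in the big family, where they have the same value
        by two of its relations.\<close>
      show "qcm q (a 0) (conv g zeta (Suc m)) = qcm q (conv h zeta (Suc m)) (a 0)"
        using big.qcm_a0_g[of m] big.qcm_h_a0[of m] by (simp add: a'_0 h' g'_conv)
    qed (simp_all add: q_ne G_zero_nz)
    have cb': "zeta (Suc m) \<otimes> b 0 = b 0 \<otimes> zeta (Suc m)"
    proof (rule qcm_b0_conv_lower[OF cb])
      show "qcm q (b 0) (conv h zeta (Suc m)) = qcm q (conv g zeta (Suc m)) (b 0)"
        using big.qcm_b0_h[of m] big.qcm_g_b0[of m] by (simp add: b'_0 h' g'_conv)
    qed (simp_all add: q_ne G_zero_nz)
    have ca2: "zeta k \<otimes> a 0 = a 0 \<otimes> zeta k" and cb2: "zeta k \<otimes> b 0 = b 0 \<otimes> zeta k" if "k \<le> Suc m" for k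
      using ca cb ca' cb' that by (cases "k = Suc m"; simp)+
    have cancel: "x = y" if "\<rho> \<odot> x \<ominus> w = \<rho> \<odot> y \<ominus> w" "x \<in> carrier A" "y \<in> carrier A" "w \<in> carrier A"
      for x y w
    proof (rule smult_cancel[OF rho_nz that(2,3)])
      show "\<rho> \<odot> x = \<rho> \<odot> y" using that by (simp add: minus_eq)
    qed
    have "\<rho> \<odot> a' (Suc m) \<ominus> \<rho> \<odot> conv b zeta m = \<rho> \<odot> conv a zeta (Suc m) \<ominus> \<rho> \<odot> conv b zeta m"
      using big.qcm_a0_g[of m] qcm_a0_conv(1)[OF ca2] by (simp add: a'_0 b' g'_conv)
    then have "a' (Suc m) = conv a zeta (Suc m)" by (rule cancel) simp_all
    moreover have "\<rho> \<odot> b' (Suc m) \<ominus> \<rho> \<odot> conv a zeta m = \<rho> \<odot> conv b zeta (Suc m) \<ominus> \<rho> \<odot> conv a zeta m"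
      using big.qcm_b0_h[of m] qcm_b0_conv(1)[OF cb2] by (simp add: b'_0 a' h')
    then have "b' (Suc m) = conv b zeta (Suc m)" by (rule cancel) simp_all
    ultimately show ?thesis using Suc ca' cb' h' by blast
  qed
qed

text \<open>The sequence is central when the small family lies in the subalgebra generated by its
  initial terms and the big family generates the algebra.\<close>

lemma zeta_central:
  assumes small: "\<And>y i. y \<in> carrier A \<Longrightarrow> y \<otimes> a 0 = a 0 \<otimes> y \<Longrightarrow> y \<otimes> b 0 = b 0 \<otimes> y \<Longrightarrow>
      y \<otimes> a i = a i \<otimes> y \<and> y \<otimes> b i = b i \<otimes> y \<and> y \<otimes> g i = g i \<otimes> y \<and> y \<otimes> h i = h i \<otimes> y"
    and big: "\<And>y. y \<in> carrier A \<Longrightarrow> (\<And>i. y \<otimes> a' i = a' i \<otimes> y \<and> y \<otimes> b' i = b' i \<otimes> y \<and>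
      y \<otimes> g' (Suc i) = g' (Suc i) \<otimes> y \<and> y \<otimes> h' (Suc i) = h' (Suc i) \<otimes> y) \<Longrightarrow>
      (\<And>x. x \<in> carrier A \<Longrightarrow> y \<otimes> x = x \<otimes> y)"
    and x: "x \<in> carrier A"
  shows "zeta n \<otimes> x = x \<otimes> zeta n"
proof -
  have small': "zeta n \<otimes> a i = a i \<otimes> zeta n" "zeta n \<otimes> b i = b i \<otimes> zeta n"
    "zeta n \<otimes> g i = g i \<otimes> zeta n" "zeta n \<otimes> h i = h i \<otimes> zeta n" for n i
    using small[OF zeta_carr, of n i] zeta_conv[of n] by blast+
  have conv_comm: "y \<otimes> conv x zeta n = conv x zeta n \<otimes> y"
    if "y \<in> carrier A" "\<And>i. x i \<in> carrier A" "\<And>i. y \<otimes> x i = x i \<otimes> y" "\<And>k. zeta k \<otimes> y = y \<otimes> zeta k"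
    for x y n
  proof -
    have "cm y (conv x zeta n) = conv (\<lambda>i. cm y (x i)) zeta n"
      by (rule cm_conv_right) (simp_all add: that)
    also have "\<dots> = \<zero>" using that(1-3) by (simp add: conv_zero cm_eq_zero_iff[THEN iffD2])
    finally show ?thesis using that(1,2) by (simp add: cm_eq_zero_iff)
  qed
  \<comment> \<open>By its recursion \<open>zeta n\<close> is a polynomial in terms of
    \<open>g\<close> and \<open>g'\<close>, so whatever commutes with these commutes with
    it.\<close>
  have sum_comm: "y \<otimes> zeta n = zeta n \<otimes> y"
    if y: "y \<in> carrier A" "\<And>i. y \<otimes> g i = g i \<otimes> y" "\<And>i. y \<otimes> g' i = g' i \<otimes> y" for y n
  proof (induction n rule: less_induct)
    case (less n)
    let ?s = "\<Oplus>k\<in>{..<n}. g (n - k) \<otimes> zeta k"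
    have s: "?s \<in> carrier A" by (rule finsum_closed) auto
    have "y \<otimes> ?s = (\<Oplus>k\<in>{..<n}. y \<otimes> (g (n - k) \<otimes> zeta k))"
      using y(1) by (intro finsum_rdistr) auto
    also have "\<dots> = (\<Oplus>k\<in>{..<n}. (g (n - k) \<otimes> zeta k) \<otimes> y)"
    proof (rule finsum_cong')
      fix k assume "k \<in> {..<n}"
      then have "zeta k \<otimes> y = y \<otimes> zeta k" using less by simp
      then have "(g (n - k) \<otimes> zeta k) \<otimes> y = (g (n - k) \<otimes> y) \<otimes> zeta k" using y(1) by (simp add: m_assoc)
      also have "\<dots> = (y \<otimes> g (n - k)) \<otimes> zeta k" by (simp only: y(2))
      finally show "y \<otimes> (g (n - k) \<otimes> zeta k) = (g (n - k) \<otimes> zeta k) \<otimes> y" using y(1) by (simp add: m_assoc)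
    qed (use y(1) in auto)
    also have "\<dots> = ?s \<otimes> y" using y(1) by (intro finsum_ldistr[symmetric]) auto
    finally have ys: "y \<otimes> ?s = ?s \<otimes> y" .
    have eq: "zeta n = inverse (G_zero q) \<odot> (g' n \<ominus> ?s)" using zeta_carr_eq by blast
    show ?case
      unfolding eq using y(1,3) s ys
      by (simp add: smult_mult_left smult_mult_right minus_eq l_distr r_distr l_minus r_minus)
  qed
  \<comment> \<open>To commute with convolutions, the terms of \<open>zeta\<close> must commute with
    one another. This comes from the commutativity of \<open>g\<close> and of \<open>g'\<close>:
    each \<open>g j\<close> commutes with \<open>g\<close> and \<open>zeta\<close>, hence with
    \<open>g'\<close>; then \<open>sum_comm\<close> applies to \<open>g' i\<close> and finally to
    \<open>zeta m\<close>.\<close>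
  have g_g: "g i \<otimes> g j = g j \<otimes> g i" for i j
  proof -
    have *: "g (Suc k) \<otimes> g (Suc l) = g (Suc l) \<otimes> g (Suc k)" for k l
      by (rule cm_eq_zero_iff[THEN iffD1]) (rule g_carr cm_g_g)+
    show ?thesis
      by (cases i; cases j) (simp_all add: * g_0 smult_mult_left smult_mult_right)
  qed
  have g'_g': "g' i \<otimes> g' j = g' j \<otimes> g' i" for i j
  proof -
    have *: "g' (Suc k) \<otimes> g' (Suc l) = g' (Suc l) \<otimes> g' (Suc k)" for k l
      by (rule cm_eq_zero_iff[THEN iffD1]) (rule big.g_carr big.cm_g_g)+
    show ?thesis
      by (cases i; cases j) (simp_all add: * big.g_0 smult_mult_left smult_mult_right)
  qed
  have gg': "g j \<otimes> g' i = g' i \<otimes> g j" for i j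
    unfolding g'_conv[of i] by (rule conv_comm) (rule g_carr g_g small')+
  have g'_z: "g' i \<otimes> zeta n = zeta n \<otimes> g' i" for i n
    by (rule sum_comm) (rule big.g_carr gg'[symmetric] g'_g')+
  have z_z: "zeta m \<otimes> zeta n = zeta n \<otimes> zeta m" for m n
    by (rule sum_comm) (rule zeta_carr small' g'_z[symmetric])+
  \<comment> \<open>Commuting with the small family and with the sequence itself,
    \<open>zeta n\<close> commutes with their convolutions, which form the big family.\<close>
  have abh: "zeta n \<otimes> a' i = a' i \<otimes> zeta n" "zeta n \<otimes> b' i = b' i \<otimes> zeta n"
    "zeta n \<otimes> h' i = h' i \<otimes> zeta n" for i
  proof -
    have "a' i = conv a zeta i" "b' i = conv b zeta i" "h' i = conv h zeta i"
      using zeta_conv[of i] by blast+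
    moreover have "zeta n \<otimes> conv a zeta i = conv a zeta i \<otimes> zeta n"
      by (rule conv_comm) (rule zeta_carr a_carr small' z_z)+
    moreover have "zeta n \<otimes> conv b zeta i = conv b zeta i \<otimes> zeta n"
      by (rule conv_comm) (rule zeta_carr b_carr small' z_z)+
    moreover have "zeta n \<otimes> conv h zeta i = conv h zeta i \<otimes> zeta n"
      by (rule conv_comm) (rule zeta_carr h_carr small' z_z)+
    ultimately show "zeta n \<otimes> a' i = a' i \<otimes> zeta n" "zeta n \<otimes> b' i = b' i \<otimes> zeta n"
      "zeta n \<otimes> h' i = h' i \<otimes> zeta n" by simp_all
  qed
  have "zeta n \<otimes> a' i = a' i \<otimes> zeta n \<and> zeta n \<otimes> b' i = b' i \<otimes> zeta n \<and>
      zeta n \<otimes> g' (Suc i) = g' (Suc i) \<otimes> zeta n \<and> zeta n \<otimes> h' (Suc i) = h' (Suc i) \<otimes> zeta n" for i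
    by (intro conjI abh) (rule g'_z[symmetric])
  from big[OF zeta_carr this x] show ?thesis .
qed

end

section \<open>Universal properties\<close>

lemma presented_induct [consumes 1, case_names one gen add mult smult]:
  assumes "X \<in> carrier (presented_alg R)"
    and "P \<one>\<^bsub>presented_alg R\<^esub>" and "\<And>x. P (presented_cls R (gen x))"
    and "\<And>X Y. X \<in> carrier (presented_alg R) \<Longrightarrow> Y \<in> carrier (presented_alg R) \<Longrightarrow> P X \<Longrightarrow> P Y \<Longrightarrow>
      P (X \<oplus>\<^bsub>presented_alg R\<^esub> Y)"
    and "\<And>X Y. X \<in> carrier (presented_alg R) \<Longrightarrow> Y \<in> carrier (presented_alg R) \<Longrightarrow> P X \<Longrightarrow> P Y \<Longrightarrow>
      P (X \<otimes>\<^bsub>presented_alg R\<^esub> Y)"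
    and "\<And>c X. X \<in> carrier (presented_alg R) \<Longrightarrow> P X \<Longrightarrow> P (c \<odot>\<^bsub>presented_alg R\<^esub> X)"
  shows "P X"
proof -
  interpret c: falg_hom monoid_alg "presented_alg R" "presented_cls R"
    by (rule falg_homI[OF falg_monoid_alg falg_presented presented_cls_hom])
  have cl: "presented_cls R p \<in> carrier (presented_alg R)" for p
    using c.hom_closed[of p] by simp
  obtain p where "X = presented_cls R p" using assms(1) by (auto simp: presented_cls_surj)
  moreover have "P (presented_cls R p)"
  proof (induction p rule: free_alg_induct)
    case one
    then show ?case using assms(2) c.hom_one by simp
  next
    case (gen x)
    show ?case by (rule assms(3))
  next
    case (add p r)
    then show ?case using assms(4)[OF cl cl] c.hom_add[of p r] by simp
  next
    case (mult p r)
    then show ?case using assms(5)[OF cl cl] c.hom_mult[of p r] by simp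
  next
    case (smult c p)
    then show ?case using assms(6)[OF cl] c.hom_smult[of p c] by (simp add: monoid_alg_smult_const)
  qed
  ultimately show ?thesis by simp
qed

section \<open>Evaluating the relations under a homomorphism\<close>

locale free_alg_hom = B: falg B for B :: "('a::field, 'b) module" +
  fixes k :: "('x, 'a) free_alg \<Rightarrow> 'b"
  assumes k_hom: "k \<in> alg_hom monoid_alg B"
begin

sublocale k: falg_hom monoid_alg B k
  by (rule falg_homI[OF falg_monoid_alg B.falg_axioms k_hom])

lemma k_closed [simp]: "k p \<in> carrier B"
  using k.hom_closed[of p] by simp

lemma k_simps [simp]:
  "k 1 = \<one>\<^bsub>B\<^esub>" "k 0 = \<zero>\<^bsub>B\<^esub>" "k (p + r) = k p \<oplus>\<^bsub>B\<^esub> k r" "k (p - r) = k p \<ominus>\<^bsub>B\<^esub> k r"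
  "k (p * r) = k p \<otimes>\<^bsub>B\<^esub> k r" "k (const c) = c \<odot>\<^bsub>B\<^esub> \<one>\<^bsub>B\<^esub>"
proof -
  show 1: "k 1 = \<one>\<^bsub>B\<^esub>" using k.hom_one by simp
  show "k (const c) = c \<odot>\<^bsub>B\<^esub> \<one>\<^bsub>B\<^esub>"
    using k.hom_smult[of 1 c] by (simp add: monoid_alg_smult_const 1)
qed (use k.hom_zero k.hom_add[of p r] k.hom_diff[of p r] k.hom_mult[of p r] in
    \<open>simp_all add: monoid_alg_diff\<close>)

lemma k_comm [simp]: "k (comm p r) = B.cm (k p) (k r)"
  by (simp add: comm_def B.cm_def)

lemma k_qcomm [simp]: "k (qcomm c p r) = B.qcm c (k p) (k r)"
  by (simp add: qcomm_def B.qcm_def B.smult_mult_left)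

lemma k_const_mult: "k (const c * p) = c \<odot>\<^bsub>B\<^esub> k p"
  by (simp add: B.smult_mult_left)

end

lemma free_alg_homI: "falg B \<Longrightarrow> k \<in> alg_hom monoid_alg B \<Longrightarrow> free_alg_hom B k"
  by (simp add: free_alg_hom_def free_alg_hom_axioms_def)

text \<open>The relations for fixed \<open>k\<close> and \<open>l\<close> are listed so that the simplifier can turn the statement that
  they all hold into a conjunction.\<close>

definition ace_rels_at ::
    "'a::field \<Rightarrow> nat \<Rightarrow> nat \<Rightarrow> ((ace_gen, 'a) free_alg \<times> (ace_gen, 'a) free_alg) list" where
  "ace_rels_at q k l = (let Wm = free_Wm; Wp = free_Wp; G = free_G q; Gt = free_Gt q;
         \<rho> = const (- ((q\<^sup>2 - inverse q ^ 2)\<^sup>2)); d = const (inverse (q + inverse q)) in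
     [(comm (Wm 0) (Wp k), d * (Gt (k+1) - G (k+1))),
      (comm (Wm k) (Wp 0), d * (Gt (k+1) - G (k+1))),
      (qcomm q (Wm 0) (G (k+1)), \<rho> * Wm (k+1) - \<rho> * Wp k),
      (qcomm q (Gt (k+1)) (Wm 0), \<rho> * Wm (k+1) - \<rho> * Wp k),
      (qcomm q (G (k+1)) (Wp 0), \<rho> * Wp (k+1) - \<rho> * Wm k),
      (qcomm q (Wp 0) (Gt (k+1)), \<rho> * Wp (k+1) - \<rho> * Wm k),
      (comm (Wm k) (Wm l), 0),
      (comm (Wp k) (Wp l), 0),
      (comm (Wm k) (Wp l) + comm (Wp k) (Wm l), 0),
      (comm (Wm k) (G (l+1)) + comm (G (k+1)) (Wm l), 0),
      (comm (Wm k) (Gt (l+1)) + comm (Gt (k+1)) (Wm l), 0),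
      (comm (Wp k) (G (l+1)) + comm (G (k+1)) (Wp l), 0),
      (comm (Wp k) (Gt (l+1)) + comm (Gt (k+1)) (Wp l), 0),
      (comm (G (k+1)) (G (l+1)), 0),
      (comm (Gt (k+1)) (Gt (l+1)), 0),
      (comm (Gt (k+1)) (G (l+1)) + comm (G (k+1)) (Gt (l+1)), 0)])"

lemma ace_rels_at: "ace_rels q = (\<Union>k l. set (ace_rels_at q k l))"
  by (simp add: ace_rels_def ace_rels_at_def Let_def)

text \<open>Links the relations as pairs in the free algebra with the locale. One direction shows
  that the generators of \<open>ace q\<close> form a quadruple, the other yields homomorphisms out
  of \<open>ace q\<close>.\<close>

lemma respects_ace_rels_iff:
  assumes "free_alg_hom B k"
  shows "(\<forall>(l, r)\<in>ace_rels q. k l = k r) \<longleftrightarrow>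
    ace_rep B q (\<lambda>n. k (free_Wm n)) (\<lambda>n. k (free_Wp n)) (\<lambda>n. k (free_G q n)) (\<lambda>n. k (free_Gt q n))"
proof -
  interpret free_alg_hom B k by (rule assms)
  have "k (free_G q 0) = G_zero q \<odot>\<^bsub>B\<^esub> \<one>\<^bsub>B\<^esub>" "k (free_Gt q 0) = G_zero q \<odot>\<^bsub>B\<^esub> \<one>\<^bsub>B\<^esub>"
    by (simp_all add: free_G_def free_Gt_def)
  then have "ace_rep B q (\<lambda>n. k (free_Wm n)) (\<lambda>n. k (free_Wp n)) (\<lambda>n. k (free_G q n)) (\<lambda>n. k (free_Gt q n))
    \<longleftrightarrow> (\<forall>i j. list_all (\<lambda>(l, r). k l = k r) (ace_rels_at q i j))"
    unfolding ace_rep_def ace_rep_axioms_def ace_rels_at_def Let_def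
    by (simp add: B.falg_axioms k_const_mult B.smult_mult_left all_conj_distrib del: k_simps(5) add: k_simps(1-4,6))
  also have "\<dots> \<longleftrightarrow> (\<forall>(l, r)\<in>ace_rels q. k l = k r)"
    unfolding ace_rels_at list_all_iff by blast
  finally show ?thesis by simp
qed

lemma falg_ace: "falg (ace q)" and falg_onsager: "falg (onsager q)"
  by (simp_all add: ace_def onsager_def falg_presented)

lemma ace_rep_ace: "ace_rep (ace q) q (ace_Wm q) (ace_Wp q) (ace_G q) (ace_Gt q)"
proof -
  interpret c: free_alg_hom "ace q" "presented_cls (ace_rels q)"
    unfolding ace_def by (rule free_alg_homI[OF falg_presented presented_cls_hom])
  have "\<forall>(l, r)\<in>ace_rels q. presented_cls (ace_rels q) l = presented_cls (ace_rels q) r"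
    by (auto dest!: presented_cls_rel)
  then show ?thesis
    unfolding respects_ace_rels_iff[OF c.free_alg_hom_axioms]
    by (simp add: ace_Wm_def[abs_def] ace_Wp_def[abs_def] ace_G_def[abs_def] ace_Gt_def[abs_def])
qed

lemma ace_rep_lift:
  assumes "ace_rep B q a b g h"
  shows "\<exists>k\<in>alg_hom (ace q) B. \<forall>n. k (ace_Wm q n) = a n \<and> k (ace_Wp q n) = b n \<and>
    k (ace_G q n) = g n \<and> k (ace_Gt q n) = h n"
proof -
  interpret B: ace_rep B q a b g h by (rule assms)
  \<comment> \<open>The generators \<open>Gplus n\<close> and \<open>Gtilde n\<close> carry the
    subscript n + 1; subscript 0 belongs to scalars.\<close>
  define e where "e x = (case x of Wminus n \<Rightarrow> a n | Wplus n \<Rightarrow> b n | Gplus n \<Rightarrow> g (Suc n) | Gtilde n \<Rightarrow> h (Suc n))" for x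
  have e: "e x \<in> carrier B" for x by (simp add: e_def split: ace_gen.split)
  define k where "k = B.lin (B.word_prod e)"
  interpret k: free_alg_hom B k
    unfolding k_def by (rule free_alg_homI[OF B.falg_axioms B.free_alg_lift(1)[OF e]])
  have k_gen: "k (gen x) = e x" for x unfolding k_def by (rule B.free_alg_lift(2)[OF e])
  have k: "k (free_Wm n) = a n" "k (free_Wp n) = b n" "k (free_G q n) = g n" "k (free_Gt q n) = h n" for n
    by (simp_all add: free_Wm_def free_Wp_def free_G_def free_Gt_def k_gen e_def B.g_0 B.h_0 split: nat.split)
  have "\<forall>(l, r)\<in>ace_rels q. k l = k r"
    unfolding respects_ace_rels_iff[OF k.free_alg_hom_axioms] k by (rule assms)
  then have "k l = k r" if "(l, r) \<in> ace_rels q" for l r using that by blast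
  from presented_lift[OF B.falg_axioms k.k_hom this] show ?thesis
    unfolding ace_def by (metis k ace_Wm_def ace_Wp_def ace_G_def ace_Gt_def)
qed

text \<open>The quadruple is turned into a homomorphism from \<open>ace q\<close> and composed with
  \<open>f\<close>, which avoids transporting the relations one by one.\<close>

lemma ace_rep_hom:
  assumes "falg_hom A B f" and "ace_rep A q a b g h"
  shows "ace_rep B q (\<lambda>n. f (a n)) (\<lambda>n. f (b n)) (\<lambda>n. f (g n)) (\<lambda>n. f (h n))"
proof -
  interpret f: falg_hom A B f by (rule assms(1))
  interpret A: ace_rep A q a b g h by (rule assms(2))
  obtain k where k: "k \<in> alg_hom (ace q) A" "\<And>n. k (ace_Wm q n) = a n" "\<And>n. k (ace_Wp q n) = b n"
    "\<And>n. k (ace_G q n) = g n" "\<And>n. k (ace_Gt q n) = h n"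
    using ace_rep_lift[OF assms(2)] by blast
  define m where "m p = f (k (presented_cls (ace_rels q) p))" for p
  interpret m: free_alg_hom B m
    unfolding m_def
    by (rule free_alg_homI[OF f.B.falg_axioms])
      (rule alg_hom_comp[OF presented_cls_hom alg_hom_comp[OF k(1)[unfolded ace_def] f.alg_hom]])
  have "\<forall>(l, r)\<in>ace_rels q. m l = m r" unfolding m_def using presented_cls_rel by fastforce
  then have "ace_rep B q (\<lambda>n. m (free_Wm n)) (\<lambda>n. m (free_Wp n)) (\<lambda>n. m (free_G q n)) (\<lambda>n. m (free_Gt q n))"
    unfolding respects_ace_rels_iff[OF m.free_alg_hom_axioms] .
  then show ?thesis
    by (simp add: m_def k flip: ace_Wm_def ace_Wp_def ace_G_def ace_Gt_def)
qed

lemma ace_induct [consumes 1, case_names one Wm Wp G Gt add mult smult]: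
  assumes "X \<in> carrier (ace q)" and "P \<one>\<^bsub>ace q\<^esub>"
    and "\<And>n. P (ace_Wm q n)" "\<And>n. P (ace_Wp q n)" "\<And>n. P (ace_G q (Suc n))" "\<And>n. P (ace_Gt q (Suc n))"
    and "\<And>X Y. X \<in> carrier (ace q) \<Longrightarrow> Y \<in> carrier (ace q) \<Longrightarrow> P X \<Longrightarrow> P Y \<Longrightarrow> P (X \<oplus>\<^bsub>ace q\<^esub> Y)"
    and "\<And>X Y. X \<in> carrier (ace q) \<Longrightarrow> Y \<in> carrier (ace q) \<Longrightarrow> P X \<Longrightarrow> P Y \<Longrightarrow> P (X \<otimes>\<^bsub>ace q\<^esub> Y)"
    and "\<And>c X. X \<in> carrier (ace q) \<Longrightarrow> P X \<Longrightarrow> P (c \<odot>\<^bsub>ace q\<^esub> X)"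
  shows "P X"
  using assms(1)[unfolded ace_def]
proof (induction X rule: presented_induct)
  case (gen x)
  show ?case
    using assms(3-6)
    by (cases x) (simp_all add: ace_Wm_def ace_Wp_def ace_G_def ace_Gt_def free_Wm_def free_Wp_def
        free_G_def free_Gt_def)
qed (use assms(2,7-9) in \<open>simp_all add: ace_def\<close>)

lemma onsager_induct [consumes 1, case_names one W0 W1 add mult smult]:
  assumes "X \<in> carrier (onsager q)" and "P \<one>\<^bsub>onsager q\<^esub>"
    and "P (onsager_W0 q)" "P (onsager_W1 q)"
    and "\<And>X Y. X \<in> carrier (onsager q) \<Longrightarrow> Y \<in> carrier (onsager q) \<Longrightarrow> P X \<Longrightarrow> P Y \<Longrightarrow> P (X \<oplus>\<^bsub>onsager q\<^esub> Y)"
    and "\<And>X Y. X \<in> carrier (onsager q) \<Longrightarrow> Y \<in> carrier (onsager q) \<Longrightarrow> P X \<Longrightarrow> P Y \<Longrightarrow> P (X \<otimes>\<^bsub>onsager q\<^esub> Y)"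
    and "\<And>c X. X \<in> carrier (onsager q) \<Longrightarrow> P X \<Longrightarrow> P (c \<odot>\<^bsub>onsager q\<^esub> X)"
  shows "P X"
  using assms(1)[unfolded onsager_def]
proof (induction X rule: presented_induct)
  case (gen x)
  show ?case
    using assms(3,4) by (cases x) (simp_all add: onsager_W0_def onsager_W1_def)
qed (use assms(2,5-7) in \<open>simp_all add: onsager_def\<close>)

text \<open>The two relations of the q-Onsager algebra are \<open>dolan_grady\<close> for the
  quadruple and for its swapped version.\<close>

lemma onsager_lift:
  assumes "ace_rep B q a b g h" and "q + inverse q \<noteq> 0"
  shows "\<exists>k\<in>alg_hom (onsager q) B. k (onsager_W0 q) = a 0 \<and> k (onsager_W1 q) = b 0"
proof -
  interpret B: ace_rep B q a b g h by (rule assms)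
  define e where "e x = (case x of OGen0 \<Rightarrow> a 0 | OGen1 \<Rightarrow> b 0)" for x
  have e: "e x \<in> carrier B" for x by (simp add: e_def split: onsager_gen.split)
  define k where "k = B.lin (B.word_prod e)"
  interpret k: free_alg_hom B k
    unfolding k_def by (rule free_alg_homI[OF B.falg_axioms B.free_alg_lift(1)[OF e]])
  have k_gen: "k (gen OGen0) = a 0" "k (gen OGen1) = b 0"
    unfolding k_def by (simp_all add: B.free_alg_lift(2)[OF e] e_def)
  have "k l = k r" if "(l, r) \<in> onsager_rels q" for l r
    using that B.dolan_grady[OF assms(2)] ace_rep.dolan_grady[OF B.swap assms(2)]
    unfolding onsager_rels_def Let_def
    by (auto simp: k_gen k.k_const_mult simp del: k.k_simps(5))
  from presented_lift[OF B.falg_axioms k.k_hom this] show ?thesis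
    unfolding onsager_def by (metis k_gen onsager_W0_def onsager_W1_def)
qed

section \<open>The polynomial algebra in countably many variables\<close>

lemma pvar_Suc: "pvar (Suc i) = Poly_Mapping.single (Poly_Mapping.single i 1) 1"
  by (simp add: pvar_def)

lemma polys_induct [case_names one pvar add mult smult]:
  fixes p :: "(nat \<Rightarrow>\<^sub>0 nat) \<Rightarrow>\<^sub>0 'a::field"
  assumes "P 1" and "\<And>n. P (pvar n)" and "\<And>p r. P p \<Longrightarrow> P r \<Longrightarrow> P (p + r)"
    and "\<And>p r. P p \<Longrightarrow> P r \<Longrightarrow> P (p * r)" and "\<And>c p. P p \<Longrightarrow> P (Poly_Mapping.single 0 c * p)"
  shows "P p"
proof -
  have pow: "P (Poly_Mapping.single (Poly_Mapping.single i e) 1)" for i e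
  proof (induction e)
    case 0
    then show ?case using assms(1) by simp
  next
    case (Suc e)
    have "Poly_Mapping.single (Poly_Mapping.single i (Suc e)) (1::'a) =
        pvar (Suc i) * Poly_Mapping.single (Poly_Mapping.single i e) 1"
      by (simp add: pvar_Suc mult_single flip: single_add)
    then show ?case using assms(2,4) Suc by metis
  qed
  \<comment> \<open>A monomial is built one variable at a time; the new variable does not occur in
    \<open>m\<close>, so setting its exponent amounts to adding it.\<close>
  have mono: "P (Poly_Mapping.single m 1)" for m
  proof (induction m rule: update_induct)
    case const
    then show ?case using assms(1) by simp
  next
    case (update m i e)
    have "Poly_Mapping.update i e m = Poly_Mapping.single i e + m"
      using update(1) by (intro poly_mapping_eqI) (auto simp: lookup_update lookup_add lookup_single in_keys_iff when_def)
    then have "Poly_Mapping.single (Poly_Mapping.update i e m) (1::'a) =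
        Poly_Mapping.single (Poly_Mapping.single i e) 1 * Poly_Mapping.single m 1"
      by (simp add: mult_single)
    then show ?case using assms(4) pow update(3) by metis
  qed
  have s: "P (Poly_Mapping.single m c)" for m c
    using assms(5)[OF mono, of c m] by (simp add: mult_single)
  have "Poly_Mapping.keys p \<subseteq> UNIV" by simp
  then show ?thesis
  proof (induction p rule: poly_mapping_induct_single)
    case zero
    then show ?case using s[of 0 0] by simp
  qed (use s assms(3) in auto)
qed

lemma (in falg) commute_mult:
  assumes "x \<in> carrier A" "y \<in> carrier A" "w \<in> carrier A"
    and "w \<otimes> x = x \<otimes> w" "w \<otimes> y = y \<otimes> w"
  shows "w \<otimes> (x \<otimes> y) = (x \<otimes> y) \<otimes> w"
proof -
  have "w \<otimes> (x \<otimes> y) = (w \<otimes> x) \<otimes> y" using assms(1-3) by (simp add: m_assoc)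
  also have "\<dots> = x \<otimes> (w \<otimes> y)" unfolding assms(4) using assms(1-3) by (simp add: m_assoc)
  also have "\<dots> = (x \<otimes> y) \<otimes> w" unfolding assms(5) using assms(1-3) by (simp add: m_assoc)
  finally show ?thesis .
qed

text \<open>Monomials are evaluated as products in the centre, a commutative monoid in which
  \<open>finprod\<close> is available. Centrality of the whole image is recorded because the map on
  the tensor product requires commuting images.\<close>

lemma (in falg) polys_lift:
  assumes z: "\<And>n. z n \<in> carrier A" and central: "\<And>n x. x \<in> carrier A \<Longrightarrow> z n \<otimes> x = x \<otimes> z n"
    and z_0: "z 0 = \<one>"
  shows "\<exists>k\<in>alg_hom polys A. (\<forall>n. k (pvar n) = z n) \<and> (\<forall>p. \<forall>x\<in>carrier A. k p \<otimes> x = x \<otimes> k p)"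
proof -
  define M where "M = \<lparr>carrier = {x \<in> carrier A. \<forall>y\<in>carrier A. x \<otimes> y = y \<otimes> x}, mult = mult A, one = one A\<rparr>"
  have M_iff: "x \<in> carrier M \<longleftrightarrow> x \<in> carrier A \<and> (\<forall>y\<in>carrier A. x \<otimes> y = y \<otimes> x)" for x
    by (simp add: M_def)
  have M_ops: "mult M = mult A" "one M = one A" by (simp_all add: M_def)
  have M_carr: "x \<in> carrier A" if "x \<in> carrier M" for x using that M_iff by blast
  have one_M: "\<one> \<in> carrier M" unfolding M_iff by simp
  interpret M: comm_monoid M
  proof (rule comm_monoidI)
    fix x y assume "x \<in> carrier M" "y \<in> carrier M"
    then have xy: "x \<in> carrier A" "y \<in> carrier A"
      and c: "\<And>w. w \<in> carrier A \<Longrightarrow> x \<otimes> w = w \<otimes> x" "\<And>w. w \<in> carrier A \<Longrightarrow> y \<otimes> w = w \<otimes> y"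
      using M_iff by blast+
    show "x \<otimes>\<^bsub>M\<^esub> y = y \<otimes>\<^bsub>M\<^esub> x" using c(1)[OF xy(2)] by (simp add: M_ops)
    have "x \<otimes> y \<otimes> w = w \<otimes> (x \<otimes> y)" if w: "w \<in> carrier A" for w
      by (rule commute_mult[OF xy w c(1)[OF w, symmetric] c(2)[OF w, symmetric], symmetric])
    then have "x \<otimes> y \<in> carrier M" using xy M_iff by blast
    then show "x \<otimes>\<^bsub>M\<^esub> y \<in> carrier M" by (simp add: M_ops)
  qed (simp_all add: M_ops M_carr one_M m_assoc)
  have zM: "z n \<in> carrier M" for n using z central M_iff by blast
  have zM_pow: "z n [^]\<^bsub>M\<^esub> (e::nat) \<in> carrier M" for n e by (rule M.nat_pow_closed[OF zM])
  \<comment> \<open>Exponent index \<open>i\<close> belongs to the variable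
    \<open>pvar (Suc i)\<close>, hence the value \<open>z (Suc i)\<close>; the unit
    \<open>z 0\<close> has no variable of its own.\<close>
  define f where "f m = finprod M (\<lambda>i. z (Suc i) [^]\<^bsub>M\<^esub> Poly_Mapping.lookup m i) (Poly_Mapping.keys m)"
    for m :: "nat \<Rightarrow>\<^sub>0 nat"
  have fM: "f m \<in> carrier M" for m
    unfolding f_def by (rule M.finprod_closed) (simp add: Pi_iff zM zM_pow)
  then have fA: "f m \<in> carrier A" for m using M_iff by blast
  have superset: "f m = finprod M (\<lambda>i. z (Suc i) [^]\<^bsub>M\<^esub> Poly_Mapping.lookup m i) K"
    if "finite K" "Poly_Mapping.keys m \<subseteq> K" for m K
    unfolding f_def
    by (rule M.finprod_mono_neutral_cong_left) (use that in \<open>simp_all add: Pi_iff zM zM_pow in_keys_iff\<close>)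
  have "f (m + m') = f m \<otimes> f m'" for m m'
  proof -
    define K where "K = Poly_Mapping.keys m \<union> Poly_Mapping.keys m'"
    have "f (m + m') = finprod M (\<lambda>i. z (Suc i) [^]\<^bsub>M\<^esub> Poly_Mapping.lookup (m + m') i) K"
      by (rule superset) (use Poly_Mapping.keys_add[of m m'] in \<open>simp_all add: K_def\<close>)
    also have "\<dots> = finprod M (\<lambda>i. z (Suc i) [^]\<^bsub>M\<^esub> Poly_Mapping.lookup m i \<otimes>\<^bsub>M\<^esub>
        z (Suc i) [^]\<^bsub>M\<^esub> Poly_Mapping.lookup m' i) K"
      by (rule M.finprod_cong') (simp_all add: Pi_iff zM zM_pow lookup_add M.nat_pow_mult)
    also have "\<dots> = finprod M (\<lambda>i. z (Suc i) [^]\<^bsub>M\<^esub> Poly_Mapping.lookup m i) K \<otimes>\<^bsub>M\<^esub>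
        finprod M (\<lambda>i. z (Suc i) [^]\<^bsub>M\<^esub> Poly_Mapping.lookup m' i) K"
      by (rule M.finprod_multf) (simp_all add: Pi_iff zM zM_pow)
    also have "\<dots> = f m \<otimes>\<^bsub>M\<^esub> f m'"
      by (simp add: superset[of K m] superset[of K m'] K_def)
    finally show ?thesis by (simp add: M_ops)
  qed
  moreover have "f 0 = \<one>" by (simp add: f_def M_ops)
  ultimately have hom: "lin f \<in> alg_hom polys A" using fA by (intro lin_monoid_hom)
  interpret k: falg_hom polys A "lin f" by (rule falg_homI[OF falg_monoid_alg falg_axioms hom])
  have k_pvar: "lin f (pvar n) = z n" for n
  proof (cases n)
    case 0
    then show ?thesis using k.hom_one by (simp add: pvar_def z_0)
  next
    case (Suc i)
    have "f (Poly_Mapping.single i 1) = z (Suc i)"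
      by (simp add: f_def zM Pi_iff)
    moreover have "f \<in> UNIV \<rightarrow> carrier A" using fA by blast
    ultimately show ?thesis using lin_single[of f UNIV] z Suc by (simp add: pvar_Suc)
  qed
  have "lin f p \<otimes> x = x \<otimes> lin f p" if x: "x \<in> carrier A" for p x
  proof -
    have c: "f u \<in> carrier A" "f u \<otimes> x = x \<otimes> f u" for u
      using fM[of u] x M_iff by blast+
    have "lin f p \<otimes> x = (\<Oplus>u\<in>Poly_Mapping.keys p. (Poly_Mapping.lookup p u \<odot> f u) \<otimes> x)"
      unfolding lin_def by (rule finsum_ldistr) (simp_all add: c(1) x Pi_iff)
    also have "\<dots> = (\<Oplus>u\<in>Poly_Mapping.keys p. x \<otimes> (Poly_Mapping.lookup p u \<odot> f u))"
      by (rule finsum_cong') (simp_all add: c x Pi_iff smult_mult_left smult_mult_right)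
    also have "\<dots> = x \<otimes> lin f p"
      unfolding lin_def by (rule finsum_rdistr[symmetric]) (simp_all add: c(1) x Pi_iff)
    finally show ?thesis .
  qed
  with hom k_pvar show ?thesis by blast
qed

section \<open>The isomorphism\<close>

text \<open>If q = q^{-1} then q^2 = 1, and if q = - q^{-1} then q^4 = 1.\<close>

lemma q_conditions:
  fixes q :: "'a::field"
  assumes "q \<noteq> 0" and "\<forall>n>0. q ^ n \<noteq> 1"
  shows "q - inverse q \<noteq> 0" and "q + inverse q \<noteq> 0"
proof -
  have q2: "q ^ 2 \<noteq> 1" and q4: "q ^ 4 \<noteq> 1" using assms(2) by auto
  show "q - inverse q \<noteq> 0"
  proof
    assume "q - inverse q = 0"
    then have "q * (q - inverse q) = 0" by simp
    then show False using assms(1) q2 by (simp add: algebra_simps power2_eq_square)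
  qed
  show "q + inverse q \<noteq> 0"
  proof
    assume "q + inverse q = 0"
    then have "q * (q + inverse q) = 0" by simp
    then have "q ^ 2 = - 1" using assms(1) by (simp add: algebra_simps power2_eq_square eq_neg_iff_add_eq_0)
    moreover have "q ^ 4 = (q ^ 2) ^ 2" by (simp flip: power_mult)
    ultimately show False using q4 by simp
  qed
qed

section \<open>The tensor product of the q-Onsager algebra with the polynomials\<close>

lemma falg_pair_onsager_polys: "falg_pair (onsager q) polys"
  by (simp add: falg_pair_def falg_onsager falg_monoid_alg)

lemmas onsager_polys_falg_tensor = falg_pair.falg_tensor[OF falg_pair_onsager_polys]
lemmas onsager_polys_tensor_add_left = falg_pair.tensor_add_left[OF falg_pair_onsager_polys]
lemmas onsager_polys_tensor_add_right = falg_pair.tensor_add_right[OF falg_pair_onsager_polys]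
lemmas onsager_polys_tensor_closed = falg_pair.tensor_closed[OF falg_pair_onsager_polys]
lemmas onsager_polys_tensor_lift = falg_pair.tensor_lift[OF falg_pair_onsager_polys]
lemmas onsager_polys_tensor_mult = falg_pair.tensor_mult[OF falg_pair_onsager_polys]
lemmas onsager_polys_tensor_one = falg_pair.tensor_one[OF falg_pair_onsager_polys]
lemmas onsager_polys_tensor_smult_left = falg_pair.tensor_smult_left[OF falg_pair_onsager_polys]
lemmas onsager_polys_tensor_smult_right = falg_pair.tensor_smult_right[OF falg_pair_onsager_polys]
lemmas onsager_polys_tensor_induct [consumes 1, case_names tensor add] =
  falg_pair.tensor_induct[OF falg_pair_onsager_polys]

lemma tensor_left_hom: "(\<lambda>x. tensor (onsager q) polys x 1) \<in> alg_hom (onsager q) (onsager_polys q)"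
proof -
  interpret O: falg "onsager q" by (rule falg_onsager)
  show ?thesis
    using onsager_polys_tensor_mult[of _ q 1 _ 1]
    by (intro alg_homI)
      (simp_all add: onsager_polys_tensor_closed onsager_polys_tensor_add_left
        onsager_polys_tensor_smult_left onsager_polys_tensor_one)
qed

lemma tensor_right_central:
  assumes "X \<in> carrier (onsager_polys q)"
  shows "tensor (onsager q) polys \<one>\<^bsub>onsager q\<^esub> p \<otimes>\<^bsub>onsager_polys q\<^esub> X =
    X \<otimes>\<^bsub>onsager_polys q\<^esub> tensor (onsager q) polys \<one>\<^bsub>onsager q\<^esub> p"
  using assms
proof (induction X rule: onsager_polys_tensor_induct)
  case (tensor a b)
  interpret O: falg "onsager q" by (rule falg_onsager)
  show ?case using tensor by (simp add: onsager_polys_tensor_mult mult.commute)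
next
  case (add X Y)
  interpret O: falg "onsager q" by (rule falg_onsager)
  interpret T: falg "onsager_polys q" by (rule onsager_polys_falg_tensor)
  show ?case using add by (simp add: T.l_distr T.r_distr onsager_polys_tensor_closed)
qed

text \<open>Since x \<otimes> z_k = (x \<otimes> 1)(1 \<otimes> z_k), the prescribed values of
  \<phi> are convolutions inside the tensor product.\<close>

lemma tensor_conv:
  assumes "\<And>i. a i \<in> carrier (onsager q)"
  shows "(\<Oplus>\<^bsub>onsager_polys q\<^esub>k\<in>{0..n}. tensor (onsager q) polys (a (n - k)) (pvar k)) =
    falg.conv (onsager_polys q) (\<lambda>i. tensor (onsager q) polys (a i) 1)
      (\<lambda>k. tensor (onsager q) polys \<one>\<^bsub>onsager q\<^esub> (pvar k)) n"
proof -
  interpret O: falg "onsager q" by (rule falg_onsager)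
  interpret T: falg "onsager_polys q" by (rule onsager_polys_falg_tensor)
  show ?thesis
    unfolding T.conv_def
    by (rule T.finsum_cong') (simp_all add: Pi_iff assms onsager_polys_tensor_closed onsager_polys_tensor_mult)
qed

text \<open>The images of the generators under \<gamma> form a quadruple. At index zero
  \<open>alt_G\<close> and \<open>alt_Gt\<close> are scalars by definition, which agrees with the
  value of \<gamma> there.\<close>

lemma alternating_rep:
  assumes "is_gamma q \<gamma>"
  shows "ace_rep (onsager q) q (alt_Wm q \<gamma>) (alt_Wp q \<gamma>) (alt_G q \<gamma>) (alt_Gt q \<gamma>)"
proof -
  have "falg_hom (ace q) (onsager q) \<gamma>"
    using assms by (intro falg_homI falg_ace falg_onsager) (simp add: is_gamma_def)
  from ace_rep_hom[OF this ace_rep_ace]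
  have rep: "ace_rep (onsager q) q (\<lambda>n. \<gamma> (ace_Wm q n)) (\<lambda>n. \<gamma> (ace_Wp q n))
      (\<lambda>n. \<gamma> (ace_G q n)) (\<lambda>n. \<gamma> (ace_Gt q n))" .
  have "alt_Wm q \<gamma> = (\<lambda>n. \<gamma> (ace_Wm q n))" "alt_Wp q \<gamma> = (\<lambda>n. \<gamma> (ace_Wp q n))"
    "alt_G q \<gamma> = (\<lambda>n. \<gamma> (ace_G q n))" "alt_Gt q \<gamma> = (\<lambda>n. \<gamma> (ace_Gt q n))"
    using ace_rep.g_0[OF rep] ace_rep.h_0[OF rep]
    by (simp_all add: fun_eq_iff alt_Wm_def alt_Wp_def alt_G_def alt_Gt_def)
  then show ?thesis using rep by simp
qed

text \<open>The alternating generators, embedded by \<open>x \<otimes> 1\<close>, are convolved with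
  the elements \<open>1 \<otimes> z_k\<close>, which are central and begin with the unit.\<close>

lemma varphi_exists:
  assumes q: "q \<noteq> 0" "q - inverse q \<noteq> 0" and "is_gamma q \<gamma>"
  shows "\<exists>\<phi>. is_varphi q \<gamma> \<phi>"
proof -
  let ?t = "\<lambda>x. tensor (onsager q) polys x 1"
  let ?z = "\<lambda>k. tensor (onsager q) polys \<one>\<^bsub>onsager q\<^esub> (pvar k)"
  interpret O: ace_rep "onsager q" q "alt_Wm q \<gamma>" "alt_Wp q \<gamma>" "alt_G q \<gamma>" "alt_Gt q \<gamma>"
    by (rule alternating_rep[OF assms(3)])
  have "ace_rep (onsager_polys q) q (\<lambda>n. ?t (alt_Wm q \<gamma> n)) (\<lambda>n. ?t (alt_Wp q \<gamma> n))
      (\<lambda>n. ?t (alt_G q \<gamma> n)) (\<lambda>n. ?t (alt_Gt q \<gamma> n))"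
    by (rule ace_rep_hom[OF _ O.ace_rep_axioms])
      (rule falg_homI[OF falg_onsager onsager_polys_falg_tensor tensor_left_hom])
  then interpret C: central_conv_rep "onsager_polys q" q "\<lambda>n. ?t (alt_Wm q \<gamma> n)" "\<lambda>n. ?t (alt_Wp q \<gamma> n)"
      "\<lambda>n. ?t (alt_G q \<gamma> n)" "\<lambda>n. ?t (alt_Gt q \<gamma> n)" ?z
    unfolding central_conv_rep_def central_conv_rep_axioms_def conv_rep_def conv_rep_axioms_def
    using q by (simp add: onsager_polys_tensor_closed tensor_right_central onsager_polys_tensor_one pvar_def)
  from ace_rep_lift[OF C.ace_rep_conv] show ?thesis
    unfolding is_varphi_def Let_def
    by (simp add: tensor_conv) blast
qed

lemma varphi_iso:
  assumes q: "q \<noteq> 0" "q - inverse q \<noteq> 0" "q + inverse q \<noteq> 0"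
    and \<gamma>: "is_gamma q \<gamma>" and \<phi>: "is_varphi q \<gamma> \<phi>"
  shows "\<phi> \<in> alg_iso (ace q) (onsager_polys q)"
proof -
  let ?A = "ace q" and ?O = "onsager q" and ?T = "onsager_polys q"
  let ?t = "\<lambda>x. tensor ?O polys x 1"
  let ?z = "\<lambda>k. tensor ?O polys \<one>\<^bsub>?O\<^esub> (pvar k)"
  interpret A: falg ?A by (rule falg_ace)
  interpret T: falg ?T by (rule onsager_polys_falg_tensor)
  interpret O: ace_rep ?O q "alt_Wm q \<gamma>" "alt_Wp q \<gamma>" "alt_G q \<gamma>" "alt_Gt q \<gamma>"
    by (rule alternating_rep[OF \<gamma>])
  have alt_0: "alt_Wm q \<gamma> 0 = onsager_W0 q" "alt_Wp q \<gamma> 0 = onsager_W1 q"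
    using \<gamma> by (simp_all add: is_gamma_def alt_Wm_def alt_Wp_def)
  have \<phi>_hom: "\<phi> \<in> alg_hom ?A ?T" using \<phi> by (simp add: is_varphi_def Let_def)
  interpret \<phi>: falg_hom ?A ?T \<phi> by (rule falg_homI[OF A.falg_axioms T.falg_axioms \<phi>_hom])
  have t_closed: "?t x \<in> carrier ?T" if "x \<in> carrier ?O" for x
    using that by (simp add: onsager_polys_tensor_closed)
  have z_closed: "?z k \<in> carrier ?T" for k by (simp add: onsager_polys_tensor_closed)
  have \<phi>_gen: "\<phi> (ace_Wm q n) = T.conv (\<lambda>i. ?t (alt_Wm q \<gamma> i)) ?z n"
    "\<phi> (ace_Wp q n) = T.conv (\<lambda>i. ?t (alt_Wp q \<gamma> i)) ?z n"
    "\<phi> (ace_G q n) = T.conv (\<lambda>i. ?t (alt_G q \<gamma> i)) ?z n"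
    "\<phi> (ace_Gt q n) = T.conv (\<lambda>i. ?t (alt_Gt q \<gamma> i)) ?z n" for n
    using \<phi> by (simp_all add: is_varphi_def Let_def tensor_conv)
  obtain \<kappa> where \<kappa>_hom: "\<kappa> \<in> alg_hom ?O ?A"
    and \<kappa>_gen: "\<kappa> (onsager_W0 q) = ace_Wm q 0" "\<kappa> (onsager_W1 q) = ace_Wp q 0"
    using onsager_lift[OF ace_rep_ace q(3)] by blast
  interpret \<kappa>: falg_hom ?O ?A \<kappa> by (rule falg_homI[OF falg_onsager A.falg_axioms \<kappa>_hom])
  \<comment> \<open>The big family consists of the generators of the extension. Its initial terms
    agree with those of the small one because \<gamma> sends them to the Onsager generators and
    \<kappa> sends these back.\<close>
  interpret Z: two_reps ?A q "\<lambda>n. \<kappa> (alt_Wm q \<gamma> n)" "\<lambda>n. \<kappa> (alt_Wp q \<gamma> n)" "\<lambda>n. \<kappa> (alt_G q \<gamma> n)"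
      "\<lambda>n. \<kappa> (alt_Gt q \<gamma> n)" "ace_Wm q" "ace_Wp q" "ace_G q" "ace_Gt q"
    unfolding two_reps_def two_reps_axioms_def
    using ace_rep_hom[OF \<kappa>.falg_hom_axioms O.ace_rep_axioms] ace_rep_ace q
    by (simp add: alt_0 \<kappa>_gen)
  \<comment> \<open>The centralizer of \<open>y\<close> is a subalgebra, and the image of \<kappa>
    is generated by the images of the two Onsager generators.\<close>
  have \<kappa>_comm: "y \<otimes>\<^bsub>?A\<^esub> \<kappa> x = \<kappa> x \<otimes>\<^bsub>?A\<^esub> y"
    if "x \<in> carrier ?O" "y \<in> carrier ?A" "y \<otimes>\<^bsub>?A\<^esub> ace_Wm q 0 = ace_Wm q 0 \<otimes>\<^bsub>?A\<^esub> y"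
      "y \<otimes>\<^bsub>?A\<^esub> ace_Wp q 0 = ace_Wp q 0 \<otimes>\<^bsub>?A\<^esub> y" for x y
    using that(1)
  proof (induction x rule: onsager_induct)
    case (mult X Y)
    then show ?case using that(2) A.commute_mult[of "\<kappa> X" "\<kappa> Y" y] by simp
  qed (use that(2-4) in \<open>simp_all add: \<kappa>_gen A.l_distr A.r_distr A.smult_mult_left A.smult_mult_right\<close>)
  have central: "Z.zeta n \<otimes>\<^bsub>?A\<^esub> x = x \<otimes>\<^bsub>?A\<^esub> Z.zeta n" if "x \<in> carrier ?A" for x n
  proof (rule Z.zeta_central[OF _ _ that])
    fix y i assume "y \<in> carrier ?A" "y \<otimes>\<^bsub>?A\<^esub> \<kappa> (alt_Wm q \<gamma> 0) = \<kappa> (alt_Wm q \<gamma> 0) \<otimes>\<^bsub>?A\<^esub> y"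
      "y \<otimes>\<^bsub>?A\<^esub> \<kappa> (alt_Wp q \<gamma> 0) = \<kappa> (alt_Wp q \<gamma> 0) \<otimes>\<^bsub>?A\<^esub> y"
    then show "y \<otimes>\<^bsub>?A\<^esub> \<kappa> (alt_Wm q \<gamma> i) = \<kappa> (alt_Wm q \<gamma> i) \<otimes>\<^bsub>?A\<^esub> y \<and>
        y \<otimes>\<^bsub>?A\<^esub> \<kappa> (alt_Wp q \<gamma> i) = \<kappa> (alt_Wp q \<gamma> i) \<otimes>\<^bsub>?A\<^esub> y \<and>
        y \<otimes>\<^bsub>?A\<^esub> \<kappa> (alt_G q \<gamma> i) = \<kappa> (alt_G q \<gamma> i) \<otimes>\<^bsub>?A\<^esub> y \<and>
        y \<otimes>\<^bsub>?A\<^esub> \<kappa> (alt_Gt q \<gamma> i) = \<kappa> (alt_Gt q \<gamma> i) \<otimes>\<^bsub>?A\<^esub> y"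
      unfolding alt_0 \<kappa>_gen by (intro conjI \<kappa>_comm) (rule O.a_carr O.b_carr O.g_carr O.h_carr | assumption)+
  next
    fix y x assume y: "y \<in> carrier ?A" and c: "\<And>i. y \<otimes>\<^bsub>?A\<^esub> ace_Wm q i = ace_Wm q i \<otimes>\<^bsub>?A\<^esub> y \<and>
      y \<otimes>\<^bsub>?A\<^esub> ace_Wp q i = ace_Wp q i \<otimes>\<^bsub>?A\<^esub> y \<and>
      y \<otimes>\<^bsub>?A\<^esub> ace_G q (Suc i) = ace_G q (Suc i) \<otimes>\<^bsub>?A\<^esub> y \<and>
      y \<otimes>\<^bsub>?A\<^esub> ace_Gt q (Suc i) = ace_Gt q (Suc i) \<otimes>\<^bsub>?A\<^esub> y"
    assume "x \<in> carrier ?A"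
    then show "y \<otimes>\<^bsub>?A\<^esub> x = x \<otimes>\<^bsub>?A\<^esub> y"
    proof (induction x rule: ace_induct)
      case (mult X Y)
      then show ?case using y by (intro A.commute_mult)
    qed (use y c in \<open>simp_all add: A.l_distr A.r_distr A.smult_mult_left A.smult_mult_right\<close>)
  qed
  obtain p where p_hom: "p \<in> alg_hom polys ?A" and p_pvar: "\<And>n. p (pvar n) = Z.zeta n"
    and p_central: "\<And>r x. x \<in> carrier ?A \<Longrightarrow> p r \<otimes>\<^bsub>?A\<^esub> x = x \<otimes>\<^bsub>?A\<^esub> p r"
    using A.polys_lift[of Z.zeta, OF Z.zeta_carr central Z.zeta_0] by blast
  obtain \<eta> where \<eta>_hom: "\<eta> \<in> alg_hom ?T ?A"
    and \<eta>: "\<And>x r. x \<in> carrier ?O \<Longrightarrow> \<eta> (tensor ?O polys x r) = \<kappa> x \<otimes>\<^bsub>?A\<^esub> p r"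
  proof -
    have "\<kappa> x \<otimes>\<^bsub>?A\<^esub> p r = p r \<otimes>\<^bsub>?A\<^esub> \<kappa> x" if "x \<in> carrier ?O" for x r
      by (rule p_central[symmetric]) (rule \<kappa>.hom_closed[OF that])
    from onsager_polys_tensor_lift[OF A.falg_axioms \<kappa>_hom p_hom this] that show thesis by auto
  qed
  interpret \<eta>: falg_hom ?T ?A \<eta> by (rule falg_homI[OF T.falg_axioms A.falg_axioms \<eta>_hom])
  \<comment> \<open>As \<eta> sends \<open>x \<otimes> 1\<close> to \<open>\<kappa> x\<close> and
    \<open>1 \<otimes> z_k\<close> to \<open>zeta k\<close>, it turns the values of \<phi> on
    generators into the convolutions that reproduce those generators.\<close>
  have \<eta>_conv: "\<eta> (T.conv (\<lambda>i. ?t (a i)) ?z n) = A.conv (\<lambda>i. \<kappa> (a i)) Z.zeta n"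
    if a: "\<And>i. a i \<in> carrier ?O" for a n
  proof -
    have "\<eta> (T.conv (\<lambda>i. ?t (a i)) ?z n) = (\<Oplus>\<^bsub>?A\<^esub>k\<in>{0..n}. \<eta> (tensor ?O polys (a (n - k)) (pvar k)))"
      unfolding tensor_conv[OF a, symmetric]
      by (rule \<eta>.hom_sum) (simp_all add: a onsager_polys_tensor_closed Pi_iff)
    also have "\<dots> = A.conv (\<lambda>i. \<kappa> (a i)) Z.zeta n"
      by (simp add: A.conv_def \<eta> a p_pvar)
    finally show ?thesis .
  qed
  have conv_zeta: "A.conv (\<lambda>i. \<kappa> (alt_Wm q \<gamma> i)) Z.zeta n = ace_Wm q n"
    "A.conv (\<lambda>i. \<kappa> (alt_Wp q \<gamma> i)) Z.zeta n = ace_Wp q n"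
    "A.conv (\<lambda>i. \<kappa> (alt_G q \<gamma> i)) Z.zeta n = ace_G q n"
    "A.conv (\<lambda>i. \<kappa> (alt_Gt q \<gamma> i)) Z.zeta n = ace_Gt q n" for n
    using Z.zeta_conv[of n] Z.g'_conv[of n] by metis+
  have \<eta>_\<phi>: "\<eta> (\<phi> x) = x" if "x \<in> carrier ?A" for x
    using that
  proof (induction x rule: ace_induct)
    case (Wm n)
    show ?case by (simp add: \<phi>_gen \<eta>_conv conv_zeta)
  next
    case (Wp n)
    show ?case by (simp add: \<phi>_gen \<eta>_conv conv_zeta)
  next
    case (G n)
    show ?case by (simp add: \<phi>_gen \<eta>_conv conv_zeta)
  next
    case (Gt n)
    show ?case by (simp add: \<phi>_gen \<eta>_conv conv_zeta)
  qed simp_all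
  have \<phi>_\<kappa>: "\<phi> (\<kappa> x) = ?t x" if "x \<in> carrier ?O" for x
  proof -
    have z_0: "?z 0 = \<one>\<^bsub>?T\<^esub>" by (simp add: onsager_polys_tensor_one pvar_def)
    interpret t: falg_hom ?O ?T ?t by (rule falg_homI[OF falg_onsager T.falg_axioms tensor_left_hom])
    \<comment> \<open>At index zero a convolution has only the term with z_0 = 1, so \<phi> sends
      W_0 and W_1 to pure tensors.\<close>
    have gen: "T.conv (\<lambda>i. ?t (a i)) ?z 0 = ?t (a 0)" if "\<And>i. a i \<in> carrier ?O" for a
      using that T.conv_0[OF z_closed, of "\<lambda>i. ?t (a i)"] t_closed by (simp add: z_0)
    show ?thesis using that
    proof (induction x rule: onsager_induct)
      case W0
      have "\<phi> (ace_Wm q 0) = ?t (alt_Wm q \<gamma> 0)" unfolding \<phi>_gen by (rule gen) (rule O.a_carr)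
      then show ?case unfolding \<kappa>_gen alt_0 .
    next
      case W1
      have "\<phi> (ace_Wp q 0) = ?t (alt_Wp q \<gamma> 0)" unfolding \<phi>_gen by (rule gen) (rule O.b_carr)
      then show ?case unfolding \<kappa>_gen alt_0 .
    qed simp_all
  qed
  \<comment> \<open>The value of \<phi> at \<open>zeta n\<close> is not prescribed. Applying \<phi>
    to the factorization of \<open>ace_G q\<close> yields a second factorization of the image with
    the same left factor, whose invertible zeroth term allows cancellation.\<close>
  have \<phi>_zeta: "\<phi> (Z.zeta n) = ?z n" for n
  proof (rule T.conv_cancel[of "\<lambda>i. ?t (alt_G q \<gamma> i)" "G_zero q"])
    show "?t (alt_G q \<gamma> 0) = G_zero q \<odot>\<^bsub>?T\<^esub> \<one>\<^bsub>?T\<^esub>"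
      by (simp add: O.g_0 onsager_polys_tensor_smult_left onsager_polys_tensor_one)
    fix n
    have "\<phi> (ace_G q n) = \<phi> (\<Oplus>\<^bsub>?A\<^esub>k\<in>{0..n}. \<kappa> (alt_G q \<gamma> (n - k)) \<otimes>\<^bsub>?A\<^esub> Z.zeta k)"
      using arg_cong[OF Z.g'_conv[of n], of \<phi>] unfolding A.conv_def .
    also have "\<dots> = (\<Oplus>\<^bsub>?T\<^esub>k\<in>{0..n}. \<phi> (\<kappa> (alt_G q \<gamma> (n - k)) \<otimes>\<^bsub>?A\<^esub> Z.zeta k))"
      by (rule \<phi>.hom_sum) (simp_all add: Pi_iff)
    also have "\<dots> = T.conv (\<lambda>i. ?t (alt_G q \<gamma> i)) (\<lambda>k. \<phi> (Z.zeta k)) n"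
      by (simp add: T.conv_def \<phi>_\<kappa>)
    finally show "T.conv (\<lambda>i. ?t (alt_G q \<gamma> i)) (\<lambda>k. \<phi> (Z.zeta k)) n = T.conv (\<lambda>i. ?t (alt_G q \<gamma> i)) ?z n"
      by (simp add: \<phi>_gen)
  qed (simp_all add: t_closed z_closed Z.G_zero_nz)
  have right: "tensor ?O polys \<one>\<^bsub>?O\<^esub> r \<in> \<phi> ` carrier ?A" for r
  proof (induction r rule: polys_induct)
    case one
    have "\<phi> \<one>\<^bsub>?A\<^esub> = tensor ?O polys \<one>\<^bsub>?O\<^esub> 1" by (simp add: onsager_polys_tensor_one)
    then show ?case using A.one_closed by (intro image_eqI[of _ \<phi>]) (rule sym)
  next
    case (pvar n)
    show ?case by (rule image_eqI[of _ \<phi>, OF \<phi>_zeta[symmetric] Z.zeta_carr])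
  next
    case (add r s)
    then obtain x y where xy: "x \<in> carrier ?A" "y \<in> carrier ?A"
      "tensor ?O polys \<one>\<^bsub>?O\<^esub> r = \<phi> x" "tensor ?O polys \<one>\<^bsub>?O\<^esub> s = \<phi> y" by blast
    have "tensor ?O polys \<one>\<^bsub>?O\<^esub> (r + s) = \<phi> (x \<oplus>\<^bsub>?A\<^esub> y)"
      using xy onsager_polys_tensor_add_right[of "\<one>\<^bsub>?O\<^esub>" q r s] by simp
    then show ?case using xy by blast
  next
    case (mult r s)
    then obtain x y where xy: "x \<in> carrier ?A" "y \<in> carrier ?A"
      "tensor ?O polys \<one>\<^bsub>?O\<^esub> r = \<phi> x" "tensor ?O polys \<one>\<^bsub>?O\<^esub> s = \<phi> y" by blast
    have "tensor ?O polys \<one>\<^bsub>?O\<^esub> (r * s) = \<phi> (x \<otimes>\<^bsub>?A\<^esub> y)"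
      using xy onsager_polys_tensor_mult[of "\<one>\<^bsub>?O\<^esub>" q r "\<one>\<^bsub>?O\<^esub>" s] by simp
    then show ?case using xy by blast
  next
    case (smult c r)
    then obtain x where x: "x \<in> carrier ?A" "tensor ?O polys \<one>\<^bsub>?O\<^esub> r = \<phi> x" by blast
    have "tensor ?O polys \<one>\<^bsub>?O\<^esub> (Poly_Mapping.single 0 c * r) = \<phi> (c \<odot>\<^bsub>?A\<^esub> x)"
      using x onsager_polys_tensor_smult_right[of "\<one>\<^bsub>?O\<^esub>" q r c] by (simp add: monoid_alg_smult)
    then show ?case using x by blast
  qed
  have "X \<in> \<phi> ` carrier ?A" if "X \<in> carrier ?T" for X
    using that
  proof (induction X rule: onsager_polys_tensor_induct)
    case (tensor x r)
    obtain y where y: "y \<in> carrier ?A" "tensor ?O polys \<one>\<^bsub>?O\<^esub> r = \<phi> y" using right by blast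
    have "tensor ?O polys x r = ?t x \<otimes>\<^bsub>?T\<^esub> tensor ?O polys \<one>\<^bsub>?O\<^esub> r"
      using tensor(1) by (simp add: onsager_polys_tensor_mult)
    also have "\<dots> = \<phi> (\<kappa> x \<otimes>\<^bsub>?A\<^esub> y)"
      unfolding y(2) \<phi>_\<kappa>[OF tensor(1), symmetric] using tensor(1) y(1) by simp
    finally have "tensor ?O polys x r = \<phi> (\<kappa> x \<otimes>\<^bsub>?A\<^esub> y)" .
    then show ?case by (rule image_eqI[of _ \<phi>]) (simp add: tensor(1) y(1))
  next
    case (add X Y)
    then obtain x y where "x \<in> carrier ?A" "y \<in> carrier ?A" "X = \<phi> x" "Y = \<phi> y" by blast
    then have "X \<oplus>\<^bsub>?T\<^esub> Y = \<phi> (x \<oplus>\<^bsub>?A\<^esub> y)" "x \<oplus>\<^bsub>?A\<^esub> y \<in> carrier ?A" by simp_all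
    then show ?case by blast
  qed
  then have "\<phi> ` carrier ?A = carrier ?T" using \<phi>.hom_closed by blast
  moreover have "inj_on \<phi> (carrier ?A)" by (rule inj_on_inverseI) (rule \<eta>_\<phi>)
  ultimately show ?thesis using \<phi>_hom by (simp add: alg_iso_def bij_betw_def)
qed

text \<open>The conditions on \<phi> fix it on the carrier only, so bijectivity is claimed for every
  such \<phi>; the existence part keeps this from holding vacuously.\<close>

theorem theorem13p5:
  fixes q :: "'a::field"
    and \<gamma> :: "(ace_gen, 'a) free_alg set \<Rightarrow> (onsager_gen, 'a) free_alg set"
  assumes "q \<noteq> 0"
    and "\<forall>n>0. q ^ n \<noteq> 1"
    and "is_gamma q \<gamma>"
  shows "(\<exists>\<phi>. is_varphi q \<gamma> \<phi>) \<and> (\<forall>\<phi>. is_varphi q \<gamma> \<phi> \<longrightarrow> \<phi> \<in> alg_iso (ace q) (onsager_polys q))"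
  using varphi_exists[OF assms(1) q_conditions(1)[OF assms(1,2)] assms(3)]
    varphi_iso[OF assms(1) q_conditions[OF assms(1,2)] assms(3)] by blast

end
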